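(* Let $X_1,X_2,\dots$ be independent non-degenerate random variables with $\mathbb{E}X_i=0$ and $\sup_{i\ge1}\mathbb{E}|X_i|^{4+\varepsilon}\le M<\infty$ for some $\varepsilon>0$, and $B_n^2\ge cn$ for some $c>0$. Let $0\le\gamma\le1$ and $\rho<1/3$. Suppose either (a) $\sum_{i=1}^n\mathbb{E}X_i^3=O(n^\gamma)$ and $x=x_n$ satisfies $x_n=o(n^{1/2-\gamma/3})$ and $x_n=O(n^\rho)$, or (b) $\sum_{i=1}^n\mathbb{E}X_i^3=o(n^\gamma)$ and $x_n=O(n^{1/2-\gamma/3})$ and $x_n=O(n^\rho)$. Then if $x_n\to\infty$, $$\frac{\mathbb{P}(S_n\ge xV_n)}{1-\Phi(x)}=\exp\Big\{-\frac1{12}\frac{x^4\sum_{i=1}^n\mathbb{E}X_i^4}{B_n^4}(1+o(1))\Big\}(1+o(1)).$$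
   Context: $S_n=\sum_{i=1}^nX_i$, $V_n^2=\sum_{i=1}^nX_i^2$ ($V_n\ge0$), $B_n^2=\sum_{i=1}^n\mathbb{E}X_i^2$, $\Phi$ the standard normal distribution function. *)

theory Defs
  imports "HOL-Probability.Probability" "HOL-Library.Landau_Symbols"
begin

definition Phi :: "real \<Rightarrow> real" where
  "Phi x = measure (density lborel std_normal_density) {..x}"

definition S_n :: "(nat \<Rightarrow> 'a \<Rightarrow> real) \<Rightarrow> nat \<Rightarrow> 'a \<Rightarrow> real" where
  "S_n X n \<omega> = (\<Sum>i=1..n. X i \<omega>)"

definition V_n :: "(nat \<Rightarrow> 'a \<Rightarrow> real) \<Rightarrow> nat \<Rightarrow> 'a \<Rightarrow> real" where
  "V_n X n \<omega> = sqrt (\<Sum>i=1..n. (X i \<omega>)\<^sup>2)"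

definition B_n_sq :: "'a measure \<Rightarrow> (nat \<Rightarrow> 'a \<Rightarrow> real) \<Rightarrow> nat \<Rightarrow> real" where
  "B_n_sq M X n = (\<Sum>i=1..n. integral\<^sup>L M (\<lambda>\<omega>. (X i \<omega>)\<^sup>2))"

end

(* Put h = x / B_n, u = h V_n and W = h S_n - u^2/2 - x^2/2. Since h x V_n = x u <= (u^2 + x^2)/2, the
   event W >= 0 implies S_n >= x V_n, and conversely S_n >= x V_n with |u - x| <= eta forces
   W >= -eta^2/2. Tilting by exp(h S_n - u^2/2), which is a product of the bounded factors exp(y - y^2/2)
   with y = h X_i, makes W approximately N(0, x^2), and P(W >= -d) becomes
   Z exp(-x^2/2) E[e^(-W); W >= -d] under the tilted law. A local limit theorem, proved by smoothing with
   the Cauchy kernel 1/(1 + w^2), whose Fourier transform is a multiple of exp(-|t|), evaluates the last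
   expectation as e^d / (x sqrt(2 pi)); together with Mills' ratio this gives P(S_n >= x V_n) ~ Z (1 - Phi(x)).
   From exp(y - y^2/2) = 1 + y - y^3/3 - y^4/12 + O(|y|^r), 4 < r <= 5, one gets
   ln Z = -(1/3) h^3 sum E X_i^3 - (1/12) h^4 sum E X_i^4 (1 + o(1)), whose first term tends to 0 by the
   assumptions on x. The part of the event where u is not close to x is negligible, by exponential Markov
   inequalities for h S_n - theta u^2 with other values of theta. *)
theory Submission
  imports Defs "HOL-Real_Asymp.Real_Asymp"
begin

text \<open>With only 4 + eps moments exp(h X_i) may have infinite mean; the factor exp(-(h
  X_i)^2/2) supplied by self-normalisation is what makes an exponential change of measure possible.
  Errors are governed by n h^4, which is comparable with x^4/n. Since rho < 1/3 it is o(x), but it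
  need not stay bounded: Z may tend to 0, so discarded events must be small relative to Z (1 -
  Phi(x)), not just to 1 - Phi(x). This fixes the width eta of the window around u = x. At u = x the
  Markov bound gives exactly exp(-x^2/2) for every theta, so the gain, of order x eta, has to exceed
  a multiple of n h^4; as n h^4 / x -> 0, this is compatible with eta -> 0. A central limit theorem
  for W / x is not enough, because exp(-w) acts at scale 1 while W spreads over scale x. Hence
  characteristic functions are needed for |t| up to a multiple of 1/h; beyond that only the trivial
  bound 1 is available, and there the decay of exp(-|t|) beats the factor x.\<close>

section \<open>Taylor remainders valid on the whole line\<close>

definition tilt :: "real \<Rightarrow> real" where
  "tilt y = y - y\<^sup>2 / 2"

text \<open>On |y| < d <= 1 the order k suffices, since there powers decrease with the exponent; on
  |y| >= d both 1 and |y|^m are at most a constant times |y|^r because r >= m. Every exponent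
  between the growth order m and the local order k is available, including the non-integer one that
  matches the moments.\<close>

lemma remainder_bound:
  fixes g :: "real \<Rightarrow> real"
  assumes loc: "g \<in> O[at 0](\<lambda>y. y ^ k)" and g0: "g 0 = 0"
    and glob: "\<And>y. \<bar>g y\<bar> \<le> K * (1 + \<bar>y\<bar> ^ m)"
    and r: "real m \<le> r" "r \<le> real k"
  obtains C where "C \<ge> 0" "\<And>y. \<bar>g y\<bar> \<le> C * \<bar>y\<bar> powr r"
proof -
  obtain c where c: "c > 0" "\<forall>\<^sub>F y in at 0. norm (g y) \<le> c * norm (y ^ k)"
    using landau_o.bigE[OF loc] by blast
  then obtain d0 where d0: "d0 > 0" "\<And>y. y \<noteq> 0 \<Longrightarrow> \<bar>y\<bar> < d0 \<Longrightarrow> \<bar>g y\<bar> \<le> c * \<bar>y\<bar> ^ k"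
    unfolding eventually_at by (auto simp: dist_norm power_abs abs_mult)
  define d where "d = min d0 1"
  have d: "0 < d" "d \<le> 1" "d \<le> d0" using d0 by (auto simp: d_def)
  have K: "K \<ge> 0" using glob[of 0] g0 by (cases m) (auto simp: zero_le_mult_iff)
  \<comment> \<open>The two fractions are the factors by which |y|^r has to be multiplied to
    dominate 1 and |y|^m for |y| >= d.\<close>
  define C where "C = c + K * (1 / d powr r + 1 / d powr (r - real m))"
  have C1: "c \<le> C" using K d by (auto simp: C_def)
  have "\<bar>g y\<bar> \<le> C * \<bar>y\<bar> powr r" for y
  proof -
    consider "y = 0" | "y \<noteq> 0" "\<bar>y\<bar> < d" | "\<bar>y\<bar> \<ge> d" by linarith
    then show ?thesis
    proof cases
      case 2
      have "\<bar>g y\<bar> \<le> c * \<bar>y\<bar> ^ k" using d0(2)[of y] 2 d by auto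
      also have "\<bar>y\<bar> ^ k = \<bar>y\<bar> powr real k" using 2 by (simp add: powr_realpow)
      also have "\<dots> \<le> \<bar>y\<bar> powr r" using 2 d r by (intro powr_mono') auto
      finally have "\<bar>g y\<bar> \<le> c * \<bar>y\<bar> powr r" using c(1) by simp
      also have "\<dots> \<le> C * \<bar>y\<bar> powr r" using C1 by (intro mult_right_mono) auto
      finally show ?thesis .
    next
      case 3
      have y: "\<bar>y\<bar> > 0" using 3 d by linarith
      have "d powr r \<le> \<bar>y\<bar> powr r" using 3 d r by (intro powr_mono2) auto
      then have a: "1 \<le> 1 / d powr r * \<bar>y\<bar> powr r" using d by (simp add: field_simps)
      have "d powr (r - real m) \<le> \<bar>y\<bar> powr (r - real m)" using 3 d r by (intro powr_mono2) auto
      then have "1 \<le> 1 / d powr (r - real m) * \<bar>y\<bar> powr (r - real m)" using d by (simp add: field_simps)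
      then have "\<bar>y\<bar> ^ m * 1 \<le> \<bar>y\<bar> ^ m * (1 / d powr (r - real m) * \<bar>y\<bar> powr (r - real m))"
        by (intro mult_left_mono) auto
      also have "\<dots> = 1 / d powr (r - real m) * (\<bar>y\<bar> powr real m * \<bar>y\<bar> powr (r - real m))"
        using y by (simp add: powr_realpow)
      also have "\<dots> = 1 / d powr (r - real m) * \<bar>y\<bar> powr r"
        by (subst powr_add[symmetric]) simp
      finally have b: "\<bar>y\<bar> ^ m \<le> 1 / d powr (r - real m) * \<bar>y\<bar> powr r" by simp
      have "\<bar>g y\<bar> \<le> K * (1 + \<bar>y\<bar> ^ m)" by (rule glob)
      also have "\<dots> \<le> K * (1 / d powr r * \<bar>y\<bar> powr r + 1 / d powr (r - real m) * \<bar>y\<bar> powr r)"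
        using a b K by (intro mult_left_mono add_mono) auto
      also have "\<dots> = (C - c) * \<bar>y\<bar> powr r" by (simp add: C_def algebra_simps)
      also have "\<dots> \<le> C * \<bar>y\<bar> powr r" using c by (intro mult_right_mono) auto
      finally show ?thesis .
    qed (use g0 in simp)
  qed
  moreover have "C \<ge> 0" using C1 c by simp
  ultimately show ?thesis using that by blast
qed

corollary remainder_bound_power:
  fixes g :: "real \<Rightarrow> real"
  assumes "g \<in> O[at 0](\<lambda>y. y ^ k)" "g 0 = 0" "\<And>y. \<bar>g y\<bar> \<le> K * (1 + \<bar>y\<bar> ^ k)" "k > 0"
  obtains C where "C \<ge> 0" "\<And>y. \<bar>g y\<bar> \<le> C * \<bar>y\<bar> ^ k"
proof -
  obtain C where C: "C \<ge> 0" "\<And>y. \<bar>g y\<bar> \<le> C * \<bar>y\<bar> powr real k"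
    using remainder_bound[OF assms(1-3), of "real k"] by auto
  have "\<bar>y\<bar> powr real k = \<bar>y\<bar> ^ k" for y :: real
    using \<open>k > 0\<close> by (cases "y = 0") (auto simp: powr_realpow)
  with C show ?thesis using that by metis
qed

lemma exp_tilt_le: "exp (tilt y) \<le> exp (1 / 2)"
proof -
  have "0 \<le> (y - 1)\<^sup>2" by simp
  then show ?thesis by (simp add: tilt_def power2_eq_square algebra_simps)
qed

text \<open>For s = - \<open>tilt y\<close> > 0 the inequality s/k <= exp(s/k) gives s^k exp(-s) <=
  k^k; for \<open>tilt y\<close> >= 0 the value is at most 1/2 and the factor \<open>exp 1\<close>
  suffices. So in the remainders below only the subtracted polynomials grow.\<close>

lemma power_exp_tilt_bounded:
  assumes "k > 0"
  shows "\<bar>tilt y\<bar> ^ k * exp (tilt y) \<le> real k ^ k * exp 1"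
proof -
  have tl: "tilt y \<le> 1 / 2" using exp_tilt_le[of y] by simp
  show ?thesis
  proof (cases "tilt y \<ge> 0")
    case True
    have "1 \<le> real k ^ k" using assms by (intro one_le_power) auto
    have "\<bar>tilt y\<bar> ^ k * exp (tilt y) \<le> 1 * exp 1"
      using True tl by (intro mult_mono power_le_one) auto
    also have "\<dots> \<le> real k ^ k * exp 1" using \<open>1 \<le> real k ^ k\<close> by (intro mult_right_mono) auto
    finally show ?thesis .
  next
    case False
    define s where "s = - tilt y"
    have s: "s > 0" using False by (simp add: s_def)
    have "s / k \<le> exp (s / k)" using exp_ge_add_one_self[of "s / k"] by linarith
    then have "(s / k) ^ k \<le> exp (s / k) ^ k" using s by (intro power_mono) auto
    also have "\<dots> = exp s" using assms by (simp add: exp_of_nat_mult[symmetric])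
    finally have "s ^ k \<le> real k ^ k * exp s"
      using assms by (simp add: power_divide divide_le_eq mult.commute)
    then have "s ^ k * exp (- s) \<le> real k ^ k" by (simp add: exp_minus field_simps)
    also have "\<dots> \<le> real k ^ k * exp 1"
      using mult_left_mono[of 1 "exp 1 :: real" "real k ^ k"] by simp
    finally show ?thesis using False by (simp add: s_def)
  qed
qed

lemma power_le_one_plus_power:
  fixes y :: real
  assumes "j \<le> k"
  shows "\<bar>y\<bar> ^ j \<le> 1 + \<bar>y\<bar> ^ k"
proof (cases "\<bar>y\<bar> \<le> 1")
  case True
  then have "\<bar>y\<bar> ^ j \<le> 1" by (intro power_le_one) auto
  then show ?thesis by (simp add: add_increasing2)
next
  case False
  then show ?thesis using power_increasing[OF assms, of "\<bar>y\<bar>"] by linarith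
qed

lemma le_mult_one_plus_power:
  fixes c y :: real
  shows "c \<ge> 0 \<Longrightarrow> c \<le> c * (1 + \<bar>y\<bar> ^ k)"
  by (simp add: algebra_simps)

text \<open>The quadratic coefficient 1/2 - 1/2 vanishes, which is the effect of self-normalisation.
  The cubic one is 1/6 - 1/2 = -1/3, and the quartic one 1/8 - 1/4 + 1/24 = -1/12 is the origin of
  the constant in the theorem.\<close>

lemma exp_tilt_expansion:
  fixes r :: real
  assumes "4 \<le> r" "r \<le> 5"
  obtains C where "C \<ge> 0"
    "\<And>y. \<bar>exp (tilt y) - (1 + y - y ^ 3 / 3 - y ^ 4 / 12)\<bar> \<le> C * \<bar>y\<bar> powr r"
proof (rule remainder_bound)
  show "(\<lambda>y. exp (tilt y) - (1 + y - y ^ 3 / 3 - y ^ 4 / 12)) \<in> O[at 0](\<lambda>y. y ^ 5)"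
    unfolding tilt_def by real_asymp
  show "\<bar>exp (tilt y) - (1 + y - y ^ 3 / 3 - y ^ 4 / 12)\<bar> \<le> (exp (1/2) + 4) * (1 + \<bar>y\<bar> ^ 4)" for y :: real
  proof -
    have q: "0 \<le> y ^ 4" "0 \<le> y ^ 4 * exp (1 / 2)" "0 \<le> exp 1 * y ^ 4" by auto
    have p: "\<bar>y\<bar> ^ j \<le> 1 + \<bar>y\<bar> ^ 4" if "j \<le> 4" for j
      using that by (rule power_le_one_plus_power)
    have "\<bar>exp (tilt y) - (1 + y - y ^ 3 / 3 - y ^ 4 / 12)\<bar>
        \<le> exp (1 / 2) + 1 + \<bar>y\<bar> + \<bar>y\<bar> ^ 3 + \<bar>y\<bar> ^ 4"
      using exp_tilt_le[of y] exp_gt_zero[of "tilt y"] unfolding power_abs[symmetric] by linarith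
    also have "\<dots> \<le> exp (1 / 2) * (1 + \<bar>y\<bar> ^ 4) + 4 * (1 + \<bar>y\<bar> ^ 4)"
      using p[of 1] p[of 3] 
        apply (simp add: algebra_simps) using q by linarith
    finally show ?thesis by (simp add: algebra_simps)
  qed
  show "real 4 \<le> r" "r \<le> real 5" using assms by auto
qed (auto simp: tilt_def)

text \<open>This expands the mean of a tilted summand. The cubic term has to be kept: a remainder of
  order h^3 per summand would allow a shift of W by n h^3, which need not be o(x) for rho close to
  1/3, whereas n h^4 is.\<close>

lemma tilt_exp_tilt_expansion:
  obtains C where "C \<ge> 0"
    "\<And>y. \<bar>tilt y * exp (tilt y) - (y + y\<^sup>2 / 2 - y ^ 3 / 2)\<bar> \<le> C * y ^ 4"
proof -
  obtain C where C: "C \<ge> 0"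
    "\<And>y. \<bar>tilt y * exp (tilt y) - (y + y\<^sup>2 / 2 - y ^ 3 / 2)\<bar> \<le> C * \<bar>y\<bar> ^ 4"
  proof (rule remainder_bound_power)
    show "(\<lambda>y. tilt y * exp (tilt y) - (y + y\<^sup>2 / 2 - y ^ 3 / 2)) \<in> O[at 0](\<lambda>y. y ^ 4)"
      unfolding tilt_def by real_asymp
    show "\<bar>tilt y * exp (tilt y) - (y + y\<^sup>2 / 2 - y ^ 3 / 2)\<bar> \<le> (exp 1 + 3) * (1 + \<bar>y\<bar> ^ 4)" for y :: real
    proof -
      have q: "0 \<le> y ^ 4" "0 \<le> y ^ 4 * exp (1 / 2)" "0 \<le> exp 1 * y ^ 4" by auto
    have p: "\<bar>y\<bar> ^ j \<le> 1 + \<bar>y\<bar> ^ 4" if "j \<le> 4" for j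
      using that by (rule power_le_one_plus_power)
      have "\<bar>tilt y * exp (tilt y)\<bar> \<le> exp 1"
        using power_exp_tilt_bounded[of 1 y] by (simp add: abs_mult)
      then have "\<bar>tilt y * exp (tilt y) - (y + y\<^sup>2 / 2 - y ^ 3 / 2)\<bar>
        \<le> exp 1 + \<bar>y\<bar> + \<bar>y\<bar>\<^sup>2 + \<bar>y\<bar> ^ 3"
        unfolding power_abs[symmetric] by linarith
      also have "\<dots> \<le> exp 1 * (1 + \<bar>y\<bar> ^ 4) + 3 * (1 + \<bar>y\<bar> ^ 4)"
        using p[of 1, simplified] p[of 2, simplified] p[of 3, simplified]
          
        apply (simp add: algebra_simps) using q by linarith
      finally show ?thesis by (simp add: algebra_simps)
    qed
  qed (auto simp: tilt_def)
  with that show ?thesis by simp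
qed

text \<open>For the second moment a relative error of order h is enough, so the cubic term may go
  into the remainder here.\<close>

lemma tilt_square_exp_tilt_expansion:
  obtains C where "C \<ge> 0"
    "\<And>y. \<bar>(tilt y)\<^sup>2 * exp (tilt y) - y\<^sup>2\<bar> \<le> C * \<bar>y\<bar> ^ 3"
proof (rule remainder_bound_power)
  show "(\<lambda>y. (tilt y)\<^sup>2 * exp (tilt y) - y\<^sup>2) \<in> O[at 0](\<lambda>y. y ^ 3)"
    unfolding tilt_def by real_asymp
  show "\<bar>(tilt y)\<^sup>2 * exp (tilt y) - y\<^sup>2\<bar> \<le> (4 * exp 1 + 1) * (1 + \<bar>y\<bar> ^ 3)" for y :: real
  proof -
    have "(tilt y)\<^sup>2 * exp (tilt y) \<le> 4 * exp 1"
      using power_exp_tilt_bounded[of 2 y] by simp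
    moreover have "0 \<le> (tilt y)\<^sup>2 * exp (tilt y)" "0 \<le> y\<^sup>2" by simp_all
    ultimately have "\<bar>(tilt y)\<^sup>2 * exp (tilt y) - y\<^sup>2\<bar> \<le> 4 * exp 1 + \<bar>y\<bar>\<^sup>2"
      unfolding power2_abs by linarith
    also have "\<dots> \<le> 4 * exp 1 * (1 + \<bar>y\<bar> ^ 3) + 1 * (1 + \<bar>y\<bar> ^ 3)"
      using power_le_one_plus_power[of 2 3 y]
      by (intro add_mono le_mult_one_plus_power) auto
    finally show ?thesis by (simp add: algebra_simps)
  qed
qed (auto simp: tilt_def)

lemma tilt_cube_exp_tilt_bound:
  obtains C where "C \<ge> 0" "\<And>y. \<bar>tilt y\<bar> ^ 3 * exp (tilt y) \<le> C * \<bar>y\<bar> ^ 3"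
proof -
  obtain C where C: "C \<ge> 0" "\<And>y. \<bar>tilt y ^ 3 * exp (tilt y)\<bar> \<le> C * \<bar>y\<bar> ^ 3"
  proof (rule remainder_bound_power)
    show "(\<lambda>y. tilt y ^ 3 * exp (tilt y)) \<in> O[at 0](\<lambda>y. y ^ 3)"
      unfolding tilt_def by real_asymp
    show "\<bar>tilt y ^ 3 * exp (tilt y)\<bar> \<le> (27 * exp 1) * (1 + \<bar>y\<bar> ^ 3)" for y :: real
    proof -
      have "\<bar>tilt y ^ 3 * exp (tilt y)\<bar> \<le> 27 * exp 1"
        using power_exp_tilt_bounded[of 3 y] by (simp add: abs_mult power_abs)
      also have "\<dots> \<le> (27 * exp 1) * (1 + \<bar>y\<bar> ^ 3)"
        using mult_left_mono[of 1 "1 + \<bar>y\<bar> ^ 3" "27 * exp 1"] by simp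
      finally show ?thesis .
    qed
  qed (auto simp: tilt_def)
  with that show ?thesis by (simp add: abs_mult power_abs)
qed

text \<open>Completing the square bounds the exponent by 1/(4 \<theta>), so the left side is bounded
  and the cubic Taylor polynomial grows more slowly than y^4. Markov bounds need only the upper half
  of the estimate.\<close>

lemma exp_quadratic_upper:
  fixes \<theta> :: real
  assumes "\<theta> > 0"
  obtains C where "C \<ge> 0"
    "\<And>y. exp (y - \<theta> * y\<^sup>2) \<le> 1 + y + (1/2 - \<theta>) * y\<^sup>2 + (1/6 - \<theta>) * y ^ 3 + C * y ^ 4"
proof -
  have ub: "y - \<theta> * y\<^sup>2 \<le> 1 / (4 * \<theta>)" for y
  proof -
    have "0 \<le> (2 * \<theta> * y - 1)\<^sup>2" by simp
    then show ?thesis using assms by (simp add: power2_eq_square field_simps)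
  qed
  obtain C where C: "C \<ge> 0"
    "\<And>y. \<bar>exp (y - \<theta> * y\<^sup>2) - (1 + y + (1/2 - \<theta>) * y\<^sup>2 + (1/6 - \<theta>) * y ^ 3)\<bar> \<le> C * \<bar>y\<bar> ^ 4"
  proof (rule remainder_bound_power)
    show "(\<lambda>y. exp (y - \<theta> * y\<^sup>2) - (1 + y + (1/2 - \<theta>) * y\<^sup>2 + (1/6 - \<theta>) * y ^ 3))
        \<in> O[at 0](\<lambda>y. y ^ 4)"
      by real_asymp
    show "\<bar>exp (y - \<theta> * y\<^sup>2) - (1 + y + (1/2 - \<theta>) * y\<^sup>2 + (1/6 - \<theta>) * y ^ 3)\<bar>
        \<le> (exp (1 / (4 * \<theta>)) + 4 + 2 * \<theta>) * (1 + \<bar>y\<bar> ^ 4)" for y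
    proof -
      have "\<bar>exp (y - \<theta> * y\<^sup>2) - (1 + y + (1/2 - \<theta>) * y\<^sup>2 + (1/6 - \<theta>) * y ^ 3)\<bar>
          \<le> \<bar>exp (y - \<theta> * y\<^sup>2)\<bar> + 1 + \<bar>y\<bar> + \<bar>(1/2 - \<theta>) * y\<^sup>2\<bar> + \<bar>(1/6 - \<theta>) * y ^ 3\<bar>"
        by linarith
      also have "\<dots> \<le> exp (1 / (4 * \<theta>)) + 1 + \<bar>y\<bar> + (1 + \<theta>) * \<bar>y\<bar> ^ 2 + (1 + \<theta>) * \<bar>y\<bar> ^ 3"
        unfolding abs_mult power_abs using ub assms by (intro add_mono mult_right_mono) auto
      also have "\<dots> \<le> exp (1 / (4 * \<theta>)) * (1 + \<bar>y\<bar> ^ 4) + (1 + \<bar>y\<bar> ^ 4) + (1 + \<bar>y\<bar> ^ 4)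
          + (1 + \<theta>) * (1 + \<bar>y\<bar> ^ 4) + (1 + \<theta>) * (1 + \<bar>y\<bar> ^ 4)"
        using power_le_one_plus_power[of 1 4 y] assms
        by (intro add_mono mult_left_mono power_le_one_plus_power) auto
      finally show ?thesis by (simp add: algebra_simps)
    qed
  qed auto
  show ?thesis
  proof
    show "exp (y - \<theta> * y\<^sup>2) \<le> 1 + y + (1/2 - \<theta>) * y\<^sup>2 + (1/6 - \<theta>) * y ^ 3 + C * y ^ 4" for y
      using C(2)[of y] by simp
  qed (rule C)
qed

section \<open>A local limit theorem by smoothing with the Cauchy kernel\<close>

lemma has_bochner_integral_exp_Ioi:
  fixes z :: complex
  assumes "Re z > 0"
  shows "has_bochner_integral lborel (\<lambda>t. indicator {0<..} t *\<^sub>R exp (- (z * complex_of_real t))) (1 / z)"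
proof -
  have z: "z \<noteq> 0" using assms by auto
  have n: "norm (exp (- (z * complex_of_real t))) = exp (- (Re z * t))" for t
    by simp
  have int: "set_integrable lborel {0<..} (\<lambda>t. exp (- (z * complex_of_real t)))"
    unfolding set_integrable_def
  proof (rule Bochner_Integration.integrable_bound)
    show "integrable lborel (\<lambda>t. indicator {0<..} t *\<^sub>R exp (- (Re z * t)))"
      using integrable_I0i_exp_mscale[OF assms] unfolding set_integrable_def
      by (subst mult.commute)
    show "AE t in lborel. norm (indicator {0<..} t *\<^sub>R exp (- (z * complex_of_real t)))
        \<le> norm (indicator {0<..} t *\<^sub>R exp (- (Re z * t)))"
      by (intro AE_I2) simp
    show "(\<lambda>t. indicator {0<..} t *\<^sub>R exp (- (z * complex_of_real t))) \<in> borel_measurable lborel"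
      by measurable
  qed
  have "(LBINT t=0..\<infinity>. exp (- (z * complex_of_real t))) = 0 - (- 1 / z)"
  proof (rule interval_integral_FTC_integrable[where F = "\<lambda>t. - exp (- (z * complex_of_real t)) / z"])
    show "((\<lambda>t. - exp (- (z * complex_of_real t)) / z) has_vector_derivative
        exp (- (z * complex_of_real t))) (at t)" for t
      using z by (auto intro!: has_vector_derivative_real_field derivative_eq_intros)
    show "isCont (\<lambda>t. exp (- (z * complex_of_real t))) t" for t
      by (intro continuous_intros)
    show "set_integrable lborel (einterval 0 \<infinity>) (\<lambda>t. exp (- (z * complex_of_real t)))"
      using int by (simp add: zero_ereal_def einterval_def greaterThan_def)
    have "((\<lambda>t. - exp (- (z * complex_of_real t)) / z) \<longlongrightarrow> - exp (- (z * complex_of_real 0)) / z) (at_right 0)"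
      using z by (intro tendsto_intros) auto
    then show "(((\<lambda>t. - exp (- (z * complex_of_real t)) / z) \<circ> real_of_ereal) \<longlongrightarrow> - 1 / z) (at_right 0)"
      by (simp add: zero_ereal_def ereal_tendsto_simps)
    have "((\<lambda>t. exp (- (Re z * t))) \<longlongrightarrow> 0) at_top" using assms by real_asymp
    then have "((\<lambda>t. norm (exp (- (z * complex_of_real t)))) \<longlongrightarrow> 0) at_top"
      unfolding n .
    then have "((\<lambda>t. exp (- (z * complex_of_real t))) \<longlongrightarrow> 0) at_top"
      by (rule tendsto_norm_zero_cancel)
    then have "((\<lambda>t. - exp (- (z * complex_of_real t)) / z) \<longlongrightarrow> - 0 / z) at_top"
      using z by (intro tendsto_intros) auto
    then show "(((\<lambda>t. - exp (- (z * complex_of_real t)) / z) \<circ> real_of_ereal) \<longlongrightarrow> 0) (at_left \<infinity>)"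
      by (simp add: ereal_tendsto_simps)
  qed simp
  then show ?thesis
    using int by (simp add: has_bochner_integral_iff set_integrable_def set_lebesgue_integral_def
      interval_lebesgue_integral_0_infty)
qed

text \<open>The half lines contribute 1/(1 - i w) and, after the reflection t -> -t, 1/(1 + i w);
  their sum is twice the Cauchy kernel.\<close>

lemma has_bochner_integral_laplace_iexp:
  "has_bochner_integral lborel (\<lambda>t. complex_of_real (exp (- \<bar>t\<bar>)) * iexp (t * w)) (complex_of_real (2 / (1 + w\<^sup>2)))"
proof -
  have nz: "1 - \<i> * w \<noteq> 0" "1 + \<i> * w \<noteq> 0" by (auto simp: complex_eq_iff)
  have 1: "has_bochner_integral lborel
      (\<lambda>t. indicator {0<..} t *\<^sub>R exp (- ((1 - \<i> * w) * complex_of_real t))) (1 / (1 - \<i> * w))"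
    by (intro has_bochner_integral_exp_Ioi) simp
  have "has_bochner_integral lborel
      (\<lambda>t. indicator {0<..} t *\<^sub>R exp (- ((1 + \<i> * w) * complex_of_real t))) (1 / (1 + \<i> * w))"
    by (intro has_bochner_integral_exp_Ioi) simp
  then have 2: "has_bochner_integral lborel
      (\<lambda>t. indicator {0<..} (- t) *\<^sub>R exp (- ((1 + \<i> * w) * complex_of_real (- t)))) (1 / (1 + \<i> * w))"
    using lborel_has_bochner_integral_real_affine_iff[of "-1"
      "\<lambda>t. indicator {0<..} t *\<^sub>R exp (- ((1 + \<i> * w) * complex_of_real t))" _ 0] by simp
  have "(1 - \<i> * w) * (1 + \<i> * w) = 1 + (complex_of_real w)\<^sup>2"
    by (simp add: algebra_simps power2_eq_square)
  then have val: "1 / (1 - \<i> * w) + 1 / (1 + \<i> * w) = complex_of_real (2 / (1 + w\<^sup>2))"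
    using nz by (simp add: add_frac_eq)
  \<comment> \<open>At t = 0 both indicators vanish while the right side is 1, so the identity holds
    only almost everywhere.\<close>
  have "AE t in lborel. indicator {0<..} t *\<^sub>R exp (- ((1 - \<i> * w) * complex_of_real t)) +
      indicator {0<..} (- t) *\<^sub>R exp (- ((1 + \<i> * w) * complex_of_real (- t))) =
      complex_of_real (exp (- \<bar>t\<bar>)) * iexp (t * w)"
    using AE_lborel_singleton[of 0]
    by eventually_elim (auto simp: indicator_def exp_of_real[symmetric] exp_add[symmetric] algebra_simps)
  then show ?thesis
    using has_bochner_integral_add[OF 1 2] unfolding val
    by (subst (asm) has_bochner_integral_cong_AE) (auto intro!: borel_measurable_continuous_onI continuous_intros)
qed

lemma integrable_exp_abs: "(a::real) > 0 \<Longrightarrow> integrable lborel (\<lambda>t::real. exp (- (a * \<bar>t\<bar>)))"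
  and integral_exp_abs: "a > 0 \<Longrightarrow> (LBINT t::real. exp (- (a * \<bar>t\<bar>))) = 2 / a"
proof -
  have "has_bochner_integral lborel (\<lambda>t. complex_of_real (exp (- \<bar>t\<bar>))) (complex_of_real 2)"
    using has_bochner_integral_laplace_iexp[of 0] by simp
  from has_bochner_integral_bounded_linear[OF bounded_linear_Re this]
  have b: "has_bochner_integral lborel (\<lambda>t::real. exp (- \<bar>t\<bar>)) (2::real)"
    by simp
  assume a: "a > 0"
  have "has_bochner_integral lborel (\<lambda>t. exp (- \<bar>0 + a * t\<bar>)) (2 /\<^sub>R \<bar>a\<bar>)"
    using a b lborel_has_bochner_integral_real_affine_iff[of a "\<lambda>t. exp (- \<bar>t\<bar>)" 2 0] by simp
  then have "has_bochner_integral lborel (\<lambda>t. exp (- (a * \<bar>t\<bar>))) (2 / a)"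
    using a by (simp add: abs_mult divide_inverse_commute)
  then show "integrable lborel (\<lambda>t. exp (- (a * \<bar>t\<bar>)))" "(LBINT t. exp (- (a * \<bar>t\<bar>))) = 2 / a"
    by (simp_all add: has_bochner_integral_iff)
qed

text \<open>The Cauchy kernel is half the transform of exp(-|t|), so by Fubini its integral against
  the distribution becomes an integral of the characteristic function. The substitution t = s/x - u
  moves the argument to s/x, the scale at which a limit is available.\<close>

lemma (in real_distribution) integral_cauchy_kernel:
  fixes u x :: real
  assumes "x > 0"
  shows "complex_of_real x * (LINT w|M. complex_of_real (1 / (1 + w\<^sup>2)) * iexp (u * w)) =
     1 / 2 * (LINT s|lborel. complex_of_real (exp (- \<bar>s / x - u\<bar>)) * char M (s / x))"
proof -
  interpret pair_sigma_finite lborel M ..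
  let ?f = "\<lambda>t w. complex_of_real (exp (- \<bar>t\<bar>)) * iexp ((t + u) * w)"
  have m: "case_prod ?f \<in> borel_measurable (lborel \<Otimes>\<^sub>M M)"
    by measurable
  have nf: "norm (?f t w) = exp (- \<bar>t\<bar>)" for t w
    by (simp add: norm_mult)
  have int: "integrable (lborel \<Otimes>\<^sub>M M) (case_prod ?f)"
  proof (rule Fubini_integrable[OF m])
    show "integrable lborel (\<lambda>t. \<integral> w. norm (case_prod ?f (t, w)) \<partial>M)"
      using integrable_exp_abs[of 1] unfolding prod.case nf by (simp add: prob_space del: space_eq_univ)
    show "AE t in lborel. integrable M (\<lambda>w. case_prod ?f (t, w))"
      by (intro AE_I2 integrable_const_bound[of _ 1]) (auto simp: nf norm_mult)
  qed
  have "(LINT t|lborel. complex_of_real (exp (- \<bar>t\<bar>)) * char M (t + u)) = (LINT t|lborel. LINT w|M. ?f t w)"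
    by (simp add: char_def)
  also have "\<dots> = (LINT w|M. LINT t|lborel. ?f t w)"
    by (rule Fubini_integral[OF int, symmetric])
  also have "\<dots> = (LINT w|M. (LINT t|lborel. complex_of_real (exp (- \<bar>t\<bar>)) * iexp (t * w)) * iexp (u * w))"
  proof (intro Bochner_Integration.integral_cong refl)
    fix w
    have "(LINT t|lborel. ?f t w) = (LINT t|lborel. (complex_of_real (exp (- \<bar>t\<bar>)) * iexp (t * w)) * iexp (u * w))"
      by (intro Bochner_Integration.integral_cong refl) (simp add: exp_add distrib_right distrib_left mult.assoc)
    then show "(LINT t|lborel. ?f t w) = (LINT t|lborel. complex_of_real (exp (- \<bar>t\<bar>)) * iexp (t * w)) * iexp (u * w)"
      by (simp only: integral_mult_left_zero)
  qed
  also have "\<dots> = (LINT w|M. 2 * (complex_of_real (1 / (1 + w\<^sup>2)) * iexp (u * w)))"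
    by (intro Bochner_Integration.integral_cong refl,
        subst has_bochner_integral_integral_eq[OF has_bochner_integral_laplace_iexp]) simp
  finally have 1: "(LINT t|lborel. complex_of_real (exp (- \<bar>t\<bar>)) * char M (t + u)) =
      2 * (LINT w|M. complex_of_real (1 / (1 + w\<^sup>2)) * iexp (u * w))"
    unfolding integral_mult_right_zero .
  have "(LINT t|lborel. complex_of_real (exp (- \<bar>t\<bar>)) * char M (t + u)) =
     \<bar>1 / x\<bar> *\<^sub>R (LINT s|lborel. complex_of_real (exp (- \<bar>- u + 1 / x * s\<bar>)) * char M (- u + 1 / x * s + u))"
    using assms lborel_integral_real_affine[of "1 / x"
        "\<lambda>t. complex_of_real (exp (- \<bar>t\<bar>)) * char M (t + u)" "- u"] by simp
  also have "\<dots> = \<bar>1 / x\<bar> *\<^sub>R (LINT s|lborel. complex_of_real (exp (- \<bar>s / x - u\<bar>)) * char M (s / x))"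
    by simp
  finally have 2: "\<bar>1 / x\<bar> *\<^sub>R (LINT s|lborel. complex_of_real (exp (- \<bar>s / x - u\<bar>)) * char M (s / x)) =
      2 * (LINT w|M. complex_of_real (1 / (1 + w\<^sup>2)) * iexp (u * w))"
    using 1 by (rule trans[OF sym])
  have aux: "complex_of_real x * b = 1 / 2 * c" if "\<bar>1 / x\<bar> *\<^sub>R c = 2 * b" for b c :: complex
  proof -
    have "complex_of_real x * (2 * b) = c"
      using assms unfolding that[symmetric] scaleR_conv_of_real by simp
    then show ?thesis by auto
  qed
  show ?thesis using 2 by (rule aux)
qed

lemma has_bochner_integral_gauss:
  fixes c :: real
  assumes "c > 0"
  shows "has_bochner_integral lborel (\<lambda>s::real. exp (- (s\<^sup>2 / (2 * c\<^sup>2)))) (c * sqrt (2 * pi))"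
proof -
  have "has_bochner_integral lborel (\<lambda>s. sqrt (2 * pi * c\<^sup>2) * normal_density 0 c s) (sqrt (2 * pi * c\<^sup>2) * 1)"
    using assms by (intro has_bochner_integral_mult_right) (simp add: has_bochner_integral_iff)
  moreover have "sqrt (2 * pi * c\<^sup>2) * normal_density 0 c s = exp (- (s\<^sup>2 / (2 * c\<^sup>2)))" for s
    using assms by (simp add: normal_density_def)
  ultimately show ?thesis using assms by (simp add: real_sqrt_mult mult.commute)
qed

text \<open>On |s/x| <= K the integrand has a Gaussian majorant, and dominated convergence gives
  exp(-|u|) times a Gaussian integral because s/x -> 0. On the rest only the bound 1 for
  characteristic functions is used, and exp(-|s/x - u|) supplies the decay. The rate 1/8 in
  \<open>dom\<close> only serves as a majorant; the limit has rate 1/2.\<close>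

lemma tendsto_integral_cauchy_kernel:
  fixes Q :: "nat \<Rightarrow> real measure" and x K :: "nat \<Rightarrow> real" and A u :: real
  assumes rd: "\<And>n. real_distribution (Q n)"
    and xpos: "\<And>n. x n > 0" and xinf: "filterlim x at_top sequentially"
    and conv: "\<And>s. (\<lambda>n. char (Q n) (s / x n)) \<longlonglongrightarrow> complex_of_real (exp (- (s\<^sup>2 / 2)))"
    and dom: "\<And>n t. \<bar>t\<bar> \<le> K n \<Longrightarrow> norm (char (Q n) t) \<le> A * exp (- ((t * x n)\<^sup>2 / 8))"
    and K: "(\<lambda>n. x n * exp (- K n / 2)) \<longlonglongrightarrow> 0"
  shows "(\<lambda>n. complex_of_real (x n) * (LINT w|Q n. complex_of_real (1 / (1 + w\<^sup>2)) * iexp (u * w)))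
     \<longlonglongrightarrow> complex_of_real (exp (- \<bar>u\<bar>) * sqrt (2 * pi) / 2)"
proof -
  define g where "g n s = complex_of_real (exp (- \<bar>s / x n - u\<bar>)) * char (Q n) (s / x n)" for n s
  define g1 where "g1 n s = (if \<bar>s / x n\<bar> \<le> K n then g n s else 0)" for n s
  define g2 where "g2 n s = (if \<bar>s / x n\<bar> \<le> K n then 0 else g n s)" for n s
  have cm [measurable]: "char (Q n) \<in> borel_measurable borel" for n
    using real_distribution.char_measurable[OF rd] .
  have gm [measurable]: "g n \<in> borel_measurable borel" "g1 n \<in> borel_measurable borel"
    "g2 n \<in> borel_measurable borel" for n
    unfolding g_def g1_def g2_def by measurable
  have ng: "norm (g n s) \<le> exp (- \<bar>s / x n - u\<bar>)" for n s
    using real_distribution.cmod_char_le_1[OF rd] by (simp add: g_def norm_mult)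
  \<comment> \<open>x >= 1 together with x exp(-K/2) < exp(-1/2) forces K >= 1. As s/x -> 0, every
    fixed s then lies eventually in the inner range.\<close>
  have K1: "\<forall>\<^sub>F n in sequentially. K n \<ge> 1"
  proof -
    have "\<forall>\<^sub>F n in sequentially. x n * exp (- K n / 2) < exp (- 1 / 2)"
      using K by (rule order_tendstoD) simp
    moreover have "\<forall>\<^sub>F n in sequentially. x n \<ge> 1"
      using xinf by (simp add: filterlim_at_top)
    ultimately show ?thesis
    proof eventually_elim
      case (elim n)
      have "1 * exp (- K n / 2) \<le> x n * exp (- K n / 2)" using elim by (intro mult_right_mono) auto
      also note elim(1)
      finally show ?case by simp
    qed
  qed
  have sx: "(\<lambda>n. s / x n) \<longlonglongrightarrow> 0" for s
    using tendsto_divide_0[OF tendsto_const filterlim_at_top_imp_at_infinity[OF xinf]] .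
  have gauss8: "integrable lborel (\<lambda>s::real. exp (- (s\<^sup>2 / 8)))"
    using has_bochner_integral_gauss[of 2] by (simp add: has_bochner_integral_iff)
  have bound1: "norm (g1 n s) \<le> \<bar>A\<bar> * exp (- (s\<^sup>2 / 8))" for n s
  proof (cases "\<bar>s / x n\<bar> \<le> K n")
    case True
    have "norm (g n s) \<le> 1 * norm (char (Q n) (s / x n))"
      unfolding g_def norm_mult by (intro mult_right_mono) auto
    also have "\<dots> \<le> A * exp (- ((s / x n * x n)\<^sup>2 / 8))" using dom[OF True] by simp
    also have "\<dots> = A * exp (- (s\<^sup>2 / 8))" using xpos[of n] by simp
    also have "\<dots> \<le> \<bar>A\<bar> * exp (- (s\<^sup>2 / 8))" by (intro mult_right_mono) auto
    finally show ?thesis using True by (simp add: g1_def)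
  qed (simp add: g1_def)
  have lim1: "(\<lambda>n. LINT s|lborel. g1 n s) \<longlonglongrightarrow> (LINT s|lborel. complex_of_real (exp (- \<bar>u\<bar>) * exp (- (s\<^sup>2 / 2))))"
  proof (rule integral_dominated_convergence[where w = "\<lambda>s. \<bar>A\<bar> * exp (- (s\<^sup>2 / 8))"])
    show "integrable lborel (\<lambda>s. \<bar>A\<bar> * exp (- (s\<^sup>2 / 8)))" using gauss8 by simp
    show "AE s in lborel. (\<lambda>n. g1 n s) \<longlonglongrightarrow> complex_of_real (exp (- \<bar>u\<bar>) * exp (- (s\<^sup>2 / 2)))"
    proof (intro AE_I2)
      fix s
      have "\<forall>\<^sub>F n in sequentially. \<bar>s / x n\<bar> < 1"
        using tendsto_rabs[OF sx[of s]] by (rule order_tendstoD) simp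
      with K1 have "\<forall>\<^sub>F n in sequentially. g1 n s = g n s"
        by eventually_elim (auto simp: g1_def)
      moreover have "(\<lambda>n. g n s) \<longlonglongrightarrow> complex_of_real (exp (- \<bar>0 - u\<bar>)) * complex_of_real (exp (- (s\<^sup>2 / 2)))"
        unfolding g_def by (intro tendsto_intros conv sx)
      ultimately show "(\<lambda>n. g1 n s) \<longlonglongrightarrow> complex_of_real (exp (- \<bar>u\<bar>) * exp (- (s\<^sup>2 / 2)))"
        by (simp add: tendsto_cong)
    qed
  qed (use bound1 in auto)
  have "(LINT s|lborel. complex_of_real (exp (- \<bar>u\<bar>) * exp (- (s\<^sup>2 / 2)))) =
      complex_of_real (exp (- \<bar>u\<bar>) * sqrt (2 * pi))"
    using has_bochner_integral_integral_eq[OF has_bochner_integral_gauss[of 1]]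
    by (simp only: integral_complex_of_real integral_mult_right_zero) simp
  note lim1 = lim1[unfolded this]
  have bound2: "norm (g2 n s) \<le> exp (\<bar>u\<bar> - K n / 2) * exp (- (1 / (2 * x n) * \<bar>s\<bar>))" for n s
  proof (cases "\<bar>s / x n\<bar> \<le> K n")
    case False
    \<comment> \<open>Half of |a| > k is spent on the small factor exp(-k/2); the other half keeps
      the bound integrable.\<close>
    have aux: "- \<bar>a - b\<bar> \<le> \<bar>b\<bar> - k / 2 - \<bar>a\<bar> / 2" if "\<not> \<bar>a\<bar> \<le> k" for a b k :: real
      using that by linarith
    have "- \<bar>s / x n - u\<bar> \<le> \<bar>u\<bar> - K n / 2 - \<bar>s / x n\<bar> / 2"
      using aux[OF False] .
    also have "\<dots> = \<bar>u\<bar> - K n / 2 + - (1 / (2 * x n) * \<bar>s\<bar>)" using xpos[of n] by (simp add: abs_divide)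
    finally have "exp (- \<bar>s / x n - u\<bar>) \<le> exp (\<bar>u\<bar> - K n / 2 + - (1 / (2 * x n) * \<bar>s\<bar>))" by simp
    then show ?thesis using ng[of n s] False by (simp only: g2_def exp_add if_False)
  qed (simp add: g2_def)
  have e2: "integrable lborel (\<lambda>s. exp (\<bar>u\<bar> - K n / 2) * exp (- (1 / (2 * x n) * \<bar>s\<bar>)))" for n
    using xpos[of n] by (intro integrable_mult_right integrable_exp_abs) auto
  have i1: "integrable lborel (g1 n)" for n
    by (rule Bochner_Integration.integrable_bound[where f = "\<lambda>s. \<bar>A\<bar> * exp (- (s\<^sup>2 / 8))"])
      (use gauss8 bound1 in auto)
  have i2: "integrable lborel (g2 n)" for n
    by (rule Bochner_Integration.integrable_bound[OF e2]) (use bound2 in auto)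
  have lim2: "(\<lambda>n. LINT s|lborel. g2 n s) \<longlonglongrightarrow> 0"
  proof (rule Lim_null_comparison)
    show "\<forall>\<^sub>F n in sequentially. norm (LINT s|lborel. g2 n s) \<le> 4 * exp \<bar>u\<bar> * (x n * exp (- K n / 2))"
    proof (intro always_eventually allI)
      fix n
      have "norm (LINT s|lborel. g2 n s) \<le> (LINT s|lborel. exp (\<bar>u\<bar> - K n / 2) * exp (- (1 / (2 * x n) * \<bar>s\<bar>)))"
        by (rule Bochner_Integration.integral_norm_bound_integral[OF i2 e2 bound2])
      also have "\<dots> = exp (\<bar>u\<bar> - K n / 2) * (2 / (1 / (2 * x n)))"
        using xpos[of n] by (subst integral_mult_right_zero, subst integral_exp_abs) auto
      also have "\<dots> = 4 * exp \<bar>u\<bar> * (x n * exp (- K n / 2))"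
        by (simp add: exp_add[symmetric])
      finally show "norm (LINT s|lborel. g2 n s) \<le> 4 * exp \<bar>u\<bar> * (x n * exp (- K n / 2))" .
    qed
    show "(\<lambda>n. 4 * exp \<bar>u\<bar> * (x n * exp (- K n / 2))) \<longlonglongrightarrow> 0"
      using tendsto_mult_right_zero[OF K] by simp
  qed
  have "(LINT s|lborel. g n s) = (LINT s|lborel. g1 n s) + (LINT s|lborel. g2 n s)" for n
    by (subst Bochner_Integration.integral_add[OF i1 i2, symmetric])
      (auto intro!: Bochner_Integration.integral_cong simp: g1_def g2_def)
  then have "complex_of_real (x n) * (LINT w|Q n. complex_of_real (1 / (1 + w\<^sup>2)) * iexp (u * w)) =
      1 / 2 * ((LINT s|lborel. g1 n s) + (LINT s|lborel. g2 n s))" for n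
    by (subst real_distribution.integral_cauchy_kernel[OF rd xpos]) (simp add: g_def)
  moreover have "(\<lambda>n. 1 / 2 * ((LINT s|lborel. g1 n s) + (LINT s|lborel. g2 n s)))
      \<longlonglongrightarrow> 1 / 2 * (complex_of_real (exp (- \<bar>u\<bar>) * sqrt (2 * pi)) + 0)"
    by (intro tendsto_intros lim1 lim2)
  moreover have "1 / 2 * (complex_of_real (exp (- \<bar>u\<bar>) * sqrt (2 * pi)) + 0) =
      complex_of_real (exp (- \<bar>u\<bar>) * sqrt (2 * pi) / 2)"
    by simp
  ultimately show ?thesis by (simp only:)
qed

section \<open>The Cauchy distribution and its characteristic function\<close>

lemma integrable_cauchy_density: "integrable lborel (\<lambda>w::real. 1 / (1 + w\<^sup>2))"
  using integrable_inverse_1_plus_square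
  by (simp add: set_integrable_def einterval_eq_UNIV inverse_eq_divide)

lemma integral_cauchy_density: "(LINT w|lborel. 1 / (1 + w\<^sup>2)) = pi"
  using LBINT_inverse_1_plus_square
  by (simp add: interval_lebesgue_integral_def set_lebesgue_integral_def einterval_eq_UNIV inverse_eq_divide)

definition cauchy_distribution :: "real measure" where
  "cauchy_distribution = density lborel (\<lambda>w. 1 / (pi * (1 + w\<^sup>2)))"

lemma real_distribution_cauchy: "real_distribution cauchy_distribution"
proof -
  have i: "integrable lborel (\<lambda>w::real. 1 / (pi * (1 + w\<^sup>2)))"
    using integrable_mult_right[OF integrable_cauchy_density, of "1 / pi"] by simp
  have "(LINT w|lborel. 1 / (pi * (1 + w\<^sup>2))) = (LINT w|lborel. 1 / pi * (1 / (1 + w\<^sup>2)))"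
    by simp
  also have "\<dots> = 1" unfolding integral_mult_right_zero integral_cauchy_density by simp
  finally have "(\<integral>\<^sup>+ w. ennreal (1 / (pi * (1 + w\<^sup>2))) \<partial>lborel) = 1"
    using nn_integral_eq_integral[OF i] by simp
  then have "prob_space cauchy_distribution"
    by (intro prob_spaceI) (simp add: cauchy_distribution_def emeasure_density)
  then show ?thesis
    by (simp add: real_distribution_def real_distribution_axioms_def cauchy_distribution_def)
qed

text \<open>The Fourier transform of the Cauchy kernel is the limit of its integrals against wide
  Gaussians, which \<open>tendsto_integral_cauchy_kernel\<close> evaluates.\<close>

lemma char_cauchy: "char cauchy_distribution u = complex_of_real (exp (- \<bar>u\<bar>))"
proof -
  define F where "F w = complex_of_real (1 / (1 + w\<^sup>2)) * iexp (u * w)" for w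
  define \<sigma> where "\<sigma> n = real (Suc n)" for n
  \<comment> \<open>These Gaussians flatten out: \<sigma> times their density tends pointwise to the
    constant 1/sqrt(2 pi), so their rescaled integrals of \<open>F\<close> tend to a multiple of the
    Lebesgue integral.\<close>
  define Q where "Q n = distr std_normal_distribution borel (\<lambda>y. \<sigma> n * y)" for n
  have s: "\<sigma> n > 0" for n by (simp add: \<sigma>_def)
  have sinf: "filterlim \<sigma> at_top sequentially"
    unfolding \<sigma>_def by real_asymp
  have Fm [measurable]: "F \<in> borel_measurable borel" unfolding F_def by measurable
  interpret N: real_distribution std_normal_distribution by (rule real_dist_normal_dist)
  have rd: "real_distribution (Q n)" for n
    unfolding Q_def by (intro N.real_distribution_distr) measurable
  have charQ: "char (Q n) t = complex_of_real (exp (- ((t * \<sigma> n)\<^sup>2 / 2)))" for n t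
  proof -
    have "char (Q n) t = char std_normal_distribution (t * \<sigma> n)"
      unfolding Q_def char_def by (subst integral_distr) (auto simp: mult.assoc)
    then show ?thesis by (simp add: char_std_normal_distribution)
  qed
  have 1: "(\<lambda>n. complex_of_real (\<sigma> n) * (LINT w|Q n. F w)) \<longlonglongrightarrow> complex_of_real (exp (- \<bar>u\<bar>) * sqrt (2 * pi) / 2)"
    unfolding F_def
  proof (rule tendsto_integral_cauchy_kernel[where K = \<sigma> and A = 1, OF rd s sinf])
    show "(\<lambda>n. char (Q n) (t / \<sigma> n)) \<longlonglongrightarrow> complex_of_real (exp (- (t\<^sup>2 / 2)))" for t
      using s[THEN less_imp_neq] by (simp add: charQ)
    show "norm (char (Q n) t) \<le> 1 * exp (- ((t * \<sigma> n)\<^sup>2 / 8))" for n t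
      by (simp add: charQ)
    show "(\<lambda>n. \<sigma> n * exp (- \<sigma> n / 2)) \<longlonglongrightarrow> 0" unfolding \<sigma>_def by real_asymp
  qed
  have 2: "complex_of_real (\<sigma> n) * (LINT w|Q n. F w) = (LINT w|lborel. std_normal_density (w / \<sigma> n) *\<^sub>R F w)" for n
  proof -
    have "(LINT w|Q n. F w) = (LINT y|lborel. std_normal_density y *\<^sub>R F (\<sigma> n * y))"
      unfolding Q_def by (simp add: integral_distr integral_density)
    also have "\<dots> = \<bar>1 / \<sigma> n\<bar> *\<^sub>R (LINT w|lborel. std_normal_density (w / \<sigma> n) *\<^sub>R F w)"
      using s[of n] lborel_integral_real_affine[of "1 / \<sigma> n" "\<lambda>y. std_normal_density y *\<^sub>R F (\<sigma> n * y)" 0] by simp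
    finally show ?thesis using s[of n] by (simp add: scaleR_conv_of_real)
  qed
  have iF: "integrable lborel F"
  proof (rule Bochner_Integration.integrable_bound[OF integrable_cauchy_density])
    have "norm (F w) = norm (1 / (1 + w\<^sup>2))" for w
      unfolding F_def norm_mult norm_of_real by simp
    then show "AE w in lborel. norm (F w) \<le> norm (1 / (1 + w\<^sup>2))" by simp
  qed simp
  have "(\<lambda>n. LINT w|lborel. std_normal_density (w / \<sigma> n) *\<^sub>R F w) \<longlonglongrightarrow> (LINT w|lborel. std_normal_density 0 *\<^sub>R F w)"
  proof (rule integral_dominated_convergence[where w = "\<lambda>w. norm (F w)"])
    show "AE w in lborel. (\<lambda>n. std_normal_density (w / \<sigma> n) *\<^sub>R F w) \<longlonglongrightarrow> std_normal_density 0 *\<^sub>R F w"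
    proof (intro AE_I2 tendsto_scaleR tendsto_const)
      fix w
      have "(\<lambda>n. w / \<sigma> n) \<longlonglongrightarrow> 0"
        using tendsto_divide_0[OF tendsto_const filterlim_at_top_imp_at_infinity[OF sinf]] .
      moreover have "isCont std_normal_density 0"
        unfolding normal_density_def by (intro continuous_intros) auto
      ultimately show "(\<lambda>n. std_normal_density (w / \<sigma> n)) \<longlonglongrightarrow> std_normal_density 0"
        using isCont_tendsto_compose by blast
    qed
    have "std_normal_density y \<le> 1" for y
    proof -
      have "1 / sqrt (2 * pi) * exp (- y\<^sup>2 / 2) \<le> 1 * 1"
        using pi_gt3 by (intro mult_mono) (auto simp: divide_le_eq_1)
      then show ?thesis by (simp add: std_normal_density_def)
    qed
    then show "AE w in lborel. norm (std_normal_density (w / \<sigma> n) *\<^sub>R F w) \<le> norm (F w)" for n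
      by (auto intro!: mult_left_le_one_le)
  qed (use iF in auto)
  \<comment> \<open>Two limits of one sequence are equated: the one from flattening and the one from
    the characteristic functions.\<close>
  then have "std_normal_density 0 *\<^sub>R (LINT w|lborel. F w) = complex_of_real (exp (- \<bar>u\<bar>) * sqrt (2 * pi) / 2)"
    using 1 unfolding 2 by (intro LIMSEQ_unique) auto
  then have 3: "complex_of_real (1 / sqrt (2 * pi)) * (LINT w|lborel. F w) = complex_of_real (exp (- \<bar>u\<bar>) * sqrt (2 * pi) / 2)"
    by (simp add: std_normal_density_def scaleR_conv_of_real)
  have "(LINT w|lborel. F w) = complex_of_real (sqrt (2 * pi)) * (complex_of_real (1 / sqrt (2 * pi)) * (LINT w|lborel. F w))"
    unfolding mult.assoc[symmetric] of_real_mult[symmetric] by simp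
  also have "\<dots> = complex_of_real (sqrt (2 * pi) * (exp (- \<bar>u\<bar>) * sqrt (2 * pi) / 2))"
    by (simp only: 3 of_real_mult)
  also have "sqrt (2 * pi) * (exp (- \<bar>u\<bar>) * sqrt (2 * pi) / 2) = pi * exp (- \<bar>u\<bar>)"
    by simp
  finally have 3: "(LINT w|lborel. F w) = complex_of_real (pi * exp (- \<bar>u\<bar>))" .
  have "char cauchy_distribution u = (LINT w|lborel. (1 / (pi * (1 + w\<^sup>2))) *\<^sub>R iexp (u * w))"
    unfolding char_def cauchy_distribution_def by (subst integral_density) auto
  also have "\<dots> = (LINT w|lborel. complex_of_real (1 / pi) * F w)"
    by (intro Bochner_Integration.integral_cong) (auto simp: F_def scaleR_conv_of_real)
  also have "\<dots> = complex_of_real (exp (- \<bar>u\<bar>))"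
    unfolding integral_mult_right_zero 3 by simp
  finally show ?thesis .
qed

text \<open>The integrand divided by the Cauchy kernel is bounded and continuous except at \<open>a\<close>, and the
  distributions \<open>Q n\<close> reweighted by the kernel converge weakly to the Cauchy distribution, by Levy's
  continuity theorem.\<close>

theorem local_limit_exponential:
  fixes Q :: "nat \<Rightarrow> real measure" and x K :: "nat \<Rightarrow> real" and A a :: real
  assumes rd: "\<And>n. real_distribution (Q n)"
    and xpos: "\<And>n. x n > 0" and xinf: "filterlim x at_top sequentially"
    and conv: "\<And>s. (\<lambda>n. char (Q n) (s / x n)) \<longlonglongrightarrow> complex_of_real (exp (- (s\<^sup>2 / 2)))"
    and dom: "\<And>n t. \<bar>t\<bar> \<le> K n \<Longrightarrow> norm (char (Q n) t) \<le> A * exp (- ((t * x n)\<^sup>2 / 8))"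
    and K: "(\<lambda>n. x n * exp (- K n / 2)) \<longlonglongrightarrow> 0"
  shows "(\<lambda>n. x n * (LINT w|Q n. indicator {a..} w * exp (- w))) \<longlonglongrightarrow> exp (- a) / sqrt (2 * pi)"
proof -
  let ?k = "\<lambda>w::real. 1 / (1 + w\<^sup>2)"
  define z where "z n = (LINT w|Q n. ?k w)" for n
  define R where "R n = density (Q n) (\<lambda>w. ?k w / z n)" for n
  have kpos: "?k w > 0" for w by (simp add: add_pos_nonneg)
  have kle: "?k w \<le> 1" for w by (simp add: divide_le_eq_1 add_pos_nonneg)
  have meas: "f \<in> borel_measurable (Q n)" if "f \<in> borel_measurable borel" for f :: "real \<Rightarrow> 'b::topological_space" and n
    using that real_distribution.events_eq_borel[OF rd, of n] by (simp cong: measurable_cong_sets)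
  have ki: "integrable (Q n) ?k" for n
  proof -
    interpret real_distribution "Q n" by (rule rd)
    show ?thesis by (rule integrable_const_bound[of _ 1]) (use kle in auto)
  qed
  have zpos: "z n > 0" for n
  proof -
    interpret real_distribution "Q n" by (rule rd)
    have "0 \<le> z n" unfolding z_def by (intro Bochner_Integration.integral_nonneg) auto
    moreover have "z n \<noteq> 0"
    proof
      assume "z n = 0"
      then have "AE w in Q n. ?k w = 0"
        using integral_nonneg_eq_0_iff_AE[OF ki[of n]] by (simp add: z_def)
      then have "AE w in Q n. False"
        by eventually_elim (metis kpos less_irrefl)
      then show False by simp
    qed
    ultimately show ?thesis by simp
  qed
  have intR: "(LINT w|R n. f w) = (LINT w|Q n. (?k w / z n) *\<^sub>R f w)"
    if "f \<in> borel_measurable borel" for f :: "real \<Rightarrow> 'b::{banach, second_countable_topology}" and n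
    unfolding R_def using zpos[of n] that
    by (intro integral_density meas) (auto simp: less_imp_le)
  have rdR: "real_distribution (R n)" for n
  proof -
    interpret real_distribution "Q n" by (rule rd)
    have "(LINT w|Q n. ?k w / z n) = z n / z n" by (simp only: integral_divide_zero z_def)
    then have "(LINT w|Q n. ?k w / z n) = 1" using zpos[of n] by simp
    moreover have "integrable (Q n) (\<lambda>w. ?k w / z n)" by (intro integrable_divide_zero ki)
    ultimately have "(\<integral>\<^sup>+ w. ennreal (?k w / z n) \<partial>Q n) = 1"
      using zpos[of n] by (subst nn_integral_eq_integral) (auto simp: less_imp_le)
    then have "prob_space (R n)"
      by (intro prob_spaceI) (simp add: R_def emeasure_density)
    then show ?thesis by (simp add: real_distribution_def real_distribution_axioms_def R_def)
  qed
  have kconv: "(\<lambda>n. complex_of_real (x n) * (LINT w|Q n. complex_of_real (?k w) * iexp (u * w)))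
     \<longlonglongrightarrow> complex_of_real (exp (- \<bar>u\<bar>) * sqrt (2 * pi) / 2)" for u
    by (rule tendsto_integral_cauchy_kernel[OF rd xpos xinf conv dom K])
  \<comment> \<open>The case u = 0 gives the asymptotics of the normalising constants
    \<open>z n\<close>, by which the limits for all other u are divided.\<close>
  have "(\<lambda>n. complex_of_real (x n * z n)) \<longlonglongrightarrow> complex_of_real (sqrt (2 * pi) / 2)"
    using kconv[of 0] ki by (simp add: z_def flip: integral_complex_of_real)
  then have xz: "(\<lambda>n. x n * z n) \<longlonglongrightarrow> sqrt (2 * pi) / 2"
    by (simp only: tendsto_of_real_iff)
  have charR: "char (R n) u = (complex_of_real (x n) * (LINT w|Q n. complex_of_real (?k w) * iexp (u * w))) / complex_of_real (x n * z n)" for n u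
  proof -
    have "char (R n) u = (LINT w|Q n. (complex_of_real (?k w) * iexp (u * w)) / complex_of_real (z n))"
      unfolding char_def by (subst intR) (auto simp: scaleR_conv_of_real)
    also have "\<dots> = (LINT w|Q n. complex_of_real (?k w) * iexp (u * w)) / complex_of_real (z n)"
      by (rule integral_divide_zero)
    finally show ?thesis using xpos[of n] by simp
  qed
  have "weak_conv_m R cauchy_distribution"
  proof (rule levy_continuity[OF rdR real_distribution_cauchy])
    fix u
    have "(\<lambda>n. char (R n) u) \<longlonglongrightarrow> complex_of_real (exp (- \<bar>u\<bar>) * sqrt (2 * pi) / 2) / complex_of_real (sqrt (2 * pi) / 2)"
      unfolding charR by (intro tendsto_divide kconv tendsto_of_real xz) simp
    then show "(\<lambda>n. char (R n) u) \<longlonglongrightarrow> char cauchy_distribution u"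
      by (simp add: char_cauchy)
  qed
  note weak = this
  \<comment> \<open>The target integrand divided by the Cauchy kernel: its integral under
    \<open>R n\<close>, multiplied by \<open>z n\<close>, is the wanted integral. It is bounded
    because exp(-w) beats 1 + w^2 on w >= a.\<close>
  define f where "f w = indicator {a..} w * exp (- w) * (1 + w\<^sup>2)" for w :: real
  have fm [measurable]: "f \<in> borel_measurable borel" unfolding f_def by measurable
  obtain B where B: "\<And>w. norm (f w) \<le> B"
  proof -
    have "((\<lambda>w::real. exp (- w) * (1 + w\<^sup>2)) \<longlongrightarrow> 0) at_top" by real_asymp
    then have "\<forall>\<^sub>F w in at_top. exp (- w) * (1 + w\<^sup>2) < (1::real)"
      by (rule order_tendstoD) simp
    then obtain b where b: "\<And>w. w \<ge> b \<Longrightarrow> exp (- w) * (1 + w\<^sup>2) < (1::real)"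
      by (auto simp: eventually_at_top_linorder)
    have "compact ((\<lambda>w::real. exp (- w) * (1 + w\<^sup>2)) ` {a..b})"
      by (intro compact_continuous_image continuous_intros compact_Icc)
    then have "bounded ((\<lambda>w::real. exp (- w) * (1 + w\<^sup>2)) ` {a..b})"
      by (rule compact_imp_bounded)
    then obtain c where c: "\<And>w. w \<in> {a..b} \<Longrightarrow> norm (exp (- w) * (1 + w\<^sup>2)) \<le> c"
      unfolding bounded_iff by blast
    have "norm (f w) \<le> max 1 \<bar>c\<bar>" for w
    proof -
      have nn: "0 \<le> exp (- w) * (1 + w\<^sup>2)" by simp
      consider "w < a" | "w \<in> {a..b}" | "w \<ge> a" "w \<ge> b" by fastforce
      then show ?thesis
      proof cases
        case 2
        then show ?thesis using c[OF 2] by (simp add: f_def)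
      next
        case 3
        then show ?thesis using b[OF 3(2)] nn by (simp add: f_def)
      qed (simp add: f_def)
    qed
    then show ?thesis using that by blast
  qed
  have cont: "isCont f w" if "w \<noteq> a" for w
  proof (cases "w < a")
    case True
    have "\<forall>\<^sub>F y in nhds w. f y = 0"
      using eventually_nhds_in_open[of "{..<a}" w] True by (auto simp: f_def elim!: eventually_mono)
    then show ?thesis by (subst isCont_cong[of f "\<lambda>_. 0"]) auto
  next
    case False
    have "\<forall>\<^sub>F y in nhds w. f y = exp (- y) * (1 + y\<^sup>2)"
      using eventually_nhds_in_open[of "{a<..}" w] False that by (auto simp: f_def elim!: eventually_mono)
    then show ?thesis by (subst isCont_cong) (auto intro!: continuous_intros)
  qed
  have "(\<lambda>n. LINT w|R n. f w) \<longlonglongrightarrow> (LINT w|cauchy_distribution. f w)"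
  proof (rule weak_conv_imp_bdd_ae_continuous_conv[OF rdR real_distribution_cauchy weak])
    have "AE w in cauchy_distribution. w \<noteq> a"
      unfolding cauchy_distribution_def
      by (subst AE_density) (use AE_lborel_singleton[of a] in auto)
    then have "emeasure cauchy_distribution {a} = 0"
      by (subst (asm) AE_iff_measurable[of "{a}"]) (auto simp: cauchy_distribution_def)
    moreover have "{w. \<not> isCont f w} \<subseteq> {a}" using cont by auto
    ultimately show "emeasure cauchy_distribution {w. \<not> isCont f w} = 0"
      by (metis (no_types, lifting) emeasure_mono le_zero_eq sets_density sets_lborel
          borel_singleton cauchy_distribution_def sets.empty_sets insert_code(1))
  qed (use B in auto)
  moreover have "(LINT w|R n. f w) = (LINT w|Q n. indicator {a..} w * exp (- w)) / z n" for n
  proof -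
    have "(?k w / z n) *\<^sub>R f w = (indicator {a..} w * exp (- w)) / z n" for w
      using kpos[of w] by (simp add: f_def)
    then show ?thesis by (simp add: intR)
  qed
  moreover have "(LINT w|cauchy_distribution. f w) = exp (- a) / pi"
  proof -
    have "(LINT w|cauchy_distribution. f w) = (LINT w|lborel. (1 / (pi * (1 + w\<^sup>2))) *\<^sub>R f w)"
      unfolding cauchy_distribution_def by (subst integral_density) auto
    also have "\<dots> = (LINT w|lborel. (indicator {a..} w * exp (- w)) / pi)"
    proof (intro Bochner_Integration.integral_cong refl)
      fix w show "(1 / (pi * (1 + w\<^sup>2))) *\<^sub>R f w = (indicator {a..} w * exp (- w)) / pi"
        using kpos[of w] by (simp add: f_def)
    qed
    also have "\<dots> = (LINT w|lborel. indicator {a..} w * exp (- w)) / pi" by (rule integral_divide_zero)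
    also have "(LINT w|lborel. indicator {a..} w * exp (- w)) = exp (- a)"
    proof -
      have "(\<integral>\<^sup>+ w. ennreal (exp (- w)) * indicator {a..} w \<partial>lborel) = ennreal (0 - (- exp (- a)))"
      proof (rule nn_integral_FTC_atLeast)
        show "((\<lambda>w::real. - exp (- w)) \<longlongrightarrow> 0) at_top" by real_asymp
      qed (auto intro!: derivative_eq_intros)
      then have "has_bochner_integral lborel (\<lambda>w. indicator {a..} w * exp (- w)) (exp (- a))"
        by (intro has_bochner_integral_nn_integral)
          (auto simp: ennreal_mult' ennreal_indicator mult.commute)
      then show ?thesis by (rule has_bochner_integral_integral_eq)
    qed
    finally show ?thesis .
  qed
  ultimately have "(\<lambda>n. (LINT w|Q n. indicator {a..} w * exp (- w)) / z n) \<longlonglongrightarrow> exp (- a) / pi" by simp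
  then have "(\<lambda>n. (x n * z n) * ((LINT w|Q n. indicator {a..} w * exp (- w)) / z n)) \<longlonglongrightarrow> sqrt (2 * pi) / 2 * (exp (- a) / pi)"
    by (intro tendsto_mult xz)
  moreover have "(x n * z n) * ((LINT w|Q n. indicator {a..} w * exp (- w)) / z n) = x n * (LINT w|Q n. indicator {a..} w * exp (- w))" for n
    using zpos[of n] by simp
  moreover have "sqrt (2 * pi) / 2 * (exp (- a) / pi) = exp (- a) / sqrt (2 * pi)"
  proof -
    have "sqrt (2 * pi) * sqrt (2 * pi) = 2 * pi" by simp
    then show ?thesis by (simp add: field_simps)
  qed
  ultimately show ?thesis by simp
qed

section \<open>Mills' ratio\<close>

lemma one_minus_Phi: "1 - Phi x = (LINT y|lborel. indicator {x<..} y * std_normal_density y)"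
proof -
  interpret N: real_distribution std_normal_distribution by (rule real_dist_normal_dist)
  have "1 - Phi x = measure std_normal_distribution (space std_normal_distribution - {..x})"
    unfolding Phi_def by (subst N.prob_compl) auto
  also have "space std_normal_distribution - {..x} = {x<..}" by auto
  also have "measure std_normal_distribution {x<..} = (LINT y|std_normal_distribution. indicator {x<..} y)"
    by simp
  also have "\<dots> = (LINT y|lborel. indicator {x<..} y * std_normal_density y)"
    by (subst integral_density) (auto simp: mult.commute)
  finally show ?thesis .
qed

lemma one_minus_Phi_pos: "0 < 1 - Phi x"
proof -
  have "0 \<le> (LINT y|lborel. indicator {x<..} y * std_normal_density y)"
    by (intro Bochner_Integration.integral_nonneg) auto
  moreover have "(LINT y|lborel. indicator {x<..} y * std_normal_density y) \<noteq> 0"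
  proof
    have i: "integrable lborel (\<lambda>y. indicator {x<..} y * std_normal_density y)"
      by (rule Bochner_Integration.integrable_bound[OF integrable_normal_density[of 1 0]])
        (auto simp: indicator_def)
    assume "(LINT y|lborel. indicator {x<..} y * std_normal_density y) = 0"
    then have "AE y in lborel. indicator {x<..} y * std_normal_density y = 0"
      using integral_nonneg_eq_0_iff_AE[OF i] by auto
    then have "AE y in lborel. y \<notin> {x<..}"
    proof eventually_elim
      case (elim y)
      then show ?case using normal_density_pos[of 1 0 y] by (auto split: split_indicator_asm)
    qed
    then have "emeasure lborel {x<..} = 0"
      by (subst (asm) AE_iff_measurable[of "{x<..}"]) auto
    moreover have "{x<..<x + 1} \<subseteq> {x<..}" unfolding subset_iff by auto
    ultimately have "emeasure lborel {x<..<x + 1} \<le> 0"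
      using emeasure_mono[of "{x<..<x + 1}" "{x<..}" lborel] by simp
    then show False by simp
  qed
  ultimately show ?thesis by (metis one_minus_Phi order_le_less)
qed

text \<open>The substitution y = x + w/x turns the left side into the integral over w > 0 of exp(-w)
  exp(-(w/x)^2/2) / sqrt(2 pi), to which dominated convergence with majorant exp(-w)
  applies.\<close>

lemma Mills_ratio:
  fixes x :: "nat \<Rightarrow> real"
  assumes xpos: "\<And>n. x n > 0" and xinf: "filterlim x at_top sequentially"
  shows "(\<lambda>n. x n * exp ((x n)\<^sup>2 / 2) * (1 - Phi (x n))) \<longlonglongrightarrow> 1 / sqrt (2 * pi)"
proof -
  have eq: "x n * exp ((x n)\<^sup>2 / 2) * (1 - Phi (x n)) =
      (LINT w|lborel. indicator {0<..} w * exp (- w) * (exp (- (w / x n)\<^sup>2 / 2) / sqrt (2 * pi)))" for n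
  proof -
    have "(LINT y|lborel. indicator {x n<..} y * std_normal_density y) =
        \<bar>1 / x n\<bar> *\<^sub>R (LINT w|lborel. indicator {x n<..} (x n + 1 / x n * w) * std_normal_density (x n + 1 / x n * w))"
      using xpos[of n] by (intro lborel_integral_real_affine[of _ "\<lambda>y. indicator {x n<..} y * std_normal_density y"]) auto
    then have "x n * exp ((x n)\<^sup>2 / 2) * (1 - Phi (x n)) =
        exp ((x n)\<^sup>2 / 2) * (LINT w|lborel. indicator {x n<..} (x n + 1 / x n * w) * std_normal_density (x n + 1 / x n * w))"
      using xpos[of n] unfolding one_minus_Phi by simp
    also have "\<dots> = (LINT w|lborel. exp ((x n)\<^sup>2 / 2) * (indicator {x n<..} (x n + 1 / x n * w) * std_normal_density (x n + 1 / x n * w)))"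
      by (rule integral_mult_right_zero[symmetric])
    also have "\<dots> = (LINT w|lborel. indicator {0<..} w * exp (- w) * (exp (- (w / x n)\<^sup>2 / 2) / sqrt (2 * pi)))"
    proof (intro Bochner_Integration.integral_cong refl)
      fix w
      have ind: "indicator {x n<..} (x n + 1 / x n * w) = (indicator {0<..} w :: real)"
        using xpos[of n] by (auto simp: indicator_def zero_less_divide_iff)
      have "exp ((x n)\<^sup>2 / 2) * exp (- (x n + 1 / x n * w)\<^sup>2 / 2) = exp (- w) * exp (- (w / x n)\<^sup>2 / 2)"
        using xpos[of n] unfolding exp_add[symmetric] by (simp add: power2_eq_square field_simps)
      then show "exp ((x n)\<^sup>2 / 2) * (indicator {x n<..} (x n + 1 / x n * w) * std_normal_density (x n + 1 / x n * w)) =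
          indicator {0<..} w * exp (- w) * (exp (- (w / x n)\<^sup>2 / 2) / sqrt (2 * pi))"
        unfolding ind std_normal_density_def by (simp add: field_simps)
    qed
    finally show ?thesis .
  qed
  have hb: "has_bochner_integral lborel (\<lambda>w. indicator {0<..} w * exp (- w)) (1::real)"
  proof -
    have "(LBINT t=0..\<infinity>. exp (- (t * 1))) = (1::real)"
      using LBINT_I0i_exp_mscale[of 1] by simp
    then show ?thesis
      using integrable_I0i_exp_mscale[of 1]
      by (simp add: has_bochner_integral_iff set_integrable_def interval_lebesgue_integral_0_infty set_lebesgue_integral_def)
  qed
  have "(\<lambda>n. LINT w|lborel. indicator {0<..} w * exp (- w) * (exp (- (w / x n)\<^sup>2 / 2) / sqrt (2 * pi)))
      \<longlonglongrightarrow> (LINT w|lborel. indicator {0<..} w * exp (- w) * (exp (- 0\<^sup>2 / 2) / sqrt (2 * pi)))"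
  proof (rule integral_dominated_convergence[where w = "\<lambda>w. indicator {0<..} w * exp (- w)"])
    show "integrable lborel (\<lambda>w. indicator {0<..} w * exp (- w) :: real)"
      using hb by (simp add: has_bochner_integral_iff)
    show "AE w in lborel. (\<lambda>n. indicator {0<..} w * exp (- w) * (exp (- (w / x n)\<^sup>2 / 2) / sqrt (2 * pi)))
        \<longlonglongrightarrow> indicator {0<..} w * exp (- w) * (exp (- 0\<^sup>2 / 2) / sqrt (2 * pi))"
    proof (intro AE_I2)
      fix w
      have "(\<lambda>n. w / x n) \<longlonglongrightarrow> 0"
        using tendsto_divide_0[OF tendsto_const filterlim_at_top_imp_at_infinity[OF xinf]] .
      then show "(\<lambda>n. indicator {0<..} w * exp (- w) * (exp (- (w / x n)\<^sup>2 / 2) / sqrt (2 * pi)))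
        \<longlonglongrightarrow> indicator {0<..} w * exp (- w) * (exp (- 0\<^sup>2 / 2) / sqrt (2 * pi))"
        by (intro tendsto_intros) auto
    qed
    have b: "exp (- y\<^sup>2 / 2) / sqrt (2 * pi) \<le> 1" for y :: real
    proof -
      have "exp (- y\<^sup>2 / 2) \<le> 1" by simp
      also have "1 \<le> sqrt (2 * pi)" using pi_gt3 by simp
      finally show ?thesis by (simp add: divide_le_eq_1)
    qed
    show "AE w in lborel. norm (indicator {0<..} w * exp (- w) * (exp (- (w / x n)\<^sup>2 / 2) / sqrt (2 * pi)))
        \<le> indicator {0<..} w * exp (- w)" for n
    proof (intro AE_I2)
      fix w
      have "indicator {0<..} w * exp (- w) * (exp (- (w / x n)\<^sup>2 / 2) / sqrt (2 * pi))
          \<le> indicator {0<..} w * exp (- w) * 1"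
        by (intro mult_left_mono b) auto
      then show "norm (indicator {0<..} w * exp (- w) * (exp (- (w / x n)\<^sup>2 / 2) / sqrt (2 * pi)))
          \<le> indicator {0<..} w * exp (- w)"
        unfolding real_norm_def by (subst abs_of_nonneg) auto
    qed
  qed auto
  also have "(LINT w|lborel. indicator {0<..} w * exp (- w) * (exp (- 0\<^sup>2 / 2) / sqrt (2 * pi))) = 1 / sqrt (2 * pi)"
    using has_bochner_integral_integral_eq[OF hb] by (subst integral_mult_left_zero) simp
  finally show ?thesis unfolding eq .
qed

section \<open>Moments of the tilted summands\<close>

text \<open>A single constant serves all expansions, so that it can become a locale parameter. The
  three values of \<theta> are those used where h V_n is away from x.\<close>

lemma tilt_constants:
  fixes r :: real
  assumes "4 \<le> r" "r \<le> 5"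
  obtains C where "C \<ge> 1"
    "\<And>y. \<bar>exp (tilt y) - (1 + y - y ^ 3 / 3 - y ^ 4 / 12)\<bar> \<le> C * \<bar>y\<bar> powr r"
    "\<And>y. \<bar>tilt y * exp (tilt y) - (y + y\<^sup>2 / 2 - y ^ 3 / 2)\<bar> \<le> C * y ^ 4"
    "\<And>y. \<bar>(tilt y)\<^sup>2 * exp (tilt y) - y\<^sup>2\<bar> \<le> C * \<bar>y\<bar> ^ 3"
    "\<And>y. \<bar>tilt y\<bar> ^ 3 * exp (tilt y) \<le> C * \<bar>y\<bar> ^ 3"
    "\<And>y \<theta>. \<theta> \<in> {3/2, 1/4, 1/8} \<Longrightarrow>
      exp (y - \<theta> * y\<^sup>2) \<le> 1 + y + (1/2 - \<theta>) * y\<^sup>2 + (1/6 - \<theta>) * y ^ 3 + C * y ^ 4"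
proof -
  obtain C1 where C1: "C1 \<ge> 0" "\<And>y. \<bar>exp (tilt y) - (1 + y - y ^ 3 / 3 - y ^ 4 / 12)\<bar> \<le> C1 * \<bar>y\<bar> powr r"
    using exp_tilt_expansion[OF assms] by blast
  obtain C2 where C2: "C2 \<ge> 0" "\<And>y. \<bar>tilt y * exp (tilt y) - (y + y\<^sup>2 / 2 - y ^ 3 / 2)\<bar> \<le> C2 * y ^ 4"
    using tilt_exp_tilt_expansion by blast
  obtain C3 where C3: "C3 \<ge> 0" "\<And>y. \<bar>(tilt y)\<^sup>2 * exp (tilt y) - y\<^sup>2\<bar> \<le> C3 * \<bar>y\<bar> ^ 3"
    using tilt_square_exp_tilt_expansion by blast
  obtain C4 where C4: "C4 \<ge> 0" "\<And>y. \<bar>tilt y\<bar> ^ 3 * exp (tilt y) \<le> C4 * \<bar>y\<bar> ^ 3"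
    using tilt_cube_exp_tilt_bound by blast
  have ex: "\<exists>C. C \<ge> 0 \<and> (\<forall>y. exp (y - \<theta> * y\<^sup>2) \<le> 1 + y + (1/2 - \<theta>) * y\<^sup>2 + (1/6 - \<theta>) * y ^ 3 + C * y ^ 4)"
    if "\<theta> > 0" for \<theta> :: real
    using exp_quadratic_upper[OF that] by metis
  obtain C5 where C5: "C5 \<ge> 0 \<and> (\<forall>y::real. exp (y - 3/2 * y\<^sup>2)
      \<le> 1 + y + (1/2 - 3/2) * y\<^sup>2 + (1/6 - 3/2) * y ^ 3 + C5 * y ^ 4)"
    by (atomize_elim, rule ex, simp)
  obtain C6 where C6: "C6 \<ge> 0 \<and> (\<forall>y::real. exp (y - 1/4 * y\<^sup>2)
      \<le> 1 + y + (1/2 - 1/4) * y\<^sup>2 + (1/6 - 1/4) * y ^ 3 + C6 * y ^ 4)"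
    by (atomize_elim, rule ex, simp)
  obtain C7 where C7: "C7 \<ge> 0 \<and> (\<forall>y::real. exp (y - 1/8 * y\<^sup>2)
      \<le> 1 + y + (1/2 - 1/8) * y\<^sup>2 + (1/6 - 1/8) * y ^ 3 + C7 * y ^ 4)"
    by (atomize_elim, rule ex, simp)
  define C where "C = 1 + C1 + C2 + C3 + C4 + C5 + C6 + C7"
  have C: "1 \<le> C" "C1 \<le> C" "C2 \<le> C" "C3 \<le> C" "C4 \<le> C" "C5 \<le> C" "C6 \<le> C" "C7 \<le> C"
    using C1(1) C2(1) C3(1) C4(1) C5 C6 C7 by (auto simp: C_def)
  have m: "a \<le> D * q \<Longrightarrow> D \<le> C \<Longrightarrow> 0 \<le> q \<Longrightarrow> a \<le> C * q" for a D q :: real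
    by (meson mult_right_mono order_trans)
  have m': "a \<le> p + D * q \<Longrightarrow> D \<le> C \<Longrightarrow> 0 \<le> q \<Longrightarrow> a \<le> p + C * q" for a D q p :: real
    using mult_right_mono[of D C q] by linarith
  show ?thesis
  proof (rule that[OF C(1)])
    show "\<bar>exp (tilt y) - (1 + y - y ^ 3 / 3 - y ^ 4 / 12)\<bar> \<le> C * \<bar>y\<bar> powr r" for y
      using m[OF C1(2) C(2)] by simp
    show "\<bar>tilt y * exp (tilt y) - (y + y\<^sup>2 / 2 - y ^ 3 / 2)\<bar> \<le> C * y ^ 4" for y
      using m[OF C2(2) C(3)] by simp
    show "\<bar>(tilt y)\<^sup>2 * exp (tilt y) - y\<^sup>2\<bar> \<le> C * \<bar>y\<bar> ^ 3" for y
      using m[OF C3(2) C(4)] by simp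
    show "\<bar>tilt y\<bar> ^ 3 * exp (tilt y) \<le> C * \<bar>y\<bar> ^ 3" for y
      using m[OF C4(2) C(5)] by simp
    show "exp (y - \<theta> * y\<^sup>2) \<le> 1 + y + (1/2 - \<theta>) * y\<^sup>2 + (1/6 - \<theta>) * y ^ 3 + C * y ^ 4"
      if "\<theta> \<in> {3/2, 1/4, 1/8}" for y \<theta>
    proof -
      have y4: "0 \<le> y ^ 4" by simp
      consider "\<theta> = 3/2" | "\<theta> = 1/4" | "\<theta> = 1/8" using \<open>\<theta> \<in> {3/2, 1/4, 1/8}\<close> by blast
      then show ?thesis
        using m'[OF C5[THEN conjunct2, rule_format] C(6) y4]
          m'[OF C6[THEN conjunct2, rule_format] C(7) y4]
          m'[OF C7[THEN conjunct2, rule_format] C(8) y4]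
        by cases (simp_all only:)
    qed
  qed
qed

text \<open>The inequalities of \<open>tilt_constants\<close> are locale assumptions on \<open>C\<close>, so that the constants
  below depend only on \<open>C\<close>, \<open>L\<close> and \<open>c\<close>, uniformly in \<open>i\<close>, \<open>n\<close> and \<open>h\<close>.\<close>

locale self_normalized = prob_space M for M :: "'a measure" +
  fixes X :: "nat \<Rightarrow> 'a \<Rightarrow> real" and r L c C :: real
  assumes rv: "\<And>i. i \<ge> 1 \<Longrightarrow> X i \<in> borel_measurable M"
    and indep: "indep_vars (\<lambda>_. borel) X {1..}"
    and mean_zero: "\<And>i. i \<ge> 1 \<Longrightarrow> expectation (X i) = 0"
    and r: "4 < r" "r \<le> 5"
    and moment_integrable: "\<And>i. i \<ge> 1 \<Longrightarrow> integrable M (\<lambda>\<omega>. \<bar>X i \<omega>\<bar> powr r)"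
    and moment_bound: "\<And>i. i \<ge> 1 \<Longrightarrow> 1 + expectation (\<lambda>\<omega>. \<bar>X i \<omega>\<bar> powr r) \<le> L"
    and c: "c > 0" "\<And>n. c * real n \<le> B_n_sq M X n"
    and C: "C \<ge> 1"
    "\<And>y. \<bar>exp (tilt y) - (1 + y - y ^ 3 / 3 - y ^ 4 / 12)\<bar> \<le> C * \<bar>y\<bar> powr r"
    "\<And>y. \<bar>tilt y * exp (tilt y) - (y + y\<^sup>2 / 2 - y ^ 3 / 2)\<bar> \<le> C * y ^ 4"
    "\<And>y. \<bar>(tilt y)\<^sup>2 * exp (tilt y) - y\<^sup>2\<bar> \<le> C * \<bar>y\<bar> ^ 3"
    "\<And>y. \<bar>tilt y\<bar> ^ 3 * exp (tilt y) \<le> C * \<bar>y\<bar> ^ 3"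
    "\<And>y \<theta>. \<theta> \<in> {3/2, 1/4, 1/8} \<Longrightarrow>
      exp (y - \<theta> * y\<^sup>2) \<le> 1 + y + (1/2 - \<theta>) * y\<^sup>2 + (1/6 - \<theta>) * y ^ 3 + C * y ^ 4"
begin

text \<open>Taylor constant times moment bound. It is at least 1, so products of such constants can
  be rounded up to a common power of \<open>A\<close>.\<close>

definition A :: real where "A = C * L"

definition mom :: "nat \<Rightarrow> nat \<Rightarrow> real" where
  "mom k i = expectation (\<lambda>\<omega>. X i \<omega> ^ k)"

lemma abs_power_le_powr: "k \<le> 4 \<Longrightarrow> \<bar>y\<bar> ^ k \<le> 1 + \<bar>y\<bar> powr r" for y :: real
proof (cases "\<bar>y\<bar> \<le> 1")
  case True
  then have "\<bar>y\<bar> ^ k \<le> 1" by (intro power_le_one) auto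
  then show ?thesis by (simp add: add_increasing2)
next
  case False
  assume "k \<le> 4"
  have "\<bar>y\<bar> ^ k = \<bar>y\<bar> powr real k" using False by (simp add: powr_realpow)
  also have "\<dots> \<le> \<bar>y\<bar> powr r" using False r \<open>k \<le> 4\<close> by (intro powr_mono) auto
  finally show ?thesis by simp
qed

lemma integrable_abs_moment: "i \<ge> 1 \<Longrightarrow> k \<le> 4 \<Longrightarrow> integrable M (\<lambda>\<omega>. \<bar>X i \<omega>\<bar> ^ k)"
proof (rule Bochner_Integration.integrable_bound)
  assume i: "i \<ge> 1" "k \<le> 4"
  show "integrable M (\<lambda>\<omega>. 1 + \<bar>X i \<omega>\<bar> powr r)"
    using moment_integrable[OF i(1)] by simp
  show "AE \<omega> in M. norm (\<bar>X i \<omega>\<bar> ^ k) \<le> norm (1 + \<bar>X i \<omega>\<bar> powr r)"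
    using abs_power_le_powr[OF i(2)] by (intro AE_I2) simp
  show "(\<lambda>\<omega>. \<bar>X i \<omega>\<bar> ^ k) \<in> borel_measurable M"
    using rv[OF i(1)] by measurable
qed

lemma integrable_moment: "i \<ge> 1 \<Longrightarrow> k \<le> 4 \<Longrightarrow> integrable M (\<lambda>\<omega>. X i \<omega> ^ k)"
  by (rule Bochner_Integration.integrable_bound[OF integrable_abs_moment[of i k]])
    (use rv[of i] in \<open>auto simp: power_abs\<close>)

lemma abs_moment_le: "i \<ge> 1 \<Longrightarrow> k \<le> 4 \<Longrightarrow> expectation (\<lambda>\<omega>. \<bar>X i \<omega>\<bar> ^ k) \<le> L"
proof -
  assume i: "i \<ge> 1" "k \<le> 4"
  have "expectation (\<lambda>\<omega>. \<bar>X i \<omega>\<bar> ^ k) \<le> expectation (\<lambda>\<omega>. 1 + \<bar>X i \<omega>\<bar> powr r)"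
    using moment_integrable[OF i(1)] abs_power_le_powr[OF i(2)]
    by (intro integral_mono integrable_abs_moment i) auto
  also have "\<dots> \<le> L"
    using moment_integrable[OF i(1)] moment_bound[OF i(1)] by (simp add: prob_space)
  finally show ?thesis .
qed

lemma L_ge_1: "1 \<le> L"
proof -
  have "0 \<le> expectation (\<lambda>\<omega>. \<bar>X 1 \<omega>\<bar> powr r)" by (intro Bochner_Integration.integral_nonneg) auto
  then show ?thesis using moment_bound[of 1] by linarith
qed

lemma A_ge: "1 \<le> A" "L \<le> A" "C \<le> A"
  using mult_mono[of 1 C 1 L] mult_right_mono[of 1 C L] mult_left_mono[of 1 L C] C(1) L_ge_1
  by (auto simp: A_def)

lemma abs_mom_le: "i \<ge> 1 \<Longrightarrow> k \<le> 4 \<Longrightarrow> \<bar>mom k i\<bar> \<le> L"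
  using integral_abs_bound[of M "\<lambda>\<omega>. X i \<omega> ^ k"] abs_moment_le[of i k]
  by (simp add: mom_def power_abs)

lemma mom_even_nonneg: "even k \<Longrightarrow> 0 \<le> mom k i"
  unfolding mom_def by (intro Bochner_Integration.integral_nonneg) auto

context
  fixes i :: nat and h :: real
  assumes i: "i \<ge> 1" and h: "h > 0"
begin

lemma X_measurable [measurable]: "X i \<in> borel_measurable M" using rv i by blast

lemma tilt_measurable [measurable]: "(\<lambda>\<omega>. tilt (h * X i \<omega>)) \<in> borel_measurable M"
  unfolding tilt_def by measurable

text \<open>Applied to Taylor remainders of order k: the mean is at most C h^k E|X_i|^k, and
  \<open>L\<close> bounds every absolute moment up to order 4 because |y|^k <= 1 + |y|^r.\<close>

lemma tilt_moment_le:
  assumes "\<And>y. \<bar>g y\<bar> \<le> C * \<bar>y\<bar> ^ k" "k \<le> 4"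
    and [measurable]: "(\<lambda>\<omega>. g (h * X i \<omega>)) \<in> borel_measurable M"
  shows "integrable M (\<lambda>\<omega>. g (h * X i \<omega>))" "\<bar>expectation (\<lambda>\<omega>. g (h * X i \<omega>))\<bar> \<le> A * h ^ k"
proof -
  have b: "\<bar>g (h * X i \<omega>)\<bar> \<le> C * h ^ k * \<bar>X i \<omega>\<bar> ^ k" for \<omega>
    using assms(1)[of "h * X i \<omega>"] h by (simp add: abs_mult power_mult_distrib mult_ac)
  have int: "integrable M (\<lambda>\<omega>. C * h ^ k * \<bar>X i \<omega>\<bar> ^ k)"
    using integrable_abs_moment[OF i assms(2)] by simp
  show 1: "integrable M (\<lambda>\<omega>. g (h * X i \<omega>))"
    by (rule Bochner_Integration.integrable_bound[OF int]) (use b in \<open>auto intro!: AE_I2 order_trans[OF b]\<close>)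
  have "\<bar>expectation (\<lambda>\<omega>. g (h * X i \<omega>))\<bar> \<le> expectation (\<lambda>\<omega>. \<bar>g (h * X i \<omega>)\<bar>)"
    using integral_abs_bound by blast
  also have "\<dots> \<le> expectation (\<lambda>\<omega>. C * h ^ k * \<bar>X i \<omega>\<bar> ^ k)"
    by (intro integral_mono int integrable_abs 1 b)
  also have "\<dots> = C * h ^ k * expectation (\<lambda>\<omega>. \<bar>X i \<omega>\<bar> ^ k)" by simp
  also have "\<dots> \<le> C * h ^ k * L"
    using C(1) h by (intro mult_left_mono abs_moment_le i assms(2)) auto
  finally show "\<bar>expectation (\<lambda>\<omega>. g (h * X i \<omega>))\<bar> \<le> A * h ^ k" by (simp add: A_def mult_ac)
qed

lemma power_hX: "k \<le> 4 \<Longrightarrow> integrable M (\<lambda>\<omega>. (h * X i \<omega>) ^ k)"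
  "expectation (\<lambda>\<omega>. (h * X i \<omega>) ^ k) = h ^ k * mom k i"
  using integrable_moment[OF i, of k] by (auto simp: power_mult_distrib mom_def)

lemma tilt_exp_integrable: "integrable M (\<lambda>\<omega>. exp (tilt (h * X i \<omega>)))"
  by (rule integrable_const_bound[of _ "exp (1/2)"]) (use exp_tilt_le in auto)

text \<open>The linear term drops out by mean zero, and there is no quadratic one. The remainder
  uses the r-th moment itself: an order above 4 makes the summed error n h^r small relative to n
  h^4.\<close>

lemma exp_tilt_mean_expansion:
  "\<bar>expectation (\<lambda>\<omega>. exp (tilt (h * X i \<omega>))) - (1 - h ^ 3 * mom 3 i / 3 - h ^ 4 * mom 4 i / 12)\<bar> \<le> A * h powr r"
proof -
  let ?p = "\<lambda>y::real. 1 + y - y ^ 3 / 3 - y ^ 4 / 12"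
  have ip: "integrable M (\<lambda>\<omega>. ?p (h * X i \<omega>))"
    using power_hX(1)[of 1] power_hX(1)[of 3] power_hX(1)[of 4] by simp
  have ep: "expectation (\<lambda>\<omega>. ?p (h * X i \<omega>)) = 1 - h ^ 3 * mom 3 i / 3 - h ^ 4 * mom 4 i / 12"
    using power_hX(1)[of 1] power_hX(1)[of 3] power_hX(1)[of 4] power_hX(2)[of 3] power_hX(2)[of 4] mean_zero[OF i]
    by (simp add: prob_space)
  have int: "integrable M (\<lambda>\<omega>. C * h powr r * \<bar>X i \<omega>\<bar> powr r)"
    using moment_integrable[OF i] by simp
  have b: "\<bar>exp (tilt (h * X i \<omega>)) - ?p (h * X i \<omega>)\<bar> \<le> C * h powr r * \<bar>X i \<omega>\<bar> powr r" for \<omega>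
    using C(2)[of "h * X i \<omega>"] h by (simp add: abs_mult powr_mult mult.assoc)
  have "\<bar>expectation (\<lambda>\<omega>. exp (tilt (h * X i \<omega>))) - expectation (\<lambda>\<omega>. ?p (h * X i \<omega>))\<bar>
      = \<bar>expectation (\<lambda>\<omega>. exp (tilt (h * X i \<omega>)) - ?p (h * X i \<omega>))\<bar>"
    by (subst Bochner_Integration.integral_diff[OF tilt_exp_integrable ip]) simp
  also have "\<dots> \<le> expectation (\<lambda>\<omega>. \<bar>exp (tilt (h * X i \<omega>)) - ?p (h * X i \<omega>)\<bar>)"
    using integral_abs_bound by blast
  also have "\<dots> \<le> expectation (\<lambda>\<omega>. C * h powr r * \<bar>X i \<omega>\<bar> powr r)"
    by (intro integral_mono int integrable_abs Bochner_Integration.integrable_diff tilt_exp_integrable ip b)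
  also have "\<dots> = C * h powr r * expectation (\<lambda>\<omega>. \<bar>X i \<omega>\<bar> powr r)" by simp
  also have "\<dots> \<le> C * h powr r * L"
    using C(1) moment_bound[OF i] by (intro mult_left_mono) auto
  finally show ?thesis unfolding ep by (simp add: A_def mult_ac)
qed

lemma tilt_exp_tilt_mean:
  "integrable M (\<lambda>\<omega>. tilt (h * X i \<omega>) * exp (tilt (h * X i \<omega>)))"
  "\<bar>expectation (\<lambda>\<omega>. tilt (h * X i \<omega>) * exp (tilt (h * X i \<omega>))) - (h\<^sup>2 * mom 2 i / 2 - h ^ 3 * mom 3 i / 2)\<bar> \<le> A * h ^ 4"
proof -
  let ?p = "\<lambda>y::real. y + y\<^sup>2 / 2 - y ^ 3 / 2"
  let ?g = "\<lambda>y. tilt y * exp (tilt y) - ?p y"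
  have ip: "integrable M (\<lambda>\<omega>. ?p (h * X i \<omega>))"
    using power_hX(1)[of 1] power_hX(1)[of 2] power_hX(1)[of 3] by simp
  have ep: "expectation (\<lambda>\<omega>. ?p (h * X i \<omega>)) = h\<^sup>2 * mom 2 i / 2 - h ^ 3 * mom 3 i / 2"
    using power_hX(1)[of 1] power_hX(1)[of 2] power_hX(1)[of 3] power_hX(2)[of 2] power_hX(2)[of 3] mean_zero[OF i]
    by simp
  have g: "integrable M (\<lambda>\<omega>. ?g (h * X i \<omega>))" "\<bar>expectation (\<lambda>\<omega>. ?g (h * X i \<omega>))\<bar> \<le> A * h ^ 4"
    using tilt_moment_le[of ?g 4] C(3) by simp_all
  show t: "integrable M (\<lambda>\<omega>. tilt (h * X i \<omega>) * exp (tilt (h * X i \<omega>)))"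
    using Bochner_Integration.integrable_add[OF g(1) ip] by simp
  show "\<bar>expectation (\<lambda>\<omega>. tilt (h * X i \<omega>) * exp (tilt (h * X i \<omega>))) - (h\<^sup>2 * mom 2 i / 2 - h ^ 3 * mom 3 i / 2)\<bar> \<le> A * h ^ 4"
    using g(2) unfolding ep[symmetric] Bochner_Integration.integral_diff[OF t ip] .
qed

lemma tilt_square_exp_tilt_mean:
  "integrable M (\<lambda>\<omega>. (tilt (h * X i \<omega>))\<^sup>2 * exp (tilt (h * X i \<omega>)))"
  "\<bar>expectation (\<lambda>\<omega>. (tilt (h * X i \<omega>))\<^sup>2 * exp (tilt (h * X i \<omega>))) - h\<^sup>2 * mom 2 i\<bar> \<le> A * h ^ 3"
proof -
  let ?g = "\<lambda>y. (tilt y)\<^sup>2 * exp (tilt y) - y\<^sup>2"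
  have ip: "integrable M (\<lambda>\<omega>. (h * X i \<omega>)\<^sup>2)" by (rule power_hX) simp
  have g: "integrable M (\<lambda>\<omega>. ?g (h * X i \<omega>))" "\<bar>expectation (\<lambda>\<omega>. ?g (h * X i \<omega>))\<bar> \<le> A * h ^ 3"
    using tilt_moment_le[of ?g 3] C(4) by simp_all
  show t: "integrable M (\<lambda>\<omega>. (tilt (h * X i \<omega>))\<^sup>2 * exp (tilt (h * X i \<omega>)))"
    using Bochner_Integration.integrable_add[OF g(1) ip] by simp
  show "\<bar>expectation (\<lambda>\<omega>. (tilt (h * X i \<omega>))\<^sup>2 * exp (tilt (h * X i \<omega>))) - h\<^sup>2 * mom 2 i\<bar> \<le> A * h ^ 3"
    using g(2) unfolding power_hX(2)[symmetric] Bochner_Integration.integral_diff[OF t ip] .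
qed

lemma tilt_cube_exp_tilt_mean:
  "integrable M (\<lambda>\<omega>. \<bar>tilt (h * X i \<omega>)\<bar> ^ 3 * exp (tilt (h * X i \<omega>)))"
  "expectation (\<lambda>\<omega>. \<bar>tilt (h * X i \<omega>)\<bar> ^ 3 * exp (tilt (h * X i \<omega>))) \<le> A * h ^ 3"
proof -
  let ?g = "\<lambda>y. \<bar>tilt y\<bar> ^ 3 * exp (tilt y)"
  have g: "integrable M (\<lambda>\<omega>. ?g (h * X i \<omega>))" "\<bar>expectation (\<lambda>\<omega>. ?g (h * X i \<omega>))\<bar> \<le> A * h ^ 3"
    using tilt_moment_le[of ?g 3] C(5) by simp_all
  then show "integrable M (\<lambda>\<omega>. ?g (h * X i \<omega>))" "expectation (\<lambda>\<omega>. ?g (h * X i \<omega>)) \<le> A * h ^ 3"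
    by auto
qed

text \<open>Passing from 1 + z to exp z needs no smallness of h and turns the later product over i
  into the exponential of a sum. The fourth moment may be bounded crudely by \<open>L\<close>, since
  the tail bounds only need an error of order n h^4.\<close>

lemma exp_quadratic_mean:
  assumes \<theta>: "\<theta> \<in> {3/2, 1/4, 1/8}"
  shows "integrable M (\<lambda>\<omega>. exp (h * X i \<omega> - \<theta> * (h * X i \<omega>)\<^sup>2))"
    "expectation (\<lambda>\<omega>. exp (h * X i \<omega> - \<theta> * (h * X i \<omega>)\<^sup>2)) \<le>
       exp ((1/2 - \<theta>) * (h\<^sup>2 * mom 2 i) + (1/6 - \<theta>) * (h ^ 3 * mom 3 i) + A * h ^ 4)"
proof -
  have tpos: "\<theta> > 0" using \<theta> by auto
  have ub: "y - \<theta> * y\<^sup>2 \<le> 1 / (4 * \<theta>)" for y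
  proof -
    have "0 \<le> (2 * \<theta> * y - 1)\<^sup>2" by simp
    then show ?thesis using tpos by (simp add: power2_eq_square field_simps)
  qed
  show int: "integrable M (\<lambda>\<omega>. exp (h * X i \<omega> - \<theta> * (h * X i \<omega>)\<^sup>2))"
    by (rule integrable_const_bound[of _ "exp (1 / (4 * \<theta>))"]) (use ub in auto)
  let ?p = "\<lambda>y::real. 1 + y + (1/2 - \<theta>) * y\<^sup>2 + (1/6 - \<theta>) * y ^ 3 + C * y ^ 4"
  have ip: "integrable M (\<lambda>\<omega>. ?p (h * X i \<omega>))"
    using power_hX(1)[of 1] power_hX(1)[of 2] power_hX(1)[of 3] power_hX(1)[of 4]
    by (intro Bochner_Integration.integrable_add integrable_mult_right) simp_all
  have "expectation (\<lambda>\<omega>. exp (h * X i \<omega> - \<theta> * (h * X i \<omega>)\<^sup>2)) \<le> expectation (\<lambda>\<omega>. ?p (h * X i \<omega>))"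
    by (intro integral_mono int ip C(6) \<theta>)
  also have "\<dots> = 1 + (1/2 - \<theta>) * (h\<^sup>2 * mom 2 i) + (1/6 - \<theta>) * (h ^ 3 * mom 3 i) + C * (h ^ 4 * mom 4 i)"
    using power_hX(1)[of 1] power_hX(1)[of 2] power_hX(1)[of 3] power_hX(1)[of 4]
      power_hX(2)[of 2] power_hX(2)[of 3] power_hX(2)[of 4] mean_zero[OF i]
    by (simp add: prob_space)
  also have "C * (h ^ 4 * mom 4 i) \<le> C * (h ^ 4 * L)"
    using abs_mom_le[OF i, of 4] C(1) h by (intro mult_left_mono) auto
  also have "C * (h ^ 4 * L) = A * h ^ 4" by (simp add: A_def)
  also have "1 + (1/2 - \<theta>) * (h\<^sup>2 * mom 2 i) + (1/6 - \<theta>) * (h ^ 3 * mom 3 i) + A * h ^ 4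
      \<le> exp ((1/2 - \<theta>) * (h\<^sup>2 * mom 2 i) + (1/6 - \<theta>) * (h ^ 3 * mom 3 i) + A * h ^ 4)"
    using exp_ge_add_one_self[of "(1/2 - \<theta>) * (h\<^sup>2 * mom 2 i) + (1/6 - \<theta>) * (h ^ 3 * mom 3 i) + A * h ^ 4"]
    by linarith
  finally show "expectation (\<lambda>\<omega>. exp (h * X i \<omega> - \<theta> * (h * X i \<omega>)\<^sup>2)) \<le>
       exp ((1/2 - \<theta>) * (h\<^sup>2 * mom 2 i) + (1/6 - \<theta>) * (h ^ 3 * mom 3 i) + A * h ^ 4)" by simp
qed

end

section \<open>Characteristic functions of the tilted summands\<close>

text \<open>The tilted mean through order h^3, taken as a polynomial in h instead of the exact mean
  so that its sum over i is exactly x^2/2 - T3/2 when x^2 = h^2 B_n^2.\<close>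

definition tmean :: "real \<Rightarrow> nat \<Rightarrow> real" where
  "tmean h i = h\<^sup>2 * mom 2 i / 2 - h ^ 3 * mom 3 i / 2"

definition zeta :: "real \<Rightarrow> nat \<Rightarrow> real" where
  "zeta h i = expectation (\<lambda>\<omega>. exp (tilt (h * X i \<omega>)))"

text \<open>The characteristic function of \<open>tilt (h * X i)\<close> under the law with density proportional to
  \<open>exp (tilt (h * X i))\<close>, centred at the approximate mean \<open>tmean h i\<close>.\<close>

definition psi :: "real \<Rightarrow> nat \<Rightarrow> real \<Rightarrow> complex" where
  "psi h i t = (LINT \<omega>|M. complex_of_real (exp (tilt (h * X i \<omega>))) * iexp (t * (tilt (h * X i \<omega>) - tmean h i))) / zeta h i"

text \<open>Since A >= 1, this forces h <= 1 and 2 A h^3 <= 1/2, which keeps the normalising factors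
  \<open>zeta\<close> between 1/2 and 2.\<close>

definition small :: "real \<Rightarrow> bool" where
  "small h \<longleftrightarrow> 0 < h \<and> 4 * A * h \<le> 1"

lemma smallD: "small h \<Longrightarrow> 0 < h" "small h \<Longrightarrow> h \<le> 1" "small h \<Longrightarrow> 4 * A * h \<le> 1"
proof -
  assume s: "small h"
  then show "0 < h" "4 * A * h \<le> 1" by (auto simp: small_def)
  have "1 * h \<le> 4 * A * h" using A_ge(1) \<open>0 < h\<close> by (intro mult_right_mono) auto
  then show "h \<le> 1" using \<open>4 * A * h \<le> 1\<close> by simp
qed

text \<open>The cubic term, the quartic term and the remainder contribute at most 1/3, 1/12 and 1
  times A h^3, which add up to less than 2 A h^3.\<close>

lemma abs_zeta_minus_1_le:
  assumes i: "i \<ge> 1" and s: "small h"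
  shows "\<bar>zeta h i - 1\<bar> \<le> 2 * A * h ^ 3" "2 * A * h ^ 3 \<le> 1 / 2" "1 / 2 \<le> zeta h i" "zeta h i \<le> 2"
proof -
  note h = smallD[OF s]
  have a: "\<bar>h ^ 3 * mom 3 i / 3\<bar> \<le> A * h ^ 3 / 3"
    using abs_mom_le[OF i, of 3] A_ge h(1) mult_left_mono[of "\<bar>mom 3 i\<bar>" A "h ^ 3"]
    by (simp add: abs_mult mult.commute)
  have "h ^ 4 \<le> h ^ 3" using h by (intro power_decreasing) auto
  then have "h ^ 4 * \<bar>mom 4 i\<bar> \<le> h ^ 3 * A"
    using abs_mom_le[OF i, of 4] A_ge h(1) by (intro mult_mono) auto
  then have b: "\<bar>h ^ 4 * mom 4 i / 12\<bar> \<le> A * h ^ 3 / 12"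
    using h(1) by (simp add: abs_mult mult.commute)
  have "h powr r \<le> h powr 3" using h r by (intro powr_mono') auto
  also have "h powr 3 = h ^ 3" using h(1) powr_realpow[of h 3] by simp
  finally have pr: "A * h powr r \<le> A * h ^ 3" using A_ge by (intro mult_left_mono) auto
  have "0 \<le> A * h ^ 3" using A_ge(1) h(1) by simp
  moreover have "\<bar>zeta h i - (1 - h ^ 3 * mom 3 i / 3 - h ^ 4 * mom 4 i / 12)\<bar> \<le> A * h powr r"
    using exp_tilt_mean_expansion[OF i h(1)] unfolding zeta_def .
  ultimately show z: "\<bar>zeta h i - 1\<bar> \<le> 2 * A * h ^ 3"
    using a b pr by linarith
  have "4 * A * h * (h * h) \<le> 1 * (1 * 1)" using h A_ge by (intro mult_mono) auto
  then show hh: "2 * A * h ^ 3 \<le> 1 / 2" by (simp add: power3_eq_cube mult.assoc)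
  show "1 / 2 \<le> zeta h i" "zeta h i \<le> 2" using z hh by (auto simp: abs_le_iff)
qed

lemma abs_tmean_le:
  assumes i: "i \<ge> 1" and s: "small h"
  shows "\<bar>tmean h i\<bar> \<le> A * h\<^sup>2"
proof -
  note h = smallD[OF s]
  have a: "h\<^sup>2 * \<bar>mom 2 i\<bar> \<le> h\<^sup>2 * A"
    using abs_mom_le[OF i, of 2] A_ge h(1) by (intro mult_left_mono) auto
  have "h ^ 3 \<le> h\<^sup>2" using h by (intro power_decreasing) auto
  then have b: "h ^ 3 * \<bar>mom 3 i\<bar> \<le> h\<^sup>2 * A"
    using abs_mom_le[OF i, of 3] A_ge h(1) by (intro mult_mono) auto
  have "\<bar>h\<^sup>2 * mom 2 i\<bar> \<le> h\<^sup>2 * A" "\<bar>h ^ 3 * mom 3 i\<bar> \<le> h\<^sup>2 * A"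
    using a b h(1) by (simp_all only: abs_mult) auto
  then show ?thesis unfolding tmean_def mult.commute[of A] by linarith
qed

lemma norm_psi_le_1:
  assumes i: "i \<ge> 1" and s: "small h"
  shows "norm (psi h i t) \<le> 1"
proof -
  note h = smallD[OF s]
  have z: "zeta h i > 0" using abs_zeta_minus_1_le[OF i s] by linarith
  have "norm (LINT \<omega>|M. complex_of_real (exp (tilt (h * X i \<omega>))) * iexp (t * (tilt (h * X i \<omega>) - tmean h i)))
      \<le> (LINT \<omega>|M. norm (complex_of_real (exp (tilt (h * X i \<omega>))) * iexp (t * (tilt (h * X i \<omega>) - tmean h i))))"
    by (rule integral_norm_bound)
  also have "\<dots> = zeta h i"
    unfolding zeta_def by (simp add: norm_mult)
  finally show ?thesis using z by (simp add: psi_def norm_divide)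
qed

text \<open>exp(i t (Y - \<mu>)) is expanded to second order under the tilted weight. Since
  \<open>tmean\<close> matches the mean up to h^4, the linear term leaves only |t| h^4; the second
  moment is off by order h^3, and the third absolute moment, of order h^3, bounds the Taylor
  remainder. Division by \<open>zeta\<close> >= 1/2 doubles the constants.\<close>

lemma psi_expansion:
  assumes i: "i \<ge> 1" and s: "small h"
  shows "norm (psi h i t - complex_of_real (1 - t\<^sup>2 * (h\<^sup>2 * mom 2 i) / 2))
    \<le> 10 * A ^ 3 * (\<bar>t\<bar> * h ^ 4 + t\<^sup>2 * h ^ 3 + \<bar>t\<bar> ^ 3 * h ^ 3)"
proof -
  note h = smallD[OF s]
  define Y where "Y \<omega> = tilt (h * X i \<omega>)" for \<omega>
  define \<mu> where "\<mu> = tmean h i"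
  define z where "z = zeta h i"
  define a1 where "a1 = expectation (\<lambda>\<omega>. Y \<omega> * exp (Y \<omega>))"
  define a2 where "a2 = expectation (\<lambda>\<omega>. (Y \<omega>)\<^sup>2 * exp (Y \<omega>))"
  define a3 where "a3 = expectation (\<lambda>\<omega>. \<bar>Y \<omega>\<bar> ^ 3 * exp (Y \<omega>))"
  have Ym [measurable]: "Y \<in> borel_measurable M"
    using tilt_measurable[OF i h(1)] unfolding Y_def .
  have i0: "integrable M (\<lambda>\<omega>. exp (Y \<omega>))" and i1: "integrable M (\<lambda>\<omega>. Y \<omega> * exp (Y \<omega>))"
    and i2: "integrable M (\<lambda>\<omega>. (Y \<omega>)\<^sup>2 * exp (Y \<omega>))" and i3: "integrable M (\<lambda>\<omega>. \<bar>Y \<omega>\<bar> ^ 3 * exp (Y \<omega>))"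
    unfolding Y_def using tilt_exp_integrable[OF i h(1)] tilt_exp_tilt_mean(1)[OF i h(1)]
      tilt_square_exp_tilt_mean(1)[OF i h(1)] tilt_cube_exp_tilt_mean(1)[OF i h(1)] by auto
  have z: "\<bar>z - 1\<bar> \<le> 2 * A * h ^ 3" "1 / 2 \<le> z" "z \<le> 2"
    using abs_zeta_minus_1_le[OF i s] by (auto simp: z_def)
  have zE: "expectation (\<lambda>\<omega>. exp (Y \<omega>)) = z" by (simp add: z_def zeta_def Y_def)
  have \<mu>: "\<bar>\<mu>\<bar> \<le> A * h\<^sup>2" using abs_tmean_le[OF i s] by (simp add: \<mu>_def)
  have a1: "\<bar>a1 - \<mu>\<bar> \<le> A * h ^ 4"
    using tilt_exp_tilt_mean(2)[OF i h(1)] by (simp add: a1_def Y_def \<mu>_def tmean_def)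
  have a2: "\<bar>a2 - h\<^sup>2 * mom 2 i\<bar> \<le> A * h ^ 3"
    using tilt_square_exp_tilt_mean(2)[OF i h(1)] by (simp add: a2_def Y_def)
  have a3: "a3 \<le> A * h ^ 3"
    using tilt_cube_exp_tilt_mean(2)[OF i h(1)] by (simp add: a3_def Y_def)
  \<comment> \<open>With A >= 1 and h <= 1, all constants below are rounded up to A^3 and all powers
    of h to h^3 or h^4.\<close>
  have AA: "1 \<le> A" "A \<le> A\<^sup>2" "A\<^sup>2 \<le> A ^ 3"
    using A_ge(1) power_increasing[of 1 2 A] power_increasing[of 2 3 A] by simp_all
  have hp: "h ^ 4 \<le> h ^ 3" "h ^ 5 \<le> h ^ 4" "h ^ 6 \<le> h ^ 3" "h ^ 3 \<le> h ^ 2" "h ^ 4 \<le> h ^ 2"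
    using h by (auto intro!: power_decreasing)

  define b1 where "b1 = expectation (\<lambda>\<omega>. (Y \<omega> - \<mu>) * exp (Y \<omega>))"
  define b2 where "b2 = expectation (\<lambda>\<omega>. (Y \<omega> - \<mu>)\<^sup>2 * exp (Y \<omega>))"
  define b3 where "b3 = expectation (\<lambda>\<omega>. \<bar>Y \<omega> - \<mu>\<bar> ^ 3 * exp (Y \<omega>))"
  have e1: "(\<lambda>\<omega>. (Y \<omega> - \<mu>) * exp (Y \<omega>)) = (\<lambda>\<omega>. Y \<omega> * exp (Y \<omega>) - \<mu> * exp (Y \<omega>))"
    by (auto simp: algebra_simps)
  have j1: "integrable M (\<lambda>\<omega>. (Y \<omega> - \<mu>) * exp (Y \<omega>))" unfolding e1 using i0 i1 by simp
  have b1': "b1 = a1 - \<mu> * z" unfolding b1_def e1 using i0 i1 by (simp add: a1_def zE)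
  have e2: "(\<lambda>\<omega>. (Y \<omega> - \<mu>)\<^sup>2 * exp (Y \<omega>)) =
      (\<lambda>\<omega>. (Y \<omega>)\<^sup>2 * exp (Y \<omega>) - 2 * \<mu> * (Y \<omega> * exp (Y \<omega>)) + \<mu>\<^sup>2 * exp (Y \<omega>))"
    by (auto simp: algebra_simps power2_eq_square)
  have j2: "integrable M (\<lambda>\<omega>. (Y \<omega> - \<mu>)\<^sup>2 * exp (Y \<omega>))" unfolding e2 using i0 i1 i2 by simp
  have b2': "b2 = a2 - 2 * \<mu> * a1 + \<mu>\<^sup>2 * z" unfolding b2_def e2 using i0 i1 i2 by (simp add: a1_def a2_def zE)
  have cube: "\<bar>y - m\<bar> ^ 3 \<le> 4 * (\<bar>y\<bar> ^ 3 + \<bar>m\<bar> ^ 3)" for y m :: real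
  proof -
    have "\<bar>y - m\<bar> ^ 3 \<le> (\<bar>y\<bar> + \<bar>m\<bar>) ^ 3" by (intro power_mono) auto
    also have "\<dots> \<le> 4 * (\<bar>y\<bar> ^ 3 + \<bar>m\<bar> ^ 3)"
    proof -
      have "4 * (a ^ 3 + b ^ 3) - (a + b) ^ 3 = 3 * (a + b) * (a - b)\<^sup>2" for a b :: real
        by (simp add: power2_eq_square power3_eq_cube algebra_simps)
      from this[of "\<bar>y\<bar>" "\<bar>m\<bar>"] have "0 \<le> 4 * (\<bar>y\<bar> ^ 3 + \<bar>m\<bar> ^ 3) - (\<bar>y\<bar> + \<bar>m\<bar>) ^ 3" by simp
      then show ?thesis by simp
    qed
    finally show ?thesis .
  qed
  have j3b: "integrable M (\<lambda>\<omega>. 4 * (\<bar>Y \<omega>\<bar> ^ 3 * exp (Y \<omega>)) + 4 * \<bar>\<mu>\<bar> ^ 3 * exp (Y \<omega>))" using i0 i3 by simp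
  have cb: "\<bar>Y \<omega> - \<mu>\<bar> ^ 3 * exp (Y \<omega>) \<le> 4 * (\<bar>Y \<omega>\<bar> ^ 3 * exp (Y \<omega>)) + 4 * \<bar>\<mu>\<bar> ^ 3 * exp (Y \<omega>)" for \<omega>
    using mult_right_mono[OF cube[of "Y \<omega>" \<mu>], of "exp (Y \<omega>)"] by (simp add: algebra_simps)
  have j3: "integrable M (\<lambda>\<omega>. \<bar>Y \<omega> - \<mu>\<bar> ^ 3 * exp (Y \<omega>))"
    by (rule Bochner_Integration.integrable_bound[OF j3b]) (auto intro!: AE_I2 order_trans[OF cb])
  have "b3 \<le> expectation (\<lambda>\<omega>. 4 * (\<bar>Y \<omega>\<bar> ^ 3 * exp (Y \<omega>)) + 4 * \<bar>\<mu>\<bar> ^ 3 * exp (Y \<omega>))"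
    unfolding b3_def by (intro integral_mono j3 j3b cb)
  also have "\<dots> = 4 * a3 + 4 * \<bar>\<mu>\<bar> ^ 3 * z" using i0 i3 by (simp add: a3_def zE)
  finally have b3': "b3 \<le> 4 * a3 + 4 * \<bar>\<mu>\<bar> ^ 3 * z" .

  \<comment> \<open>The centre reduces the first moment from order h^2 to h^4. The weight has total
    mass z and not 1, which adds \<mu> (z - 1), of the smaller order h^5.\<close>
  have B1: "\<bar>b1\<bar> \<le> 3 * A ^ 3 * h ^ 4"
  proof -
    have "\<bar>\<mu>\<bar> * \<bar>z - 1\<bar> \<le> (A * h\<^sup>2) * (2 * A * h ^ 3)"
      using \<mu> z(1) by (intro mult_mono) auto
    also have "\<dots> = 2 * (A\<^sup>2 * h ^ 5)" by (simp add: power2_eq_square power3_eq_cube eval_nat_numeral)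
    also have "\<dots> \<le> 2 * (A ^ 3 * h ^ 4)" using AA hp h by (intro mult_left_mono mult_mono) auto
    finally have 1: "\<bar>\<mu>\<bar> * \<bar>z - 1\<bar> \<le> 2 * (A ^ 3 * h ^ 4)" .
    have "A * h ^ 4 \<le> A ^ 3 * h ^ 4" using AA h by (intro mult_right_mono) auto
    moreover have "b1 = (a1 - \<mu>) - \<mu> * (z - 1)" by (simp add: b1' algebra_simps)
    moreover have "\<bar>(a1 - \<mu>) - \<mu> * (z - 1)\<bar> \<le> \<bar>a1 - \<mu>\<bar> + \<bar>\<mu>\<bar> * \<bar>z - 1\<bar>"
      unfolding abs_mult[symmetric] by linarith
    ultimately show ?thesis using a1 1 by linarith
  qed
  have a1': "\<bar>a1\<bar> \<le> 2 * A * h\<^sup>2"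
  proof -
    have "A * h ^ 4 \<le> A * h\<^sup>2" using AA hp by (intro mult_left_mono) auto
    then show ?thesis using a1 \<mu> by linarith
  qed
  have B2: "\<bar>b2 - h\<^sup>2 * mom 2 i\<bar> \<le> 7 * A ^ 3 * h ^ 3"
  proof -
    have "\<bar>\<mu>\<bar> * \<bar>a1\<bar> \<le> (A * h\<^sup>2) * (2 * A * h\<^sup>2)" using \<mu> a1' by (intro mult_mono) auto
    also have "\<dots> = 2 * (A\<^sup>2 * h ^ 4)" by (simp add: power2_eq_square eval_nat_numeral)
    also have "\<dots> \<le> 2 * (A ^ 3 * h ^ 3)" using AA hp h by (intro mult_left_mono mult_mono) auto
    finally have 1: "\<bar>\<mu> * a1\<bar> \<le> 2 * (A ^ 3 * h ^ 3)" by (simp add: abs_mult)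
    have "\<mu>\<^sup>2 \<le> (A * h\<^sup>2)\<^sup>2" using \<mu> AA by (intro abs_le_square_iff[THEN iffD1]) auto
    then have "\<mu>\<^sup>2 * z \<le> (A * h\<^sup>2)\<^sup>2 * 2" using z by (intro mult_mono) auto
    also have "\<dots> = 2 * (A\<^sup>2 * h ^ 4)" by (simp add: power2_eq_square eval_nat_numeral)
    also have "\<dots> \<le> 2 * (A ^ 3 * h ^ 3)" using AA hp h by (intro mult_left_mono mult_mono) auto
    finally have 2: "\<mu>\<^sup>2 * z \<le> 2 * (A ^ 3 * h ^ 3)" .
    have 3: "0 \<le> \<mu>\<^sup>2 * z" using z by simp
    have 4: "A * h ^ 3 \<le> A ^ 3 * h ^ 3" using AA h by (intro mult_right_mono) auto
    have "b2 - h\<^sup>2 * mom 2 i = (a2 - h\<^sup>2 * mom 2 i) - 2 * (\<mu> * a1) + \<mu>\<^sup>2 * z" by (simp add: b2')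
    then show ?thesis using a2 1 2 3 4 by linarith
  qed
  have B3: "b3 \<le> 12 * A ^ 3 * h ^ 3"
  proof -
    have "\<bar>\<mu>\<bar> ^ 3 * z \<le> (A * h\<^sup>2) ^ 3 * 2" using \<mu> z AA h by (intro mult_mono power_mono) auto
    also have "\<dots> = 2 * (A ^ 3 * h ^ 6)" by (simp add: power_mult_distrib flip: power_mult)
    also have "\<dots> \<le> 2 * (A ^ 3 * h ^ 3)" using AA hp h by (intro mult_left_mono) auto
    finally have 1: "\<bar>\<mu>\<bar> ^ 3 * z \<le> 2 * (A ^ 3 * h ^ 3)" .
    have 4: "A * h ^ 3 \<le> A ^ 3 * h ^ 3" using AA h by (intro mult_right_mono) auto
    show ?thesis using b3' a3 1 4 by linarith
  qed

  define J where "J = (LINT \<omega>|M. complex_of_real (exp (Y \<omega>)) * iexp (t * (Y \<omega> - \<mu>)))"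
  define P where "P \<omega> = complex_of_real (exp (Y \<omega>)) + \<i> * complex_of_real t * complex_of_real ((Y \<omega> - \<mu>) * exp (Y \<omega>))
      - complex_of_real (t\<^sup>2 / 2) * complex_of_real ((Y \<omega> - \<mu>)\<^sup>2 * exp (Y \<omega>))" for \<omega>
  have k0: "integrable M (\<lambda>\<omega>. complex_of_real (exp (Y \<omega>)))"
    and k1: "integrable M (\<lambda>\<omega>. \<i> * complex_of_real t * complex_of_real ((Y \<omega> - \<mu>) * exp (Y \<omega>)))"
    and k2: "integrable M (\<lambda>\<omega>. complex_of_real (t\<^sup>2 / 2) * complex_of_real ((Y \<omega> - \<mu>)\<^sup>2 * exp (Y \<omega>)))"
    by (intro integrable_mult_right integrable_of_real i0 j1 j2)+
  have iP: "integrable M P"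
    unfolding P_def by (intro Bochner_Integration.integrable_add Bochner_Integration.integrable_diff k0 k1 k2)
  have LP: "(LINT \<omega>|M. P \<omega>) = z + \<i> * complex_of_real t * complex_of_real b1 - complex_of_real (t\<^sup>2 / 2) * complex_of_real b2"
  proof -
    have "(LINT \<omega>|M. P \<omega>) = (LINT \<omega>|M. complex_of_real (exp (Y \<omega>))) + (LINT \<omega>|M. \<i> * complex_of_real t * complex_of_real ((Y \<omega> - \<mu>) * exp (Y \<omega>)))
      - (LINT \<omega>|M. complex_of_real (t\<^sup>2 / 2) * complex_of_real ((Y \<omega> - \<mu>)\<^sup>2 * exp (Y \<omega>)))"
      unfolding P_def
      by (simp only: Bochner_Integration.integral_diff[OF Bochner_Integration.integrable_add[OF k0 k1] k2]
          Bochner_Integration.integral_add[OF k0 k1])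
    then show ?thesis
      by (simp only: integral_mult_right_zero integral_complex_of_real b1_def b2_def zE)
  qed
  have iJ: "integrable M (\<lambda>\<omega>. complex_of_real (exp (Y \<omega>)) * iexp (t * (Y \<omega> - \<mu>)))"
    by (rule Bochner_Integration.integrable_bound[OF i0]) (auto simp: norm_mult)
  have pw: "norm (complex_of_real (exp (Y \<omega>)) * iexp (t * (Y \<omega> - \<mu>)) - P \<omega>) \<le> \<bar>t\<bar> ^ 3 / 6 * (\<bar>Y \<omega> - \<mu>\<bar> ^ 3 * exp (Y \<omega>))" for \<omega>
  proof -
    define \<theta> where "\<theta> = t * (Y \<omega> - \<mu>)"
    have "norm (iexp \<theta> - (\<Sum>k\<le>2. (\<i> * \<theta>) ^ k / fact k)) \<le> \<bar>\<theta>\<bar> ^ Suc 2 / fact (Suc 2)"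
      by (rule iexp_approx1)
    then have 1: "norm (iexp \<theta> - (1 + \<i> * \<theta> - \<theta>\<^sup>2 / 2)) \<le> \<bar>\<theta>\<bar> ^ 3 / 6"
      by (simp add: eval_nat_numeral atMost_Suc algebra_simps)
    have "complex_of_real (exp (Y \<omega>)) * iexp \<theta> - P \<omega> = complex_of_real (exp (Y \<omega>)) * (iexp \<theta> - (1 + \<i> * \<theta> - \<theta>\<^sup>2 / 2))"
      by (simp add: P_def \<theta>_def power2_eq_square field_simps)
    then have "norm (complex_of_real (exp (Y \<omega>)) * iexp \<theta> - P \<omega>) = exp (Y \<omega>) * norm (iexp \<theta> - (1 + \<i> * \<theta> - \<theta>\<^sup>2 / 2))"
      by (simp only: norm_mult norm_of_real) simp
    also have "\<dots> \<le> exp (Y \<omega>) * (\<bar>\<theta>\<bar> ^ 3 / 6)" using 1 by (intro mult_left_mono) auto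
    finally show ?thesis by (simp add: \<theta>_def abs_mult power_mult_distrib mult_ac)
  qed
  have "norm (J - (LINT \<omega>|M. P \<omega>)) = norm (LINT \<omega>|M. complex_of_real (exp (Y \<omega>)) * iexp (t * (Y \<omega> - \<mu>)) - P \<omega>)"
    unfolding J_def by (subst Bochner_Integration.integral_diff[OF iJ iP]) simp
  also have "\<dots> \<le> (LINT \<omega>|M. norm (complex_of_real (exp (Y \<omega>)) * iexp (t * (Y \<omega> - \<mu>)) - P \<omega>))"
    by (rule integral_norm_bound)
  also have "\<dots> \<le> (LINT \<omega>|M. \<bar>t\<bar> ^ 3 / 6 * (\<bar>Y \<omega> - \<mu>\<bar> ^ 3 * exp (Y \<omega>)))"
    by (intro integral_mono pw integrable_norm Bochner_Integration.integrable_diff iJ iP integrable_mult_right j3)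
  also have "\<dots> = \<bar>t\<bar> ^ 3 / 6 * b3" by (simp add: b3_def)
  also have "\<dots> \<le> \<bar>t\<bar> ^ 3 / 6 * (12 * A ^ 3 * h ^ 3)" using B3 by (intro mult_left_mono) auto
  finally have JP: "norm (J - (LINT \<omega>|M. P \<omega>)) \<le> 2 * (A ^ 3 * (\<bar>t\<bar> ^ 3 * h ^ 3))"
    by (simp add: mult.commute mult.left_commute)

  define v where "v = h\<^sup>2 * mom 2 i"
  \<comment> \<open>z times the claimed approximation: the comparison is made for the unnormalised
    integral \<open>J\<close> and divided by z only at the end.\<close>
  define G where "G = z - z * (t\<^sup>2 * v / 2)"
  have v: "0 \<le> v" "v \<le> A"
  proof -
    show "0 \<le> v" using mom_even_nonneg[of 2 i] by (simp add: v_def)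
    have "h\<^sup>2 * \<bar>mom 2 i\<bar> \<le> 1 * A"
      using h abs_mom_le[OF i, of 2] A_ge by (intro mult_mono power_le_one) auto
    then show "v \<le> A" using mom_even_nonneg[of 2 i] by (simp add: v_def)
  qed
  have "(LINT \<omega>|M. P \<omega>) - complex_of_real G =
      \<i> * complex_of_real (t * b1) + complex_of_real (t\<^sup>2 / 2 * (v * (z - 1) - (b2 - v)))"
    unfolding LP G_def by (simp add: field_simps)
  then have "norm ((LINT \<omega>|M. P \<omega>) - complex_of_real G) \<le>
      norm (\<i> * complex_of_real (t * b1)) + norm (complex_of_real (t\<^sup>2 / 2 * (v * (z - 1) - (b2 - v))))"
    by (metis norm_triangle_ineq)
  also have "\<dots> = \<bar>t\<bar> * \<bar>b1\<bar> + t\<^sup>2 / 2 * \<bar>v * (z - 1) - (b2 - v)\<bar>"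
    unfolding norm_mult norm_of_real by (simp add: abs_mult)
  also have "\<dots> \<le> \<bar>t\<bar> * (3 * A ^ 3 * h ^ 4) + t\<^sup>2 / 2 * (9 * A ^ 3 * h ^ 3)"
  proof (intro add_mono mult_left_mono B1)
    have "v * \<bar>z - 1\<bar> \<le> A * (2 * A * h ^ 3)" using v z A_ge by (intro mult_mono) auto
    also have "\<dots> = 2 * (A\<^sup>2 * h ^ 3)" by (simp add: power2_eq_square)
    also have "\<dots> \<le> 2 * (A ^ 3 * h ^ 3)" using AA h by (intro mult_left_mono mult_right_mono) auto
    finally have "\<bar>v * (z - 1)\<bar> \<le> 2 * (A ^ 3 * h ^ 3)" using v by (simp add: abs_mult)
    then show "\<bar>v * (z - 1) - (b2 - v)\<bar> \<le> 9 * A ^ 3 * h ^ 3" using B2 unfolding v_def by linarith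
  qed auto
  finally have PG: "norm ((LINT \<omega>|M. P \<omega>) - complex_of_real G) \<le>
      3 * (A ^ 3 * (\<bar>t\<bar> * h ^ 4)) + 9 / 2 * (A ^ 3 * (t\<^sup>2 * h ^ 3))"
    by (simp add: mult.commute mult.left_commute)
  have "J - complex_of_real G = (J - (LINT \<omega>|M. P \<omega>)) + ((LINT \<omega>|M. P \<omega>) - complex_of_real G)" by simp
  then have "norm (J - complex_of_real G) \<le> norm (J - (LINT \<omega>|M. P \<omega>)) + norm ((LINT \<omega>|M. P \<omega>) - complex_of_real G)"
    by (metis norm_triangle_ineq)
  then have JG: "norm (J - complex_of_real G) \<le>
      2 * (A ^ 3 * (\<bar>t\<bar> ^ 3 * h ^ 3)) + 3 * (A ^ 3 * (\<bar>t\<bar> * h ^ 4)) + 9 / 2 * (A ^ 3 * (t\<^sup>2 * h ^ 3))"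
    using JP PG by linarith
  have "psi h i t - complex_of_real (1 - t\<^sup>2 * v / 2) = (J - complex_of_real G) / complex_of_real z"
    using z unfolding psi_def J_def G_def Y_def \<mu>_def z_def by (simp add: field_simps)
  then have "norm (psi h i t - complex_of_real (1 - t\<^sup>2 * v / 2)) = norm (J - complex_of_real G) / z"
    using z by (simp add: norm_divide)
  also have "\<dots> \<le> norm (J - complex_of_real G) / (1 / 2)"
    using z by (intro divide_left_mono) auto
  also have "\<dots> = 2 * norm (J - complex_of_real G)" by simp
  also have "\<dots> \<le> 2 * (2 * (A ^ 3 * (\<bar>t\<bar> ^ 3 * h ^ 3)) + 3 * (A ^ 3 * (\<bar>t\<bar> * h ^ 4)) + 9 / 2 * (A ^ 3 * (t\<^sup>2 * h ^ 3)))"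
    by (intro mult_left_mono JG) simp
  also have "\<dots> \<le> 10 * A ^ 3 * (\<bar>t\<bar> * h ^ 4 + t\<^sup>2 * h ^ 3 + \<bar>t\<bar> ^ 3 * h ^ 3)"
  proof -
    have "0 \<le> A ^ 3 * (\<bar>t\<bar> ^ 3 * h ^ 3)" "0 \<le> A ^ 3 * (\<bar>t\<bar> * h ^ 4)" "0 \<le> A ^ 3 * (t\<^sup>2 * h ^ 3)"
      using AA h by auto
    then show ?thesis by (simp add: algebra_simps)
  qed
  finally show ?thesis unfolding v_def .
qed

end

section \<open>The tilted law of the sum\<close>

lemma abs_exp_minus_le:
  fixes y :: real
  assumes "y \<ge> 0"
  shows "\<bar>exp (- y) - (1 - y)\<bar> \<le> y\<^sup>2 / 2"
proof -
  have "1 - y \<le> exp (- y)" using exp_ge_add_one_self[of "- y"] by simp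
  moreover have "exp (- y) \<le> 1 - y + y\<^sup>2 / 2"
  proof -
    let ?f = "\<lambda>y::real. 1 - y + y\<^sup>2 / 2 - exp (- y)"
    have "?f 0 \<le> ?f y"
    proof (rule DERIV_nonneg_imp_nondecreasing[OF assms])
      fix x :: real assume "0 \<le> x" "x \<le> y"
      have "(?f has_real_derivative - 1 + x + exp (- x)) (at x)"
        by (auto intro!: derivative_eq_intros)
      moreover have "- 1 + x + exp (- x) \<ge> 0" using exp_ge_add_one_self[of "- x"] by simp
      ultimately show "\<exists>z. (?f has_real_derivative z) (at x) \<and> z \<ge> 0" by blast
    qed
    then show ?thesis by simp
  qed
  ultimately show ?thesis by (simp add: abs_le_iff)
qed

context self_normalized
begin

definition T3 :: "nat \<Rightarrow> real \<Rightarrow> real" where "T3 n h = h ^ 3 * (\<Sum>i=1..n. mom 3 i)"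

definition T4 :: "nat \<Rightarrow> real \<Rightarrow> real" where "T4 n h = h ^ 4 * (\<Sum>i=1..n. mom 4 i)"

definition Zn :: "nat \<Rightarrow> real \<Rightarrow> real" where "Zn n h = (\<Prod>i=1..n. zeta h i)"

definition U :: "nat \<Rightarrow> real \<Rightarrow> 'a \<Rightarrow> real" where "U n h \<omega> = (\<Sum>i=1..n. tilt (h * X i \<omega>))"

text \<open>The law of W under the tilted probability. Here h and x are independent parameters; the
  relation x^2 = h^2 B_n^2 that centres W is imposed where it is needed.\<close>

definition tilted :: "nat \<Rightarrow> real \<Rightarrow> real \<Rightarrow> real measure" where
  "tilted n h x = distr (density M (\<lambda>\<omega>. exp (U n h \<omega>) / Zn n h)) borel (\<lambda>\<omega>. U n h \<omega> - x\<^sup>2 / 2)"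

lemma B_n_sq_eq: "B_n_sq M X n = (\<Sum>i=1..n. mom 2 i)"
  by (simp add: B_n_sq_def mom_def)

lemma expectation_prod:
  fixes f :: "nat \<Rightarrow> real \<Rightarrow> 'b :: {real_normed_field, banach, second_countable_topology}"
  assumes m: "\<And>i. f i \<in> borel_measurable borel"
    and int: "\<And>i. i \<ge> 1 \<Longrightarrow> integrable M (\<lambda>\<omega>. f i (X i \<omega>))"
  shows "integrable M (\<lambda>\<omega>. \<Prod>i=1..n. f i (X i \<omega>))"
    "(LINT \<omega>|M. (\<Prod>i=1..n. f i (X i \<omega>))) = (\<Prod>i=1..n. LINT \<omega>|M. f i (X i \<omega>))"
proof -
  have "indep_vars (\<lambda>_. borel) X {1..n}"
    using indep by (rule indep_vars_subset) auto
  then have "indep_vars (\<lambda>_. borel) (\<lambda>i \<omega>. f i (X i \<omega>)) {1..n}"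
    by (rule indep_vars_compose2) (rule m)
  then show "integrable M (\<lambda>\<omega>. \<Prod>i=1..n. f i (X i \<omega>))"
    "(LINT \<omega>|M. (\<Prod>i=1..n. f i (X i \<omega>))) = (\<Prod>i=1..n. LINT \<omega>|M. f i (X i \<omega>))"
    using indep_vars_integrable[of "{1..n}" "\<lambda>i \<omega>. f i (X i \<omega>)"]
      indep_vars_lebesgue_integral[of "{1..n}" "\<lambda>i \<omega>. f i (X i \<omega>)"] int by auto
qed

lemma U_measurable [measurable]: "h > 0 \<Longrightarrow> U n h \<in> borel_measurable M"
  unfolding U_def using tilt_measurable by (intro borel_measurable_sum) auto

lemma exp_U:
  assumes "h > 0"
  shows "integrable M (\<lambda>\<omega>. exp (U n h \<omega>))" "expectation (\<lambda>\<omega>. exp (U n h \<omega>)) = Zn n h"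
proof -
  have m: "(\<lambda>y. exp (tilt (h * y))) \<in> borel_measurable borel" unfolding tilt_def by measurable
  have "exp (U n h \<omega>) = (\<Prod>i=1..n. exp (tilt (h * X i \<omega>)))" for \<omega>
    by (simp add: U_def exp_sum)
  then show "integrable M (\<lambda>\<omega>. exp (U n h \<omega>))" "expectation (\<lambda>\<omega>. exp (U n h \<omega>)) = Zn n h"
    using expectation_prod[of "\<lambda>_ y. exp (tilt (h * y))" n, OF m tilt_exp_integrable] assms
    by (simp_all add: Zn_def zeta_def)
qed

lemma Zn_pos: "small h \<Longrightarrow> Zn n h > 0"
  unfolding Zn_def
proof (rule prod_pos)
  fix i assume "small h" "i \<in> {1..n}"
  then show "0 < zeta h i" using abs_zeta_minus_1_le(3)[of i h] by simp
qed

lemma integral_tilted: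
  fixes f :: "real \<Rightarrow> 'b :: {banach, second_countable_topology}"
  assumes s: "small h" and f: "f \<in> borel_measurable borel"
  shows "(LINT w|tilted n h x. f w) = (LINT \<omega>|M. (exp (U n h \<omega>) / Zn n h) *\<^sub>R f (U n h \<omega> - x\<^sup>2 / 2))"
proof -
  note [measurable] = f U_measurable[OF smallD(1)[OF s]]
  have "(LINT w|tilted n h x. f w) = (LINT \<omega>|density M (\<lambda>\<omega>. exp (U n h \<omega>) / Zn n h). f (U n h \<omega> - x\<^sup>2 / 2))"
    unfolding tilted_def by (rule integral_distr) measurable
  also have "\<dots> = (LINT \<omega>|M. (exp (U n h \<omega>) / Zn n h) *\<^sub>R f (U n h \<omega> - x\<^sup>2 / 2))"
    using Zn_pos[OF s, of n] by (intro integral_density) (auto simp: less_imp_le)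
  finally show ?thesis .
qed

lemma real_distribution_tilted:
  assumes s: "small h"
  shows "real_distribution (tilted n h x)"
proof -
  note [measurable] = U_measurable[OF smallD(1)[OF s]]
  have i: "integrable M (\<lambda>\<omega>. exp (U n h \<omega>) / Zn n h)"
    using exp_U[OF smallD(1)[OF s], of n] by simp
  have "expectation (\<lambda>\<omega>. exp (U n h \<omega>) / Zn n h) = 1"
    using exp_U[OF smallD(1)[OF s], of n] Zn_pos[OF s, of n] by simp
  then have "(\<integral>\<^sup>+ \<omega>. ennreal (exp (U n h \<omega>) / Zn n h) \<partial>M) = 1"
    using Zn_pos[OF s, of n] by (subst nn_integral_eq_integral[OF i]) (auto simp: less_imp_le)
  then have "prob_space (density M (\<lambda>\<omega>. exp (U n h \<omega>) / Zn n h))"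
    by (intro prob_spaceI) (simp add: emeasure_density cong: nn_integral_cong)
  then show ?thesis
    unfolding tilted_def by (intro prob_space.real_distribution_distr) measurable
qed

lemma sum_tmean:
  assumes "x\<^sup>2 = h\<^sup>2 * B_n_sq M X n"
  shows "(\<Sum>i=1..n. tmean h i) - x\<^sup>2 / 2 = - T3 n h / 2"
  unfolding assms B_n_sq_eq tmean_def T3_def
  by (simp add: sum_subtractf sum_distrib_left flip: sum_divide_distrib)

text \<open>Weight and complex exponential factorise together by independence. The centres
  \<open>tmean\<close> add up to x^2/2 - T3/2 and not to x^2/2, which leaves the phase exp(-i t
  T3/2).\<close>

lemma char_tilted:
  assumes s: "small h" and x: "x\<^sup>2 = h\<^sup>2 * B_n_sq M X n"
  shows "char (tilted n h x) t = iexp (- (t * T3 n h / 2)) * (\<Prod>i=1..n. psi h i t)"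
proof -
  note h = smallD[OF s]
  let ?f = "\<lambda>i y. complex_of_real (exp (tilt (h * y))) * iexp (t * (tilt (h * y) - tmean h i))"
  have fm: "?f i \<in> borel_measurable borel" for i unfolding tilt_def by measurable
  have fi: "integrable M (\<lambda>\<omega>. ?f i (X i \<omega>))" if "i \<ge> 1" for i
  proof (rule Bochner_Integration.integrable_bound[OF tilt_exp_integrable[OF that h(1)]])
    show "(\<lambda>\<omega>. ?f i (X i \<omega>)) \<in> borel_measurable M"
      using rv[OF that] fm by (intro measurable_compose[OF _ fm])
  qed (auto simp: norm_mult)
  have P: "(LINT \<omega>|M. (\<Prod>i=1..n. ?f i (X i \<omega>))) = (\<Prod>i=1..n. psi h i t * zeta h i)"
  proof (rule trans[OF expectation_prod(2)[of ?f n, OF fm fi] prod.cong[OF refl]])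
    fix i assume "i \<in> {1..n}"
    then have "zeta h i \<noteq> 0" using abs_zeta_minus_1_le(3)[of i h] s by auto
    then show "(LINT \<omega>|M. ?f i (X i \<omega>)) = psi h i t * zeta h i"
      by (simp add: psi_def)
  qed
  have pw: "(exp (U n h \<omega>) / Zn n h) *\<^sub>R iexp (t * (U n h \<omega> - x\<^sup>2 / 2)) =
      iexp (- (t * T3 n h / 2)) / Zn n h * (\<Prod>i=1..n. ?f i (X i \<omega>))" for \<omega>
  proof -
    have 1: "U n h \<omega> - x\<^sup>2 / 2 = (\<Sum>i=1..n. tilt (h * X i \<omega>) - tmean h i) - T3 n h / 2"
      using sum_tmean[OF x] by (simp add: U_def sum_subtractf)
    have "iexp (t * (U n h \<omega> - x\<^sup>2 / 2)) =
        iexp (- (t * T3 n h / 2)) * exp (\<Sum>i=1..n. \<i> * complex_of_real (t * (tilt (h * X i \<omega>) - tmean h i)))"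
      unfolding exp_add[symmetric] 1 by (simp add: algebra_simps sum_distrib_left)
    also have "exp (\<Sum>i=1..n. \<i> * complex_of_real (t * (tilt (h * X i \<omega>) - tmean h i))) =
        (\<Prod>i=1..n. iexp (t * (tilt (h * X i \<omega>) - tmean h i)))"
      by (rule exp_sum) simp
    finally have 2: "iexp (t * (U n h \<omega> - x\<^sup>2 / 2)) =
        iexp (- (t * T3 n h / 2)) * (\<Prod>i=1..n. iexp (t * (tilt (h * X i \<omega>) - tmean h i)))" .
    have 3: "complex_of_real (exp (U n h \<omega>)) = (\<Prod>i=1..n. complex_of_real (exp (tilt (h * X i \<omega>))))"
      by (simp only: U_def exp_sum finite_atLeastAtMost of_real_prod)
    show ?thesis
      unfolding scaleR_conv_of_real of_real_divide 2 3 prod.distrib by (simp add: mult_ac)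
  qed
  have "char (tilted n h x) t = (LINT \<omega>|M. (exp (U n h \<omega>) / Zn n h) *\<^sub>R iexp (t * (U n h \<omega> - x\<^sup>2 / 2)))"
    unfolding char_def by (rule integral_tilted[OF s]) measurable
  also have "\<dots> = iexp (- (t * T3 n h / 2)) / Zn n h * (\<Prod>i=1..n. psi h i t * zeta h i)"
    unfolding pw integral_mult_right_zero P ..
  also have "\<dots> = iexp (- (t * T3 n h / 2)) * (\<Prod>i=1..n. psi h i t)"
  proof -
    have "(\<Prod>i=1..n. psi h i t * zeta h i) = (\<Prod>i=1..n. psi h i t) * complex_of_real (Zn n h)"
      by (simp add: prod.distrib Zn_def)
    moreover have "complex_of_real (Zn n h) \<noteq> 0"
      using Zn_pos[OF s, of n] by simp
    ultimately show ?thesis by simp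
  qed
  finally show ?thesis .
qed

lemma n_h_square_le:
  assumes x: "x\<^sup>2 = h\<^sup>2 * B_n_sq M X n"
  shows "real n * h\<^sup>2 \<le> x\<^sup>2 / c"
proof -
  have "h\<^sup>2 * (c * real n) \<le> h\<^sup>2 * B_n_sq M X n" using c(2) by (intro mult_left_mono) auto
  then show ?thesis using c(1) by (simp add: x field_simps)
qed

text \<open>The Gaussian is split into factors exp(-t^2 v_i/2), with the v_i adding up to x^2. All
  factors on both sides have norm at most 1, so the difference of the products is at most the sum of
  the differences. The extra t^4 h^4 is the cost of replacing 1 - y by exp(-y).\<close>

lemma prod_psi_near:
  assumes s: "small h" and x: "x\<^sup>2 = h\<^sup>2 * B_n_sq M X n"
  shows "norm ((\<Prod>i=1..n. psi h i t) - complex_of_real (exp (- ((t * x)\<^sup>2 / 2))))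
    \<le> 10 * A ^ 3 * real n * (\<bar>t\<bar> * h ^ 4 + t\<^sup>2 * h ^ 3 + \<bar>t\<bar> ^ 3 * h ^ 3 + t ^ 4 * h ^ 4)"
proof -
  note h = smallD[OF s]
  define v where "v i = h\<^sup>2 * mom 2 i" for i
  have v0: "0 \<le> v i" for i using mom_even_nonneg[of 2 i] by (simp add: v_def)
  have e: "complex_of_real (exp (- ((t * x)\<^sup>2 / 2))) = (\<Prod>i=1..n. complex_of_real (exp (- (t\<^sup>2 * v i / 2))))"
  proof -
    have "- ((t * x)\<^sup>2 / 2) = (\<Sum>i=1..n. - (t\<^sup>2 * v i / 2))"
      unfolding power_mult_distrib x B_n_sq_eq v_def
      by (simp add: sum_negf sum_distrib_left flip: sum_divide_distrib)
    then show ?thesis by (simp only: exp_sum finite_atLeastAtMost of_real_prod)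
  qed
  have "norm ((\<Prod>i=1..n. psi h i t) - complex_of_real (exp (- ((t * x)\<^sup>2 / 2))))
      \<le> (\<Sum>i=1..n. norm (psi h i t - complex_of_real (exp (- (t\<^sup>2 * v i / 2)))))"
    unfolding e by (rule norm_prod_diff) (use v0 norm_psi_le_1[OF _ s] in auto)
  also have "\<dots> \<le> (\<Sum>i=1..n. 10 * A ^ 3 * (\<bar>t\<bar> * h ^ 4 + t\<^sup>2 * h ^ 3 + \<bar>t\<bar> ^ 3 * h ^ 3 + t ^ 4 * h ^ 4))"
  proof (rule sum_mono)
    fix i assume "i \<in> {1..n}"
    then have i: "i \<ge> 1" by simp
    let ?y = "t\<^sup>2 * v i / 2"
    have "psi h i t - complex_of_real (exp (- ?y)) =
        (psi h i t - complex_of_real (1 - ?y)) - complex_of_real (exp (- ?y) - (1 - ?y))" by simp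
    then have "norm (psi h i t - complex_of_real (exp (- ?y))) \<le>
        norm (psi h i t - complex_of_real (1 - ?y)) + norm (complex_of_real (exp (- ?y) - (1 - ?y)))"
      by (metis norm_triangle_ineq4)
    also have "norm (complex_of_real (exp (- ?y) - (1 - ?y))) \<le> ?y\<^sup>2 / 2"
      unfolding norm_of_real using v0 by (intro abs_exp_minus_le) simp
    also have "?y\<^sup>2 / 2 \<le> 10 * A ^ 3 * (t ^ 4 * h ^ 4)"
    proof -
      have "(mom 2 i)\<^sup>2 \<le> A\<^sup>2"
        using abs_mom_le[OF i, of 2] A_ge by (intro abs_le_square_iff[THEN iffD1]) auto
      also have "A\<^sup>2 \<le> A ^ 3" using A_ge by (intro power_increasing) auto
      finally have "t ^ 4 * h ^ 4 * (mom 2 i)\<^sup>2 \<le> t ^ 4 * h ^ 4 * A ^ 3"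
        by (intro mult_left_mono) auto
      moreover have "?y\<^sup>2 / 2 = t ^ 4 * h ^ 4 * (mom 2 i)\<^sup>2 / 8"
        by (simp add: v_def power2_eq_square eval_nat_numeral)
      moreover have "0 \<le> t ^ 4 * h ^ 4 * A ^ 3" using A_ge by simp
      ultimately show ?thesis by (simp add: mult_ac)
    qed
    also note psi_expansion[OF i s, of t, folded v_def]
    finally show "norm (psi h i t - complex_of_real (exp (- ?y))) \<le>
        10 * A ^ 3 * (\<bar>t\<bar> * h ^ 4 + t\<^sup>2 * h ^ 3 + \<bar>t\<bar> ^ 3 * h ^ 3 + t ^ 4 * h ^ 4)"
      by (simp add: algebra_simps)
  qed
  finally show ?thesis by (simp add: mult_ac)
qed

text \<open>160 = 10 * 16: the first bound makes 10 A^3 \<kappa> / c at most 1/16, so that the t^2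
  and |t|^3 errors each cost at most t^2 x^2/16. The second keeps 1 - t^2 h^2 E X_i^2/2 nonnegative
  for |t| h <= \<kappa>.\<close>

definition \<kappa> :: real where "\<kappa> = min (c / (160 * A ^ 3)) (1 / A)"

lemma kappa_pos: "\<kappa> > 0" using c(1) A_ge(1) by (simp add: \<kappa>_def)

text \<open>Each factor is at most 1 - t^2 v_i/2 + e <= exp(-t^2 v_i/2 + e). Summed over i, the t^2
  and |t|^3 parts of e are absorbed by the Gaussian through \<kappa>, while the linear part is at
  most |t| x by the hypothesis on n h^4.\<close>

lemma norm_char_tilted_le:
  assumes s: "small h" and x: "x\<^sup>2 = h\<^sup>2 * B_n_sq M X n" "x > 0"
    and hk: "h \<le> \<kappa>" and th: "\<bar>t\<bar> * h \<le> \<kappa>" and G: "10 * A ^ 3 * (real n * h ^ 4) \<le> x"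
  shows "norm (char (tilted n h x) t) \<le> exp 2 * exp (- ((t * x)\<^sup>2 / 8))"
proof -
  note h = smallD[OF s]
  define v where "v i = h\<^sup>2 * mom 2 i" for i
  define D where "D = 10 * A ^ 3"
  define e where "e = D * (\<bar>t\<bar> * h ^ 4 + t\<^sup>2 * h ^ 3 + \<bar>t\<bar> ^ 3 * h ^ 3)"
  have D: "D > 0" using A_ge by (simp add: D_def)
  have v0: "0 \<le> v i" for i using mom_even_nonneg[of 2 i] by (simp add: v_def)
  have pb: "norm (psi h i t) \<le> exp (- (t\<^sup>2 * v i / 2) + e)" if i: "i \<ge> 1" for i
  proof -
    have "(\<bar>t\<bar> * h)\<^sup>2 \<le> (1 / A)\<^sup>2"
      using th h(1) by (intro power_mono) (auto simp: \<kappa>_def)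
    moreover have "mom 2 i \<le> A" using abs_mom_le[OF i, of 2] A_ge by simp
    ultimately have "(\<bar>t\<bar> * h)\<^sup>2 * mom 2 i \<le> (1 / A)\<^sup>2 * A"
      using A_ge mom_even_nonneg[of 2 i] by (intro mult_mono) auto
    also have "\<dots> \<le> 1" using A_ge by (simp add: power2_eq_square)
    finally have "t\<^sup>2 * v i \<le> 2" by (simp add: v_def power_mult_distrib mult_ac)
    then have "norm (complex_of_real (1 - t\<^sup>2 * v i / 2)) = 1 - t\<^sup>2 * v i / 2"
      by (simp only: norm_of_real)
    moreover have "norm (psi h i t) \<le> norm (psi h i t - complex_of_real (1 - t\<^sup>2 * v i / 2)) + norm (complex_of_real (1 - t\<^sup>2 * v i / 2))"
      by (metis diff_add_cancel norm_triangle_ineq)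
    moreover have "norm (psi h i t - complex_of_real (1 - t\<^sup>2 * v i / 2)) \<le> e"
      using psi_expansion[OF i s, of t] by (simp only: v_def e_def D_def)
    ultimately have "norm (psi h i t) \<le> 1 + (- (t\<^sup>2 * v i / 2) + e)" by linarith
    also have "\<dots> \<le> exp (- (t\<^sup>2 * v i / 2) + e)" by (rule exp_ge_add_one_self)
    finally show ?thesis .
  qed
  have "norm (char (tilted n h x) t) = (\<Prod>i=1..n. norm (psi h i t))"
    unfolding char_tilted[OF s x(1)] norm_mult by (simp add: prod_norm)
  also have "\<dots> \<le> (\<Prod>i=1..n. exp (- (t\<^sup>2 * v i / 2) + e))"
    using pb by (intro prod_mono) auto
  also have "\<dots> = exp (\<Sum>i=1..n. - (t\<^sup>2 * v i / 2) + e)" by (rule exp_sum[symmetric]) simp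
  also have "(\<Sum>i=1..n. - (t\<^sup>2 * v i / 2) + e) = - (t\<^sup>2 * x\<^sup>2 / 2) + real n * e"
    unfolding x B_n_sq_eq v_def
    by (simp add: sum.distrib sum_negf sum_subtractf sum_distrib_left flip: sum_divide_distrib)
  also have "real n * e \<le> \<bar>t\<bar> * x + t\<^sup>2 * x\<^sup>2 / 8"
  proof -
    have k: "D * \<kappa> / c \<le> 1 / 16"
    proof -
      have "D * \<kappa> \<le> D * (c / (160 * A ^ 3))" using D by (intro mult_left_mono) (auto simp: \<kappa>_def)
      also have "\<dots> = c / 16" using A_ge by (simp add: D_def)
      finally show ?thesis using c(1) by (simp add: field_simps)
    qed
    have nh: "real n * h\<^sup>2 \<le> x\<^sup>2 / c" by (rule n_h_square_le[OF x(1)])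
    have *: "D * t\<^sup>2 * ((real n * h\<^sup>2) * q) \<le> t\<^sup>2 * x\<^sup>2 / 16" if "0 \<le> q" "q \<le> \<kappa>" for q
    proof -
      have "D * t\<^sup>2 * ((real n * h\<^sup>2) * q) \<le> D * t\<^sup>2 * ((x\<^sup>2 / c) * \<kappa>)"
        using nh that D c(1) by (intro mult_left_mono mult_mono) auto
      also have "\<dots> = t\<^sup>2 * x\<^sup>2 * (D * \<kappa> / c)" by simp
      also have "\<dots> \<le> t\<^sup>2 * x\<^sup>2 * (1 / 16)" using k by (intro mult_left_mono) auto
      finally show ?thesis by simp
    qed
    have "real n * e = \<bar>t\<bar> * (D * (real n * h ^ 4)) + D * t\<^sup>2 * ((real n * h\<^sup>2) * h) + D * t\<^sup>2 * ((real n * h\<^sup>2) * (\<bar>t\<bar> * h))"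
      unfolding e_def by (simp add: algebra_simps power2_eq_square power3_eq_cube abs_mult_self_eq)
    also have "\<dots> \<le> \<bar>t\<bar> * x + t\<^sup>2 * x\<^sup>2 / 16 + t\<^sup>2 * x\<^sup>2 / 16"
      using G h hk th by (intro add_mono mult_left_mono *) (auto simp: D_def)
    finally show ?thesis by simp
  qed
  \<comment> \<open>The linear term is absorbed by completing the square, |t| x <= (t x)^2/8 + 2;
    this is the source of the factor \<open>exp 2\<close>.\<close>
  also have "- (t\<^sup>2 * x\<^sup>2 / 2) + (\<bar>t\<bar> * x + t\<^sup>2 * x\<^sup>2 / 8) \<le> 2 - (t * x)\<^sup>2 / 8"
  proof -
    have "0 \<le> (\<bar>t\<bar> * x - 4)\<^sup>2" by simp
    then have "\<bar>t\<bar> * x \<le> (t * x)\<^sup>2 / 8 + 2"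
      by (simp add: power2_diff power_mult_distrib)
    moreover have "0 \<le> (t * x)\<^sup>2" by simp
    ultimately show ?thesis unfolding power_mult_distrib by linarith
  qed
  finally show ?thesis unfolding exp_add[symmetric] by simp
qed

section \<open>The normalising constant and exponential Markov bounds\<close>

text \<open>|ln(1 + u) - u| <= 2 u^2 with u = \<open>zeta\<close> - 1 = O(h^3), and h^6 <= h^r since
  h <= 1 and r <= 5. The constant 9 A^2 collects 8 A^2 from u^2 and A <= A^2 from the mean
  expansion.\<close>

lemma ln_Zn_expansion:
  assumes s: "small h"
  shows "\<bar>ln (Zn n h) + T3 n h / 3 + T4 n h / 12\<bar> \<le> 9 * A\<^sup>2 * (real n * h powr r)"
proof -
  note h = smallD[OF s]
  have b: "\<bar>ln (zeta h i) + h ^ 3 * mom 3 i / 3 + h ^ 4 * mom 4 i / 12\<bar> \<le> 9 * A\<^sup>2 * h powr r"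
    if i: "i \<ge> 1" for i
  proof -
    note z = abs_zeta_minus_1_le[OF i s]
    define u where "u = zeta h i - 1"
    have "\<bar>ln (1 + u) - u\<bar> \<le> 2 * u\<^sup>2"
      using z by (intro abs_ln_one_plus_x_minus_x_bound) (simp add: u_def)
    also have "u\<^sup>2 \<le> (2 * A * h ^ 3)\<^sup>2"
      using z A_ge h(1) by (intro abs_le_square_iff[THEN iffD1]) (simp add: u_def)
    also have "(2 * A * h ^ 3)\<^sup>2 = 4 * A\<^sup>2 * h ^ 6" by (simp add: power_mult_distrib flip: power_mult)
    finally have 1: "\<bar>ln (1 + u) - u\<bar> \<le> 8 * A\<^sup>2 * h ^ 6" by simp
    have "h ^ 6 = h powr 6" using h(1) powr_realpow[of h 6] by simp
    also have "h powr 6 \<le> h powr r" using h r by (intro powr_mono') auto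
    finally have 2: "8 * A\<^sup>2 * h ^ 6 \<le> 8 * A\<^sup>2 * h powr r" by (intro mult_left_mono) auto
    have 3: "A * h powr r \<le> A\<^sup>2 * h powr r"
      using A_ge(1) power_increasing[of 1 2 A] by (intro mult_right_mono) auto
    have "\<bar>zeta h i - (1 - h ^ 3 * mom 3 i / 3 - h ^ 4 * mom 4 i / 12)\<bar> \<le> A * h powr r"
      using exp_tilt_mean_expansion[OF i h(1)] by (simp add: zeta_def)
    then have 4: "\<bar>u + h ^ 3 * mom 3 i / 3 + h ^ 4 * mom 4 i / 12\<bar> \<le> A * h powr r"
      by (simp add: u_def algebra_simps)
    have "1 + u = zeta h i" by (simp add: u_def)
    then show ?thesis using 1 2 3 4 by (simp only:)
  qed
  have "ln (Zn n h) = (\<Sum>i=1..n. ln (zeta h i))"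
    unfolding Zn_def by (rule ln_prod) (use abs_zeta_minus_1_le(3)[OF _ s] in fastforce)+
  then have eq: "ln (Zn n h) + T3 n h / 3 + T4 n h / 12 = (\<Sum>i=1..n. ln (zeta h i) + h ^ 3 * mom 3 i / 3 + h ^ 4 * mom 4 i / 12)"
    by (simp add: T3_def T4_def sum.distrib sum_distrib_left flip: sum_divide_distrib)
  have "\<bar>\<Sum>i=1..n. ln (zeta h i) + h ^ 3 * mom 3 i / 3 + h ^ 4 * mom 4 i / 12\<bar> \<le> (\<Sum>i=1..n. \<bar>ln (zeta h i) + h ^ 3 * mom 3 i / 3 + h ^ 4 * mom 4 i / 12\<bar>)"
    by (rule sum_abs)
  also have "\<dots> \<le> (\<Sum>i=1..n. 9 * A\<^sup>2 * h powr r)" using b by (intro sum_mono) auto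
  finally show ?thesis unfolding eq by (simp add: mult_ac)
qed

text \<open>Integrating (X_i^2 - c)^2 >= 0 gives E X_i^4 >= 2 c E X_i^2 - c^2, and then B_n^2 >= c n
  suffices. With this lower bound an error O(n h^r) in ln Z is a relative error O(h^(r-4)) in
  \<open>T4\<close>.\<close>

lemma T4_ge: "h > 0 \<Longrightarrow> c\<^sup>2 * (real n * h ^ 4) \<le> T4 n h"
proof -
  assume h: "h > 0"
  have "2 * c * mom 2 i - c\<^sup>2 \<le> mom 4 i" if i: "i \<ge> 1" for i
  proof -
    have "expectation (\<lambda>\<omega>. 2 * c * X i \<omega> ^ 2 - c\<^sup>2) \<le> expectation (\<lambda>\<omega>. X i \<omega> ^ 4)"
    proof (intro integral_mono Bochner_Integration.integrable_diff integrable_mult_right integrable_moment i)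
      fix \<omega> have "0 \<le> ((X i \<omega>)\<^sup>2 - c)\<^sup>2" by simp
      then show "2 * c * X i \<omega> ^ 2 - c\<^sup>2 \<le> X i \<omega> ^ 4"
        by (simp add: power2_diff mult.commute mult.left_commute flip: power_mult)
    qed auto
    then show ?thesis
      using integrable_moment[OF i, of 2] by (simp add: mom_def prob_space)
  qed
  then have "(\<Sum>i=1..n. 2 * c * mom 2 i - c\<^sup>2) \<le> (\<Sum>i=1..n. mom 4 i)" by (intro sum_mono) auto
  also have "(\<Sum>i=1..n. 2 * c * mom 2 i - c\<^sup>2) = 2 * c * B_n_sq M X n - real n * c\<^sup>2"
    by (simp add: B_n_sq_eq sum_subtractf sum_distrib_left)
  finally have 1: "2 * c * B_n_sq M X n - real n * c\<^sup>2 \<le> (\<Sum>i=1..n. mom 4 i)" .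
  have "2 * c * (c * real n) \<le> 2 * c * B_n_sq M X n" using c by (intro mult_left_mono) auto
  with 1 have "c\<^sup>2 * real n \<le> (\<Sum>i=1..n. mom 4 i)" by (simp add: power2_eq_square algebra_simps)
  then have "h ^ 4 * (c\<^sup>2 * real n) \<le> h ^ 4 * (\<Sum>i=1..n. mom 4 i)"
    using h by (intro mult_left_mono) auto
  then show ?thesis by (simp add: T4_def mult_ac)
qed

lemma T4_le: "h > 0 \<Longrightarrow> T4 n h \<le> A * (real n * h ^ 4)"
proof -
  assume h: "h > 0"
  have "(\<Sum>i=1..n. mom 4 i) \<le> (\<Sum>i=1..n. A)"
    using abs_mom_le[of _ 4] A_ge by (intro sum_mono) (fastforce simp: abs_le_iff)
  then have "h ^ 4 * (\<Sum>i=1..n. mom 4 i) \<le> h ^ 4 * (real n * A)"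
    using h by (intro mult_left_mono) auto
  then show ?thesis by (simp add: T4_def mult_ac)
qed

text \<open>Markov's inequality for exp(h S_n - \<theta> (h V_n)^2), a product of independent
  bounded factors. The value 1/2 is not among the \<theta>: near u = x Markov's inequality would
  lose the factor 1/x, and the local limit theorem takes its place.\<close>

lemma tail_quadratic:
  assumes h: "h > 0" and \<theta>: "\<theta> \<in> {3/2, 1/4, 1/8}"
  shows "prob {\<omega> \<in> space M. a \<le> h * S_n X n \<omega> - \<theta> * (h * V_n X n \<omega>)\<^sup>2}
    \<le> exp ((1/2 - \<theta>) * (h\<^sup>2 * B_n_sq M X n) + (1/6 - \<theta>) * T3 n h + A * (real n * h ^ 4) - a)"
proof -
  let ?f = "\<lambda>y. exp (h * y - \<theta> * (h * y)\<^sup>2)"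
  have fm: "?f \<in> borel_measurable borel" by measurable
  define F where "F \<omega> = h * S_n X n \<omega> - \<theta> * (h * V_n X n \<omega>)\<^sup>2" for \<omega>
  have F: "F \<omega> = (\<Sum>i=1..n. h * X i \<omega> - \<theta> * (h * X i \<omega>)\<^sup>2)" for \<omega>
    by (simp add: F_def S_n_def V_n_def sum_nonneg power_mult_distrib sum_subtractf sum_distrib_left mult.assoc)
  have eF: "exp (F \<omega>) = (\<Prod>i=1..n. ?f (X i \<omega>))" for \<omega> unfolding F by (rule exp_sum) simp
  have iF: "integrable M (\<lambda>\<omega>. exp (F \<omega>))"
    and EF: "expectation (\<lambda>\<omega>. exp (F \<omega>)) = (\<Prod>i=1..n. expectation (\<lambda>\<omega>. ?f (X i \<omega>)))"
    unfolding eF using expectation_prod[of "\<lambda>_. ?f" n, OF fm exp_quadratic_mean(1)[OF _ h \<theta>]] by auto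
  have mF [measurable]: "F \<in> borel_measurable M"
    unfolding F using rv by (intro borel_measurable_sum) (auto intro!: borel_measurable_diff borel_measurable_times borel_measurable_power)
  have "expectation (\<lambda>\<omega>. exp (F \<omega>)) \<le> (\<Prod>i=1..n. exp ((1/2 - \<theta>) * (h\<^sup>2 * mom 2 i) + (1/6 - \<theta>) * (h ^ 3 * mom 3 i) + A * h ^ 4))"
    unfolding EF
  proof (intro prod_mono conjI)
    show "0 \<le> expectation (\<lambda>\<omega>. ?f (X i \<omega>))" for i
      by (intro Bochner_Integration.integral_nonneg) auto
    show "expectation (\<lambda>\<omega>. ?f (X i \<omega>)) \<le> exp ((1/2 - \<theta>) * (h\<^sup>2 * mom 2 i) + (1/6 - \<theta>) * (h ^ 3 * mom 3 i) + A * h ^ 4)"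
      if "i \<in> {1..n}" for i
      using that by (intro exp_quadratic_mean(2) h \<theta>) auto
  qed
  also have "\<dots> = exp (\<Sum>i=1..n. (1/2 - \<theta>) * (h\<^sup>2 * mom 2 i) + (1/6 - \<theta>) * (h ^ 3 * mom 3 i) + A * h ^ 4)"
    by (rule exp_sum[symmetric]) simp
  also have "(\<Sum>i=1..n. (1/2 - \<theta>) * (h\<^sup>2 * mom 2 i) + (1/6 - \<theta>) * (h ^ 3 * mom 3 i) + A * h ^ 4) =
      (1/2 - \<theta>) * (h\<^sup>2 * B_n_sq M X n) + (1/6 - \<theta>) * T3 n h + A * (real n * h ^ 4)"
    by (simp add: sum.distrib B_n_sq_eq T3_def sum_distrib_left)
  finally have E: "expectation (\<lambda>\<omega>. exp (F \<omega>)) \<le> exp ((1/2 - \<theta>) * (h\<^sup>2 * B_n_sq M X n) + (1/6 - \<theta>) * T3 n h + A * (real n * h ^ 4))" .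
  have "prob {\<omega> \<in> space M. a \<le> F \<omega>} = expectation (indicator {\<omega> \<in> space M. a \<le> F \<omega>})" by simp
  also have "\<dots> \<le> expectation (\<lambda>\<omega>. exp (- a) * exp (F \<omega>))"
  proof (intro integral_mono integrable_mult_right iF)
    show "integrable M (indicator {\<omega> \<in> space M. a \<le> F \<omega>} :: _ \<Rightarrow> real)"
      by (rule integrable_real_indicator) (measurable, simp add: emeasure_eq_measure)
    show "indicator {\<omega> \<in> space M. a \<le> F \<omega>} \<omega> \<le> exp (- a) * exp (F \<omega>)" for \<omega>
      unfolding exp_add[symmetric] by (auto simp: indicator_def)
  qed
  also have "\<dots> = exp (- a) * expectation (\<lambda>\<omega>. exp (F \<omega>))" by simp
  also have "\<dots> \<le> exp (- a) * exp ((1/2 - \<theta>) * (h\<^sup>2 * B_n_sq M X n) + (1/6 - \<theta>) * T3 n h + A * (real n * h ^ 4))"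
    using E by (intro mult_left_mono) auto
  finally show ?thesis unfolding F_def exp_add[symmetric] by (simp add: add.commute)
qed

end

section \<open>The tail event\<close>

lemma dyadic_bracket:
  fixes y :: real
  assumes "2 \<le> y" "y < 2 ^ Suc N"
  shows "\<exists>k\<in>{1..N}. 2 ^ k \<le> y \<and> y \<le> 2 ^ Suc k"
  using assms(2)
proof (induction N)
  case 0
  then show ?case using assms(1) by simp
next
  case (Suc N)
  show ?case
  proof (cases "y < 2 ^ Suc N")
    case True
    then show ?thesis using Suc.IH by fastforce
  next
    case False
    then show ?thesis using Suc.prems by (intro bexI[of _ "Suc N"]) auto
  qed
qed

context self_normalized
begin

lemma S_n_measurable [measurable]: "S_n X n \<in> borel_measurable M"
  unfolding S_n_def[abs_def] using rv by (intro borel_measurable_sum) auto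

lemma V_n_measurable [measurable]: "V_n X n \<in> borel_measurable M"
  unfolding V_n_def[abs_def] using rv
  by (intro borel_measurable_sqrt[THEN measurable_compose[rotated]] borel_measurable_sum borel_measurable_power) auto

lemma V_n_nonneg: "0 \<le> V_n X n \<omega>"
  by (simp add: V_n_def sum_nonneg)

lemma U_eq: "U n h \<omega> = h * S_n X n \<omega> - (h * V_n X n \<omega>)\<^sup>2 / 2"
  by (simp add: U_def tilt_def S_n_def V_n_def sum_nonneg power_mult_distrib sum_subtractf
      sum_distrib_left flip: sum_divide_distrib)

lemma prob_U_ge:
  assumes s: "small h"
  shows "prob {\<omega> \<in> space M. - d \<le> U n h \<omega> - x\<^sup>2 / 2} =
    Zn n h * exp (- (x\<^sup>2 / 2)) * (LINT w|tilted n h x. indicator {- d..} w * exp (- w))"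
proof -
  note [measurable] = U_measurable[OF smallD(1)[OF s]]
  have "(LINT w|tilted n h x. indicator {- d..} w * exp (- w)) =
      (LINT \<omega>|M. (exp (U n h \<omega>) / Zn n h) *\<^sub>R (indicator {- d..} (U n h \<omega> - x\<^sup>2 / 2) * exp (- (U n h \<omega> - x\<^sup>2 / 2))))"
    by (rule integral_tilted[OF s]) measurable
  also have "\<dots> = (LINT \<omega>|M. exp (x\<^sup>2 / 2) / Zn n h * indicator {\<omega> \<in> space M. - d \<le> U n h \<omega> - x\<^sup>2 / 2} \<omega>)"
  proof (intro Bochner_Integration.integral_cong refl)
    fix \<omega> assume "\<omega> \<in> space M"
    have "exp (U n h \<omega>) * exp (- (U n h \<omega> - x\<^sup>2 / 2)) = exp (x\<^sup>2 / 2)"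
      by (simp flip: exp_add)
    then show "(exp (U n h \<omega>) / Zn n h) *\<^sub>R (indicator {- d..} (U n h \<omega> - x\<^sup>2 / 2) * exp (- (U n h \<omega> - x\<^sup>2 / 2))) =
        exp (x\<^sup>2 / 2) / Zn n h * indicator {\<omega> \<in> space M. - d \<le> U n h \<omega> - x\<^sup>2 / 2} \<omega>"
      using \<open>\<omega> \<in> space M\<close> by (simp add: indicator_def)
  qed
  also have "\<dots> = exp (x\<^sup>2 / 2) / Zn n h * prob {\<omega> \<in> space M. - d \<le> U n h \<omega> - x\<^sup>2 / 2}" by simp
  finally show ?thesis using Zn_pos[OF s, of n] by (simp add: exp_minus field_simps)
qed

lemma prob_lower:
  assumes h: "h > 0"
  shows "prob {\<omega> \<in> space M. 0 \<le> U n h \<omega> - x\<^sup>2 / 2} \<le> prob {\<omega> \<in> space M. x * V_n X n \<omega> \<le> S_n X n \<omega>}"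
proof (rule finite_measure_mono)
  show "{\<omega> \<in> space M. 0 \<le> U n h \<omega> - x\<^sup>2 / 2} \<subseteq> {\<omega> \<in> space M. x * V_n X n \<omega> \<le> S_n X n \<omega>}"
  proof safe
    fix \<omega> assume "0 \<le> U n h \<omega> - x\<^sup>2 / 2"
    then have "((h * V_n X n \<omega>)\<^sup>2 + x\<^sup>2) / 2 \<le> h * S_n X n \<omega>" by (simp add: U_eq field_simps)
    moreover have "0 \<le> (h * V_n X n \<omega> - x)\<^sup>2" by simp
    ultimately have "h * (x * V_n X n \<omega>) \<le> h * S_n X n \<omega>"
      by (simp add: power2_diff mult_ac)
    then show "x * V_n X n \<omega> \<le> S_n X n \<omega>" using h by simp
  qed
qed measurable

text \<open>Markov's inequality for (h V_n)^2, whose mean is x^2. The bound is weak in k, but it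
  only has to stop the dyadic decomposition after finitely many steps.\<close>

lemma prob_V_n_ge:
  assumes h: "h > 0" and x: "x > 0" "x\<^sup>2 = h\<^sup>2 * B_n_sq M X n"
  shows "prob {\<omega> \<in> space M. 2 ^ k * x \<le> h * V_n X n \<omega>} \<le> (1 / 4) ^ k"
proof -
  have V2: "(h * V_n X n \<omega>)\<^sup>2 = h\<^sup>2 * (\<Sum>i=1..n. X i \<omega> ^ 2)" for \<omega>
    by (simp add: V_n_def sum_nonneg power_mult_distrib)
  have iV: "integrable M (\<lambda>\<omega>. (h * V_n X n \<omega>)\<^sup>2)"
    unfolding V2 using integrable_moment[of _ 2] by (intro integrable_mult_right Bochner_Integration.integrable_sum) auto
  have EV: "expectation (\<lambda>\<omega>. (h * V_n X n \<omega>)\<^sup>2) = x\<^sup>2"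
    unfolding V2 x B_n_sq_eq using integrable_moment[of _ 2]
    by (simp add: Bochner_Integration.integral_sum mom_def)
  have pos: "0 < (2 ^ k * x)\<^sup>2" using x by simp
  have "prob {\<omega> \<in> space M. 2 ^ k * x \<le> h * V_n X n \<omega>} = expectation (indicator {\<omega> \<in> space M. 2 ^ k * x \<le> h * V_n X n \<omega>})"
    by simp
  also have "\<dots> \<le> expectation (\<lambda>\<omega>. 1 / (2 ^ k * x)\<^sup>2 * (h * V_n X n \<omega>)\<^sup>2)"
  proof (intro integral_mono integrable_mult_right iV)
    show "integrable M (indicator {\<omega> \<in> space M. 2 ^ k * x \<le> h * V_n X n \<omega>} :: _ \<Rightarrow> real)"
      by (rule integrable_real_indicator) (measurable, simp add: emeasure_eq_measure)
    fix \<omega>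
    have "(2 ^ k * x)\<^sup>2 \<le> (h * V_n X n \<omega>)\<^sup>2" if "2 ^ k * x \<le> h * V_n X n \<omega>"
      using that x by (intro power_mono) auto
    then show "indicator {\<omega> \<in> space M. 2 ^ k * x \<le> h * V_n X n \<omega>} \<omega> \<le> 1 / (2 ^ k * x)\<^sup>2 * (h * V_n X n \<omega>)\<^sup>2"
      using pos by (auto simp: indicator_def le_divide_eq)
  qed
  also have "\<dots> = 1 / (2 ^ k * x)\<^sup>2 * x\<^sup>2" by (simp only: integral_mult_right_zero EV)
  also have "\<dots> = (1 / 4) ^ k"
  proof -
    have "(2 ^ k :: real)\<^sup>2 = 4 ^ k" by (simp add: power2_eq_square flip: power_mult_distrib)
    then show ?thesis using x(1) by (simp add: power_mult_distrib power_one_over)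
  qed
  finally show ?thesis .
qed

text \<open>On \<open>S_n \<ge> x V_n\<close> the quadratic form \<open>h S_n - \<theta> (h V_n)\<^sup>2\<close> is large when \<open>\<theta>\<close> is adapted to the
  size of \<open>u = h V_n\<close>: \<open>\<theta> = 1/2\<close> near \<open>u = x\<close>, \<open>\<theta> = 3/2\<close> below, \<open>\<theta> = 1/4\<close> on \<open>[x, 2 x]\<close>, and
  \<open>\<theta> = 1/8\<close> with \<open>h\<close> rescaled by \<open>2 ^ k\<close> on the dyadic ranges above.\<close>

lemma prob_upper:
  assumes h: "h > 0" and x: "x > 0" "x\<^sup>2 = h\<^sup>2 * B_n_sq M X n" and \<eta>: "0 < \<eta>"
  shows "prob {\<omega> \<in> space M. x * V_n X n \<omega> \<le> S_n X n \<omega>} \<le>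
      prob {\<omega> \<in> space M. - (\<eta>\<^sup>2 / 2) \<le> U n h \<omega> - x\<^sup>2 / 2}
    + exp (- (x\<^sup>2 / 2) - 4 / 3 * T3 n h + A * (real n * h ^ 4) - x * \<eta> / 2)
    + exp (- (x\<^sup>2 / 2) - 1 / 12 * T3 n h + A * (real n * h ^ 4) - x * \<eta> / 4)
    + real N * exp (- (25 / 32 * x\<^sup>2) + \<bar>T3 n h\<bar> + A * (real n * h ^ 4))
    + (1 / 4) ^ Suc N"
proof -
  let ?u = "\<lambda>\<omega>. h * V_n X n \<omega>"
  let ?Q = "\<lambda>\<theta> g a. {\<omega> \<in> space M. a \<le> g * S_n X n \<omega> - \<theta> * (g * V_n X n \<omega>)\<^sup>2}"
  define E0 where "E0 = {\<omega> \<in> space M. - (\<eta>\<^sup>2 / 2) \<le> U n h \<omega> - x\<^sup>2 / 2}"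
  define E1 where "E1 = ?Q (3/2) h (- (x\<^sup>2 / 2) + x * \<eta> / 2)"
  define E2 where "E2 = ?Q (1/4) h (3 / 4 * x\<^sup>2 + x * \<eta> / 4)"
  define E3 where "E3 k = ?Q (1/8) (h / 2 ^ k) (7 / 8 * x\<^sup>2)" for k :: nat
  define E4 where "E4 = {\<omega> \<in> space M. 2 ^ Suc N * x \<le> ?u \<omega>}"
  have meas: "E0 \<in> events" "E1 \<in> events" "E2 \<in> events" "\<And>k. E3 k \<in> events" "E4 \<in> events"
    using U_measurable[OF h] unfolding E0_def E1_def E2_def E3_def E4_def by measurable
  have sub: "{\<omega> \<in> space M. x * V_n X n \<omega> \<le> S_n X n \<omega>} \<subseteq> E0 \<union> E1 \<union> E2 \<union> (\<Union>k\<in>{1..N}. E3 k) \<union> E4"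
  proof
    fix \<omega> assume "\<omega> \<in> {\<omega> \<in> space M. x * V_n X n \<omega> \<le> S_n X n \<omega>}"
    then have sp: "\<omega> \<in> space M" and S: "x * V_n X n \<omega> \<le> S_n X n \<omega>" by auto
    define u where "u = ?u \<omega>"
    have u0: "0 \<le> u" using h V_n_nonneg[of n \<omega>] by (simp add: u_def)
    have S': "x * (g * V_n X n \<omega>) \<le> g * S_n X n \<omega>" if "g > 0" for g
      using mult_left_mono[OF S, of g] that by (simp add: mult_ac)
    have Su: "x * u \<le> h * S_n X n \<omega>" using S'[OF h] by (simp add: u_def)
    consider "\<bar>u - x\<bar> \<le> \<eta>" | "u < x - \<eta>" | "x + \<eta> < u" "u \<le> 2 * x" | "2 * x < u" "u < 2 ^ Suc N * x" | "2 ^ Suc N * x \<le> u"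
      by linarith
    then show "\<omega> \<in> E0 \<union> E1 \<union> E2 \<union> (\<Union>k\<in>{1..N}. E3 k) \<union> E4"
    proof cases
      case 1
      then have "(u - x)\<^sup>2 \<le> \<eta>\<^sup>2" by (intro abs_le_square_iff[THEN iffD1]) (use \<eta> in simp)
      then have "- (\<eta>\<^sup>2 / 2) \<le> x * u - u\<^sup>2 / 2 - x\<^sup>2 / 2" by (simp add: power2_diff mult_ac)
      then show ?thesis using Su sp by (simp add: E0_def U_eq u_def)
    next
      case 2
      \<comment> \<open>With L(\<theta>) = x u - \<theta> u^2, the product (x - u)(x + 3 u) is 2
        L(3/2) + x^2. In the next two cases (u - x)(3 x - u) is 4 L(1/4) - 3 x^2 and (w - x)(7 x -
        w) is 8 L(1/8) - 7 x^2 with w for u: each \<theta> is chosen to make u = x a root.\<close>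
      have "\<eta> * x \<le> (x - u) * (x + 3 * u)"
        using 2 u0 \<eta> x(1) by (intro mult_mono) auto
      then have "- (x\<^sup>2 / 2) + x * \<eta> / 2 \<le> x * u - 3 / 2 * u\<^sup>2"
        by (simp add: power2_eq_square algebra_simps)
      then show ?thesis using Su sp by (simp add: E1_def u_def)
    next
      case 3
      have "\<eta> * x \<le> (u - x) * (3 * x - u)"
        using 3 \<eta> x(1) by (intro mult_mono) auto
      then have "3 / 4 * x\<^sup>2 + x * \<eta> / 4 \<le> x * u - 1 / 4 * u\<^sup>2"
        by (simp add: power2_eq_square algebra_simps)
      then show ?thesis using Su sp by (simp add: E2_def u_def)
    next
      case 4
      then have "2 \<le> u / x" "u / x < 2 ^ Suc N" using x(1) by (auto simp: field_simps)
      from dyadic_bracket[OF this] obtain k where k: "k \<in> {1..N}" "2 ^ k \<le> u / x" "u / x \<le> 2 ^ Suc k"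
        by blast
      define g where "g = h / 2 ^ k"
      define w where "w = g * V_n X n \<omega>"
      have w: "x \<le> w" "w \<le> 2 * x"
        using k(2,3) x(1) by (simp_all add: w_def g_def u_def field_simps)
      have "0 \<le> (w - x) * (7 * x - w)" using w x(1) by simp
      then have "7 / 8 * x\<^sup>2 \<le> x * w - 1 / 8 * w\<^sup>2"
        by (simp add: power2_eq_square algebra_simps)
      moreover have "x * w \<le> g * S_n X n \<omega>" using S'[of g] h by (simp add: w_def g_def)
      ultimately have "7 / 8 * x\<^sup>2 \<le> g * S_n X n \<omega> - 1 / 8 * w\<^sup>2" by linarith
      then have "\<omega> \<in> E3 k" using sp unfolding E3_def g_def[symmetric] w_def by blast
      then show ?thesis using k(1) by blast
    qed (use sp in \<open>simp add: E4_def u_def\<close>)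
  qed
  have "prob {\<omega> \<in> space M. x * V_n X n \<omega> \<le> S_n X n \<omega>} \<le> prob (E0 \<union> E1 \<union> E2 \<union> (\<Union>k\<in>{1..N}. E3 k) \<union> E4)"
    using meas by (intro finite_measure_mono sub) auto
  also have "\<dots> \<le> prob E0 + prob E1 + prob E2 + (\<Sum>k\<in>{1..N}. prob (E3 k)) + prob E4"
  proof -
    have 3: "prob (\<Union>k\<in>{1..N}. E3 k) \<le> (\<Sum>k\<in>{1..N}. prob (E3 k))"
      using meas by (intro finite_measure_subadditive_finite) auto
    have m: "(\<Union>k\<in>{1..N}. E3 k) \<in> events" using meas by auto
    have "prob (E0 \<union> E1 \<union> E2 \<union> (\<Union>k\<in>{1..N}. E3 k) \<union> E4) \<le> prob (E0 \<union> E1 \<union> E2 \<union> (\<Union>k\<in>{1..N}. E3 k)) + prob E4"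
      using meas m by (intro measure_Un_le) auto
    moreover have "prob (E0 \<union> E1 \<union> E2 \<union> (\<Union>k\<in>{1..N}. E3 k)) \<le> prob (E0 \<union> E1 \<union> E2) + prob (\<Union>k\<in>{1..N}. E3 k)"
      using meas m by (intro measure_Un_le) auto
    moreover have "prob (E0 \<union> E1 \<union> E2) \<le> prob (E0 \<union> E1) + prob E2" using meas by (intro measure_Un_le) auto
    moreover have "prob (E0 \<union> E1) \<le> prob E0 + prob E1" using meas by (intro measure_Un_le) auto
    ultimately show ?thesis using 3 by linarith
  qed
  also have "prob E1 \<le> exp (- (x\<^sup>2 / 2) - 4 / 3 * T3 n h + A * (real n * h ^ 4) - x * \<eta> / 2)"
    unfolding E1_def by (rule order_trans[OF tail_quadratic[OF h]]) (auto simp: x(2)[symmetric])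
  also have "prob E2 \<le> exp (- (x\<^sup>2 / 2) - 1 / 12 * T3 n h + A * (real n * h ^ 4) - x * \<eta> / 4)"
    unfolding E2_def by (rule order_trans[OF tail_quadratic[OF h]]) (auto simp: x(2)[symmetric])
  also have "(\<Sum>k\<in>{1..N}. prob (E3 k)) \<le> (\<Sum>k\<in>{1..N}. exp (- (25 / 32 * x\<^sup>2) + \<bar>T3 n h\<bar> + A * (real n * h ^ 4)))"
  proof (rule sum_mono)
    fix k assume "k \<in> {1..N}"
    then have k: "k \<ge> 1" by simp
    define g where "g = h / 2 ^ k"
    have g: "g > 0" "g \<le> h" "g \<le> h / 2"
    proof -
      have "(2::real) ^ 1 \<le> 2 ^ k" using k by (intro power_increasing) auto
      then show "g > 0" "g \<le> h" "g \<le> h / 2" using h by (auto simp: g_def field_simps)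
    qed
    have "g\<^sup>2 \<le> (h / 2)\<^sup>2" using g by (intro power_mono) auto
    then have "g\<^sup>2 * B_n_sq M X n \<le> (h / 2)\<^sup>2 * B_n_sq M X n"
      using mom_even_nonneg[of 2] by (intro mult_right_mono) (auto simp: B_n_sq_eq intro!: sum_nonneg)
    then have 1: "g\<^sup>2 * B_n_sq M X n \<le> x\<^sup>2 / 4" by (simp add: x(2) power_divide)
    have "g ^ 3 \<le> h ^ 3" using g by (intro power_mono) auto
    then have 2: "\<bar>T3 n g\<bar> \<le> \<bar>T3 n h\<bar>"
      using g(1) h by (simp add: T3_def abs_mult mult_right_mono)
    have "g ^ 4 \<le> h ^ 4" using g by (intro power_mono) auto
    then have 3: "A * (real n * g ^ 4) \<le> A * (real n * h ^ 4)"
      using A_ge by (intro mult_left_mono) auto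
    have "prob (E3 k) \<le> exp ((1/2 - 1/8) * (g\<^sup>2 * B_n_sq M X n) + (1/6 - 1/8) * T3 n g + A * (real n * g ^ 4) - 7 / 8 * x\<^sup>2)"
      unfolding E3_def g_def[symmetric] by (rule tail_quadratic[OF g(1)]) simp
    also have "\<dots> \<le> exp (- (25 / 32 * x\<^sup>2) + \<bar>T3 n h\<bar> + A * (real n * h ^ 4))"
      using 1 2 3 by simp
    finally show "prob (E3 k) \<le> exp (- (25 / 32 * x\<^sup>2) + \<bar>T3 n h\<bar> + A * (real n * h ^ 4))" .
  qed
  also have "prob E4 \<le> (1 / 4) ^ Suc N"
    unfolding E4_def by (rule prob_V_n_ge[OF h x])
  finally show ?thesis by (simp add: E0_def)
qed

section \<open>Asymptotics along a sequence of parameters\<close>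

context
  fixes nn :: "nat \<Rightarrow> nat" and x h :: "nat \<Rightarrow> real"
  assumes xge: "\<And>m. x m \<ge> 1" and small: "\<And>m. small (h m)"
    and xh: "\<And>m. (x m)\<^sup>2 = (h m)\<^sup>2 * B_n_sq M X (nn m)"
    and hk: "\<And>m. h m \<le> \<kappa>" and G: "\<And>m. 10 * A ^ 3 * (real (nn m) * h m ^ 4) \<le> x m"
    and T3_le: "\<And>m. \<bar>T3 (nn m) (h m)\<bar> \<le> 1"
    and xinf: "filterlim x at_top sequentially" and hlim: "h \<longlonglongrightarrow> 0"
    and Glim: "(\<lambda>m. real (nn m) * h m ^ 4 / x m) \<longlonglongrightarrow> 0"
    and xh2: "(\<lambda>m. x m * (h m)\<^sup>2) \<longlonglongrightarrow> 0"
    and T3lim: "(\<lambda>m. T3 (nn m) (h m)) \<longlonglongrightarrow> 0"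
begin

lemma xpos: "x m > 0" using xge[of m] by linarith

text \<open>At t = s/x the linear error of \<open>prod_psi_near\<close> becomes |s| n h^4 / x, and n
  h^2 <= x^2/c reduces the other errors to multiples of h. The phase tends to 1 because both s/x and
  T3 tend to 0.\<close>

lemma char_tilted_tendsto:
  "(\<lambda>m. char (tilted (nn m) (h m) (x m)) (s / x m)) \<longlonglongrightarrow> complex_of_real (exp (- (s\<^sup>2 / 2)))"
proof -
  have "(\<lambda>m. (\<Prod>i=1..nn m. psi (h m) i (s / x m)) - complex_of_real (exp (- (s\<^sup>2 / 2)))) \<longlonglongrightarrow> 0"
  proof (rule Lim_null_comparison)
    let ?b = "\<lambda>m. 10 * A ^ 3 * (\<bar>s\<bar> * (real (nn m) * h m ^ 4 / x m) + (s\<^sup>2 + \<bar>s\<bar> ^ 3 + s ^ 4) * (h m / c))"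
    show "\<forall>\<^sub>F m in sequentially. norm ((\<Prod>i=1..nn m. psi (h m) i (s / x m)) - complex_of_real (exp (- (s\<^sup>2 / 2)))) \<le> ?b m"
    proof (intro always_eventually allI)
      fix m
      note hm = smallD[OF small[of m]]
      let ?n = "real (nn m)" and ?h = "h m" and ?x = "x m"
      have nh: "?n * ?h\<^sup>2 \<le> ?x\<^sup>2 / c" by (rule n_h_square_le[OF xh])
      have pw: "1 / ?x ^ k * q \<le> q" if "q \<ge> 0" for k q
      proof -
        have "1 / ?x ^ k \<le> 1" using xge[of m] by (simp add: one_le_power)
        then show ?thesis using that by (rule mult_left_le_one_le[rotated 2]) (use xpos[of m] in auto)
      qed
      have base: "?n * ?h\<^sup>2 * ?h / ?x\<^sup>2 \<le> ?h / c"
      proof -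
        have "?n * ?h\<^sup>2 * ?h / ?x\<^sup>2 \<le> ?x\<^sup>2 / c * ?h / ?x\<^sup>2"
          using nh hm(1) by (intro divide_right_mono mult_right_mono) auto
        also have "\<dots> = ?h / c" using xpos[of m] by simp
        finally show ?thesis .
      qed
      have b0: "0 \<le> ?n * ?h\<^sup>2 * ?h / ?x\<^sup>2" using hm(1) by simp
      have e1: "?n * (\<bar>s / ?x\<bar> * ?h ^ 4) = \<bar>s\<bar> * (?n * ?h ^ 4 / ?x)"
        using xpos[of m] by (simp add: abs_divide)
      have e2: "?n * ((s / ?x)\<^sup>2 * ?h ^ 3) \<le> s\<^sup>2 * (?h / c)"
      proof -
        have "?n * ((s / ?x)\<^sup>2 * ?h ^ 3) = s\<^sup>2 * (?n * ?h\<^sup>2 * ?h / ?x\<^sup>2)"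
          by (simp add: power_divide power2_eq_square power3_eq_cube)
        also have "\<dots> \<le> s\<^sup>2 * (?h / c)" using base by (intro mult_left_mono) auto
        finally show ?thesis .
      qed
      have e3: "?n * (\<bar>s / ?x\<bar> ^ 3 * ?h ^ 3) \<le> \<bar>s\<bar> ^ 3 * (?h / c)"
      proof -
        have "?n * (\<bar>s / ?x\<bar> ^ 3 * ?h ^ 3) = \<bar>s\<bar> ^ 3 * (1 / ?x ^ 1 * (?n * ?h\<^sup>2 * ?h / ?x\<^sup>2))"
          using xpos[of m] by (simp add: abs_divide power_divide power2_eq_square power3_eq_cube mult_ac)
        also have "\<dots> \<le> \<bar>s\<bar> ^ 3 * (?h / c)" using base pw[OF b0, of 1] by (intro mult_left_mono) auto
        finally show ?thesis .
      qed
      have e4: "?n * ((s / ?x) ^ 4 * ?h ^ 4) \<le> s ^ 4 * (?h / c)"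
      proof -
        have "?n * ((s / ?x) ^ 4 * ?h ^ 4) = s ^ 4 * (1 / ?x ^ 2 * (?n * ?h\<^sup>2 * ?h / ?x\<^sup>2)) * ?h"
          using xpos[of m] by (simp add: power_divide power2_eq_square eval_nat_numeral mult_ac)
        also have "\<dots> \<le> s ^ 4 * (?h / c) * 1"
          using base pw[OF b0, of 2] hm c(1) by (intro mult_mono mult_left_mono) auto
        finally show ?thesis by simp
      qed
      have "norm ((\<Prod>i=1..nn m. psi ?h i (s / ?x)) - complex_of_real (exp (- (s\<^sup>2 / 2))))
          \<le> 10 * A ^ 3 * ?n * (\<bar>s / ?x\<bar> * ?h ^ 4 + (s / ?x)\<^sup>2 * ?h ^ 3 + \<bar>s / ?x\<bar> ^ 3 * ?h ^ 3 + (s / ?x) ^ 4 * ?h ^ 4)"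
        using prod_psi_near[OF small xh, of m "s / ?x"] xpos[of m] by simp
      also have "\<dots> = 10 * A ^ 3 * (?n * (\<bar>s / ?x\<bar> * ?h ^ 4) + ?n * ((s / ?x)\<^sup>2 * ?h ^ 3)
          + ?n * (\<bar>s / ?x\<bar> ^ 3 * ?h ^ 3) + ?n * ((s / ?x) ^ 4 * ?h ^ 4))"
        by (simp only: distrib_left mult.assoc)
      also have "\<dots> \<le> ?b m"
        using e1 e2 e3 e4 A_ge by (intro mult_left_mono) (simp_all only: distrib_right, auto)
      finally show "norm ((\<Prod>i=1..nn m. psi ?h i (s / ?x)) - complex_of_real (exp (- (s\<^sup>2 / 2)))) \<le> ?b m" .
    qed
    have "?b \<longlonglongrightarrow> 10 * A ^ 3 * (\<bar>s\<bar> * 0 + (s\<^sup>2 + \<bar>s\<bar> ^ 3 + s ^ 4) * (0 / c))"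
      using c(1) by (intro tendsto_intros Glim hlim) auto
    then show "?b \<longlonglongrightarrow> 0" by simp
  qed
  then have 1: "(\<lambda>m. \<Prod>i=1..nn m. psi (h m) i (s / x m)) \<longlonglongrightarrow> complex_of_real (exp (- (s\<^sup>2 / 2)))"
    by (simp only: LIM_zero_iff)
  have "(\<lambda>m. s / x m) \<longlonglongrightarrow> 0"
    using tendsto_divide_0[OF tendsto_const filterlim_at_top_imp_at_infinity[OF xinf]] .
  then have "(\<lambda>m. iexp (- (s / x m * T3 (nn m) (h m) / 2))) \<longlonglongrightarrow> iexp (- (0 * 0 / 2))"
    using T3lim by (intro tendsto_intros) auto
  from tendsto_mult[OF this 1] show ?thesis
    unfolding char_tilted[OF small xh] by simp
qed

text \<open>The Gaussian bound on the characteristic function holds up to K = \<kappa>/h. As exp(y)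
  >= y^2/2, exp(-K/2) is at most 8 h^2/\<kappa>^2, so x exp(-K/2) -> 0 follows from x h^2 ->
  0.\<close>

lemma integral_tilted_tendsto:
  "(\<lambda>m. x m * (LINT w|tilted (nn m) (h m) (x m). indicator {a..} w * exp (- w))) \<longlonglongrightarrow> exp (- a) / sqrt (2 * pi)"
proof (rule local_limit_exponential[where K = "\<lambda>m. \<kappa> / h m" and A = "exp 2"])
  show "norm (char (tilted (nn m) (h m) (x m)) t) \<le> exp 2 * exp (- ((t * x m)\<^sup>2 / 8))" if "\<bar>t\<bar> \<le> \<kappa> / h m" for m t
    using that smallD(1)[OF small[of m]]
    by (intro norm_char_tilted_le small xh xpos hk G) (simp add: le_divide_eq)
  show "(\<lambda>m. x m * exp (- (\<kappa> / h m) / 2)) \<longlonglongrightarrow> 0"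
  proof (rule Lim_null_comparison)
    show "\<forall>\<^sub>F m in sequentially. norm (x m * exp (- (\<kappa> / h m) / 2)) \<le> 8 / \<kappa>\<^sup>2 * (x m * (h m)\<^sup>2)"
    proof (intro always_eventually allI)
      fix m
      have hm: "h m > 0" by (rule smallD(1)[OF small])
      define y where "y = \<kappa> / h m / 2"
      have y: "y > 0" using hm kappa_pos by (simp add: y_def)
      have "y\<^sup>2 / 2 \<le> exp y" using exp_lower_Taylor_quadratic[of y] y by simp
      then have "exp (- y) \<le> 2 / y\<^sup>2" using y by (simp add: exp_minus field_simps)
      also have "2 / y\<^sup>2 = 8 / \<kappa>\<^sup>2 * (h m)\<^sup>2" using hm kappa_pos by (simp add: y_def power2_eq_square)
      finally have "x m * exp (- y) \<le> x m * (8 / \<kappa>\<^sup>2 * (h m)\<^sup>2)"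
        using xpos[of m] by (intro mult_left_mono) auto
      then show "norm (x m * exp (- (\<kappa> / h m) / 2)) \<le> 8 / \<kappa>\<^sup>2 * (x m * (h m)\<^sup>2)"
        using xpos[of m] by (simp add: y_def abs_mult mult_ac)
    qed
    show "(\<lambda>m. 8 / \<kappa>\<^sup>2 * (x m * (h m)\<^sup>2)) \<longlonglongrightarrow> 0" by (rule tendsto_mult_right_zero[OF xh2])
  qed
qed (use real_distribution_tilted[OF small] xpos xinf char_tilted_tendsto in auto)

lemma prob_U_ge_ratio_tendsto:
  "(\<lambda>m. prob {\<omega> \<in> space M. - d \<le> U (nn m) (h m) \<omega> - (x m)\<^sup>2 / 2} / ((1 - Phi (x m)) * Zn (nn m) (h m))) \<longlonglongrightarrow> exp d"
proof -
  have eq: "prob {\<omega> \<in> space M. - d \<le> U (nn m) (h m) \<omega> - (x m)\<^sup>2 / 2} / ((1 - Phi (x m)) * Zn (nn m) (h m)) =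
      (x m * (LINT w|tilted (nn m) (h m) (x m). indicator {- d..} w * exp (- w))) /
      (x m * exp ((x m)\<^sup>2 / 2) * (1 - Phi (x m)))" for m
    unfolding prob_U_ge[OF small] using Zn_pos[OF small[of m], of "nn m"] one_minus_Phi_pos[of "x m"] xpos[of m]
    by (simp add: exp_minus field_simps)
  have "(\<lambda>m. (x m * (LINT w|tilted (nn m) (h m) (x m). indicator {- d..} w * exp (- w))) /
      (x m * exp ((x m)\<^sup>2 / 2) * (1 - Phi (x m)))) \<longlonglongrightarrow> (exp (- (- d)) / sqrt (2 * pi)) / (1 / sqrt (2 * pi))"
    by (intro tendsto_divide integral_tilted_tendsto Mills_ratio xpos xinf) auto
  then show ?thesis unfolding eq by simp
qed

text \<open>1/Z may grow exponentially in n h^4, which can be unbounded. The error terms of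
  \<open>prob_upper\<close> have to be smaller by this factor.\<close>

lemma inverse_Zn_le: "1 / Zn (nn m) (h m) \<le> exp (1 + 10 * A\<^sup>2 * (real (nn m) * h m ^ 4))"
proof -
  note hm = smallD[OF small[of m]]
  let ?G = "real (nn m) * h m ^ 4"
  have "h m powr r \<le> h m powr 4" using hm r by (intro powr_mono') auto
  also have "h m powr 4 = h m ^ 4" using hm(1) powr_realpow[of "h m" 4] by simp
  finally have "9 * A\<^sup>2 * (real (nn m) * h m powr r) \<le> 9 * A\<^sup>2 * ?G" by (intro mult_left_mono) auto
  moreover have "T4 (nn m) (h m) \<le> A\<^sup>2 * ?G"
  proof -
    have "A * ?G \<le> A\<^sup>2 * ?G"
      using A_ge(1) power_increasing[of 1 2 A] by (intro mult_right_mono) auto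
    then show ?thesis using T4_le[OF hm(1), of "nn m"] by linarith
  qed
  moreover have "0 \<le> T4 (nn m) (h m)"
    using T4_ge[OF hm(1), of "nn m"] by (rule order_trans[rotated]) simp
  ultimately have "- (1 + 10 * A\<^sup>2 * ?G) \<le> ln (Zn (nn m) (h m))"
    using ln_Zn_expansion[OF small[of m], of "nn m"] T3_le[of m] by linarith
  then have "exp (- (1 + 10 * A\<^sup>2 * ?G)) \<le> Zn (nn m) (h m)"
    using Zn_pos[OF small[of m], of "nn m"] by (simp add: ln_ge_iff)
  then have "1 / Zn (nn m) (h m) \<le> 1 / exp (- (1 + 10 * A\<^sup>2 * ?G))"
    using Zn_pos[OF small[of m], of "nn m"] by (intro divide_left_mono) auto
  then show ?thesis by (simp only: exp_minus inverse_eq_divide) simp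
qed

text \<open>The event W >= 0 bounds the ratio from below. From above, the windows -d <= W with
  arbitrarily small d > 0 cost a factor exp d, and the other terms of \<open>prob_upper\<close>
  vanish relative to Z (1 - Phi).\<close>

lemma S_n_ratio_tendsto:
  "(\<lambda>m. prob {\<omega> \<in> space M. x m * V_n X (nn m) \<omega> \<le> S_n X (nn m) \<omega>} / ((1 - Phi (x m)) * Zn (nn m) (h m))) \<longlonglongrightarrow> 1"
proof -
  define G where "G m = real (nn m) * h m ^ 4" for m
  \<comment> \<open>The first summand makes x \<eta> at least sqrt x, which yields decay. The second
    provides x \<eta> / 4 >= 11 A^2 n h^4, enough for A n h^4 from the Markov bound plus 10 A^2 n
    h^4 from 1/Z.\<close>
  define \<eta> where "\<eta> m = 1 / sqrt (x m) + 44 * A\<^sup>2 * (G m / x m)" for m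
  \<comment> \<open>As 1/4 <= exp(-1), the remainder 4^-(N+1) is at most exp(-x^2), while the number
    of dyadic pieces stays polynomial in x.\<close>
  define N where "N m = nat \<lceil>(x m)\<^sup>2\<rceil>" for m
  define p where "p d m = prob {\<omega> \<in> space M. - d \<le> U (nn m) (h m) \<omega> - (x m)\<^sup>2 / 2}" for d m
  define R where "R m = (1 - Phi (x m)) * Zn (nn m) (h m)" for m
  define Q where "Q m = prob {\<omega> \<in> space M. x m * V_n X (nn m) \<omega> \<le> S_n X (nn m) \<omega>}" for m
  define e where "e y = 2 * (y * exp (3 - sqrt y / 4)) + (y\<^sup>2 + 1) * y * exp (2 + 2 * y - 9 / 32 * y\<^sup>2)
      + y * exp (1 + 2 * y - y\<^sup>2 / 2)" for y :: real
  have R: "R m > 0" for m using Zn_pos[OF small] one_minus_Phi_pos by (simp add: R_def)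
  have Gn: "0 \<le> G m" for m by (simp add: G_def)
  have Gx: "10 * (A\<^sup>2 * G m) \<le> x m" for m
  proof -
    have "A\<^sup>2 * G m \<le> A ^ 3 * G m" using A_ge(1) Gn by (intro mult_right_mono power_increasing) auto
    then show ?thesis using G[of m] by (simp add: G_def)
  qed
  have AG: "A * G m \<le> A\<^sup>2 * G m" for m
    using A_ge(1) power_increasing[of 1 2 A] Gn by (intro mult_right_mono) auto
  have AG0: "0 \<le> A\<^sup>2 * G m" for m using Gn by simp
  have \<eta>pos: "\<eta> m > 0" for m
    using xpos[of m] Gn[of m] by (simp add: \<eta>_def add_pos_nonneg)
  have x\<eta>: "x m * \<eta> m = sqrt (x m) + 44 * (A\<^sup>2 * G m)" for m
    using xpos[of m] by (simp add: \<eta>_def distrib_left real_div_sqrt)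
  have \<eta>lim: "\<eta> \<longlonglongrightarrow> 0"
  proof -
    have "((\<lambda>y::real. 1 / sqrt y) \<longlongrightarrow> 0) at_top" by real_asymp
    from filterlim_compose[OF this xinf] have "\<eta> \<longlonglongrightarrow> 0 + 44 * A\<^sup>2 * 0"
      unfolding \<eta>_def G_def by (intro tendsto_intros Glim)
    then show ?thesis by simp
  qed
  have elim: "(\<lambda>m. e (x m)) \<longlonglongrightarrow> 0"
  proof -
    have "(e \<longlongrightarrow> 0) at_top" unfolding e_def by real_asymp
    then show ?thesis using filterlim_compose xinf by blast
  qed
  have upper: "Q m \<le> p ((\<eta> m)\<^sup>2 / 2) m + e (x m) / (x m * exp ((x m)\<^sup>2 / 2)) * Zn (nn m) (h m)" for m
  proof -
    let ?x = "x m" and ?Z = "Zn (nn m) (h m)" and ?T = "T3 (nn m) (h m)"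
    have Z: "?Z > 0" by (rule Zn_pos[OF small])
    \<comment> \<open>By Mills' ratio, Z / (x exp(x^2/2)) has the order of \<open>R\<close>. A bound
      q is therefore negligible once x exp(x^2/2) q, multiplied by the bound on 1/Z, tends to
      0.\<close>
    have conv: "q \<le> f / (?x * exp (?x\<^sup>2 / 2)) * ?Z"
      if "?x * exp (?x\<^sup>2 / 2) * q * exp (1 + 10 * (A\<^sup>2 * G m)) \<le> f" "0 \<le> q" for q f
    proof -
      have "?x * exp (?x\<^sup>2 / 2) * q * (1 / ?Z) \<le> ?x * exp (?x\<^sup>2 / 2) * q * exp (1 + 10 * (A\<^sup>2 * G m))"
        using inverse_Zn_le[of m] xpos[of m] that(2) by (intro mult_left_mono) (auto simp: G_def mult.assoc)
      then have "?x * exp (?x\<^sup>2 / 2) * q * (1 / ?Z) \<le> f" using that(1) by linarith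
      then show ?thesis using xpos[of m] Z by (simp add: field_simps)
    qed
    have T: "\<bar>?T\<bar> \<le> 1" by (rule T3_le)
    \<comment> \<open>s and b stand for sqrt x and A^2 n h^4. The terms 22 b and 11 b coming from x
      \<eta> outweigh b + 10 b, and the T3 term costs at most 4/3.\<close>
    have lin1: "q / 2 + (- (q / 2) - 4 / 3 * T + a - (s + 44 * b) / 2) + (1 + 10 * b) \<le> 3 - s / 4"
      and lin2: "q / 2 + (- (q / 2) - 1 / 12 * T + a - (s + 44 * b) / 4) + (1 + 10 * b) \<le> 3 - s / 4"
      if "- 1 \<le> T" "a \<le> b" "0 \<le> b" "0 \<le> s" for q T a b s :: real
      using that by (auto simp: field_simps)
    have T': "- 1 \<le> ?T" "?T \<le> 1" using T by (auto simp: abs_le_iff)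
    have sx: "0 \<le> sqrt ?x" using xpos[of m] by simp
    have 1: "exp (- (?x\<^sup>2 / 2) - 4 / 3 * ?T + A * G m - ?x * \<eta> m / 2)
        \<le> ?x * exp (3 - sqrt ?x / 4) / (?x * exp (?x\<^sup>2 / 2)) * ?Z"
    proof (rule conv)
      have "?x * exp (?x\<^sup>2 / 2) * exp (- (?x\<^sup>2 / 2) - 4 / 3 * ?T + A * G m - ?x * \<eta> m / 2) * exp (1 + 10 * (A\<^sup>2 * G m)) =
          ?x * exp (?x\<^sup>2 / 2 + (- (?x\<^sup>2 / 2) - 4 / 3 * ?T + A * G m - ?x * \<eta> m / 2) + (1 + 10 * (A\<^sup>2 * G m)))"
        by (simp only: exp_add mult.assoc)
      also have "\<dots> \<le> ?x * exp (3 - sqrt ?x / 4)"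
      proof (rule mult_left_mono)
        show "exp (?x\<^sup>2 / 2 + (- (?x\<^sup>2 / 2) - 4 / 3 * ?T + A * G m - ?x * \<eta> m / 2) + (1 + 10 * (A\<^sup>2 * G m))) \<le> exp (3 - sqrt ?x / 4)"
          unfolding x\<eta> exp_le_cancel_iff by (rule lin1[OF T'(1) AG AG0 sx])
      qed (use xpos[of m] in simp)
      finally show "?x * exp (?x\<^sup>2 / 2) * exp (- (?x\<^sup>2 / 2) - 4 / 3 * ?T + A * G m - ?x * \<eta> m / 2) * exp (1 + 10 * (A\<^sup>2 * G m)) \<le> ?x * exp (3 - sqrt ?x / 4)" .
    qed simp
    have 2: "exp (- (?x\<^sup>2 / 2) - 1 / 12 * ?T + A * G m - ?x * \<eta> m / 4)
        \<le> ?x * exp (3 - sqrt ?x / 4) / (?x * exp (?x\<^sup>2 / 2)) * ?Z"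
    proof (rule conv)
      have "?x * exp (?x\<^sup>2 / 2) * exp (- (?x\<^sup>2 / 2) - 1 / 12 * ?T + A * G m - ?x * \<eta> m / 4) * exp (1 + 10 * (A\<^sup>2 * G m)) =
          ?x * exp (?x\<^sup>2 / 2 + (- (?x\<^sup>2 / 2) - 1 / 12 * ?T + A * G m - ?x * \<eta> m / 4) + (1 + 10 * (A\<^sup>2 * G m)))"
        by (simp only: exp_add mult.assoc)
      also have "\<dots> \<le> ?x * exp (3 - sqrt ?x / 4)"
      proof (rule mult_left_mono)
        show "exp (?x\<^sup>2 / 2 + (- (?x\<^sup>2 / 2) - 1 / 12 * ?T + A * G m - ?x * \<eta> m / 4) + (1 + 10 * (A\<^sup>2 * G m))) \<le> exp (3 - sqrt ?x / 4)"
          unfolding x\<eta> exp_le_cancel_iff by (rule lin2[OF T'(1) AG AG0 sx])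
      qed (use xpos[of m] in simp)
      finally show "?x * exp (?x\<^sup>2 / 2) * exp (- (?x\<^sup>2 / 2) - 1 / 12 * ?T + A * G m - ?x * \<eta> m / 4) * exp (1 + 10 * (A\<^sup>2 * G m)) \<le> ?x * exp (3 - sqrt ?x / 4)" .
    qed simp
    \<comment> \<open>After multiplication by exp(x^2/2) the decay exp(-9 x^2/32) is left, since 1/2
      - 25/32 = -9/32; it beats the factor from 11 A^2 n h^4 <= 2 x.\<close>
    have 3: "real (N m) * exp (- (25 / 32 * ?x\<^sup>2) + \<bar>?T\<bar> + A * G m)
        \<le> (?x\<^sup>2 + 1) * ?x * exp (2 + 2 * ?x - 9 / 32 * ?x\<^sup>2) / (?x * exp (?x\<^sup>2 / 2)) * ?Z"
    proof (rule conv)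
      have Nle: "real (N m) \<le> ?x\<^sup>2 + 1"
        unfolding N_def using zero_le_power2[of ?x] by linarith
      have "?x * exp (?x\<^sup>2 / 2) * (real (N m) * exp (- (25 / 32 * ?x\<^sup>2) + \<bar>?T\<bar> + A * G m)) * exp (1 + 10 * (A\<^sup>2 * G m)) =
          real (N m) * ?x * exp (?x\<^sup>2 / 2 + (- (25 / 32 * ?x\<^sup>2) + \<bar>?T\<bar> + A * G m) + (1 + 10 * (A\<^sup>2 * G m)))"
        by (simp only: exp_add mult_ac)
      also have "\<dots> \<le> (?x\<^sup>2 + 1) * ?x * exp (2 + 2 * ?x - 9 / 32 * ?x\<^sup>2)"
      proof (rule mult_mono)
        show "real (N m) * ?x \<le> (?x\<^sup>2 + 1) * ?x" using Nle xpos[of m] by (intro mult_right_mono) auto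
        have "?x\<^sup>2 / 2 + (- (25 / 32 * ?x\<^sup>2) + \<bar>?T\<bar> + A * G m) + (1 + 10 * (A\<^sup>2 * G m)) \<le> 2 + 2 * ?x - 9 / 32 * ?x\<^sup>2"
          using T AG[of m] AG0[of m] Gx[of m] by linarith
        then show "exp (?x\<^sup>2 / 2 + (- (25 / 32 * ?x\<^sup>2) + \<bar>?T\<bar> + A * G m) + (1 + 10 * (A\<^sup>2 * G m))) \<le> exp (2 + 2 * ?x - 9 / 32 * ?x\<^sup>2)"
          by simp
      qed (use xpos[of m] in auto)
      finally show "?x * exp (?x\<^sup>2 / 2) * (real (N m) * exp (- (25 / 32 * ?x\<^sup>2) + \<bar>?T\<bar> + A * G m)) * exp (1 + 10 * (A\<^sup>2 * G m)) \<le> (?x\<^sup>2 + 1) * ?x * exp (2 + 2 * ?x - 9 / 32 * ?x\<^sup>2)" .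
    qed simp
    have 4: "(1 / 4) ^ Suc (N m) \<le> ?x * exp (1 + 2 * ?x - ?x\<^sup>2 / 2) / (?x * exp (?x\<^sup>2 / 2)) * ?Z"
    proof (rule conv)
      have q: "(1 / 4 :: real) \<le> exp (- 1)"
        using exp_le by (simp add: exp_minus field_simps)
      have "(1 / 4 :: real) ^ Suc (N m) \<le> exp (- 1) ^ Suc (N m)" using q by (intro power_mono) auto
      also have "\<dots> = exp (- real (Suc (N m)))" by (subst exp_of_nat_mult[symmetric]) simp
      also have "\<dots> \<le> exp (- ?x\<^sup>2)" unfolding N_def by simp linarith
      finally have q: "(1 / 4 :: real) ^ Suc (N m) \<le> exp (- ?x\<^sup>2)" .
      have "?x * exp (?x\<^sup>2 / 2) * (1 / 4) ^ Suc (N m) * exp (1 + 10 * (A\<^sup>2 * G m)) \<le>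
          ?x * exp (?x\<^sup>2 / 2) * exp (- ?x\<^sup>2) * exp (1 + 10 * (A\<^sup>2 * G m))"
        using q xpos[of m] by (intro mult_right_mono mult_left_mono) auto
      also have "\<dots> = ?x * exp (?x\<^sup>2 / 2 + - ?x\<^sup>2 + (1 + 10 * (A\<^sup>2 * G m)))"
        by (simp only: exp_add mult.assoc)
      also have "\<dots> \<le> ?x * exp (1 + 2 * ?x - ?x\<^sup>2 / 2)"
      proof -
        have "?x\<^sup>2 / 2 + - ?x\<^sup>2 + (1 + 10 * (A\<^sup>2 * G m)) \<le> 1 + 2 * ?x - ?x\<^sup>2 / 2"
          using Gx[of m] xpos[of m] by linarith
        then show ?thesis using xpos[of m] by (intro mult_left_mono) auto
      qed
      finally show "?x * exp (?x\<^sup>2 / 2) * (1 / 4) ^ Suc (N m) * exp (1 + 10 * (A\<^sup>2 * G m)) \<le> ?x * exp (1 + 2 * ?x - ?x\<^sup>2 / 2)" .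
    qed simp
    have "Q m \<le> p ((\<eta> m)\<^sup>2 / 2) m
      + exp (- (?x\<^sup>2 / 2) - 4 / 3 * ?T + A * G m - ?x * \<eta> m / 2)
      + exp (- (?x\<^sup>2 / 2) - 1 / 12 * ?T + A * G m - ?x * \<eta> m / 4)
      + real (N m) * exp (- (25 / 32 * ?x\<^sup>2) + \<bar>?T\<bar> + A * G m) + (1 / 4) ^ Suc (N m)"
      unfolding Q_def p_def G_def
      by (rule prob_upper[OF smallD(1)[OF small] xpos xh \<eta>pos])
    also have "\<dots> \<le> p ((\<eta> m)\<^sup>2 / 2) m
      + ?x * exp (3 - sqrt ?x / 4) / (?x * exp (?x\<^sup>2 / 2)) * ?Z
      + ?x * exp (3 - sqrt ?x / 4) / (?x * exp (?x\<^sup>2 / 2)) * ?Z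
      + (?x\<^sup>2 + 1) * ?x * exp (2 + 2 * ?x - 9 / 32 * ?x\<^sup>2) / (?x * exp (?x\<^sup>2 / 2)) * ?Z
      + ?x * exp (1 + 2 * ?x - ?x\<^sup>2 / 2) / (?x * exp (?x\<^sup>2 / 2)) * ?Z"
      by (intro add_mono order_refl 1 2 3 4)
    also have "\<dots> = p ((\<eta> m)\<^sup>2 / 2) m + e ?x / (?x * exp (?x\<^sup>2 / 2)) * ?Z"
      unfolding e_def mult_2 add_divide_distrib distrib_right by (simp only: add.assoc)
    finally show ?thesis .
  qed
  have err: "(\<lambda>m. e (x m) / (x m * exp ((x m)\<^sup>2 / 2)) * Zn (nn m) (h m) / R m) \<longlonglongrightarrow> 0"
  proof -
    have "(\<lambda>m. e (x m) / (x m * exp ((x m)\<^sup>2 / 2) * (1 - Phi (x m)))) \<longlonglongrightarrow> 0 / (1 / sqrt (2 * pi))"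
      by (intro tendsto_divide elim Mills_ratio xpos xinf) auto
    moreover have "e (x m) / (x m * exp ((x m)\<^sup>2 / 2)) * Zn (nn m) (h m) / R m =
        e (x m) / (x m * exp ((x m)\<^sup>2 / 2) * (1 - Phi (x m)))" for m
      using Zn_pos[OF small[of m], of "nn m"] by (simp add: R_def)
    ultimately show ?thesis by simp
  qed
  have plim: "(\<lambda>m. p d m / R m) \<longlonglongrightarrow> exp d" for d
    using prob_U_ge_ratio_tendsto[of d] unfolding p_def R_def .
  have "(\<lambda>m. Q m / R m) \<longlonglongrightarrow> 1"
  proof (rule order_tendstoI)
    fix a :: real assume a: "a < 1"
    have "\<forall>\<^sub>F m in sequentially. a < p 0 m / R m"
      using plim[of 0] a by (intro order_tendstoD) auto
    then show "\<forall>\<^sub>F m in sequentially. a < Q m / R m"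
    proof eventually_elim
      case (elim m)
      have "p 0 m \<le> Q m" using prob_lower[OF smallD(1)[OF small[of m]]] by (simp add: p_def Q_def)
      then have "p 0 m / R m \<le> Q m / R m" using R[of m] by (intro divide_right_mono) auto
      with elim show ?case by linarith
    qed
  next
    fix a :: real assume a: "1 < a"
    \<comment> \<open>The limit is known only for a fixed d, whereas \<eta>^2/2 varies with m. Once
      \<eta>^2/2 < d, monotonicity allows it to be replaced by this d, which satisfies exp d <
      a.\<close>
    define d where "d = ln a / 2"
    have d: "d > 0" "exp d < a" 
    proof -
      show "d > 0" using a by (simp add: d_def)
      have "exp d < exp (ln a)" using a unfolding exp_less_cancel_iff by (simp add: d_def)
      then show "exp d < a" using a by simp
    qed
    have "(\<lambda>m. p d m / R m + e (x m) / (x m * exp ((x m)\<^sup>2 / 2)) * Zn (nn m) (h m) / R m) \<longlonglongrightarrow> exp d + 0"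
      by (intro tendsto_add plim err)
    then have "\<forall>\<^sub>F m in sequentially. p d m / R m + e (x m) / (x m * exp ((x m)\<^sup>2 / 2)) * Zn (nn m) (h m) / R m < a"
      using d by (intro order_tendstoD) auto
    moreover have "\<forall>\<^sub>F m in sequentially. (\<eta> m)\<^sup>2 / 2 < d"
    proof -
      have "(\<lambda>m. (\<eta> m)\<^sup>2 / 2) \<longlonglongrightarrow> 0\<^sup>2 / 2" by (intro tendsto_intros \<eta>lim) auto
      then show ?thesis using d(1) by (intro order_tendstoD) auto
    qed
    ultimately show "\<forall>\<^sub>F m in sequentially. Q m / R m < a"
    proof eventually_elim
      case (elim m)
      have "p ((\<eta> m)\<^sup>2 / 2) m \<le> p d m"
        unfolding p_def using elim(2) U_measurable[OF smallD(1)[OF small[of m]]]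
        by (intro finite_measure_mono) auto
      then have "Q m \<le> p d m + e (x m) / (x m * exp ((x m)\<^sup>2 / 2)) * Zn (nn m) (h m)"
        using upper[of m] by linarith
      then have "Q m / R m \<le> (p d m + e (x m) / (x m * exp ((x m)\<^sup>2 / 2)) * Zn (nn m) (h m)) / R m"
        using R[of m] by (intro divide_right_mono) auto
      with elim(1) show ?case by (simp only: add_divide_distrib) 
    qed
  qed
  then show ?thesis unfolding Q_def R_def .
qed

end

end

section \<open>Verification of the growth conditions and extraction of the o(1) terms\<close>

theorem theorem3p3:
  fixes M :: "'a measure" and X :: "nat \<Rightarrow> 'a \<Rightarrow> real"
    and \<epsilon> Mb c \<gamma> \<rho> :: real and x :: "nat \<Rightarrow> real"
  assumes P: "prob_space M"
    and rv: "\<And>i. i \<ge> 1 \<Longrightarrow> X i \<in> borel_measurable M"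
    and indep: "prob_space.indep_vars M (\<lambda>_. borel) X {1..}"
    and nondeg: "\<And>i. i \<ge> 1 \<Longrightarrow> \<not> (\<exists>a. AE \<omega> in M. X i \<omega> = a)"
    and mean0: "\<And>i. i \<ge> 1 \<Longrightarrow> integral\<^sup>L M (X i) = 0"
    and eps: "\<epsilon> > 0"
    and mom_int: "\<And>i. i \<ge> 1 \<Longrightarrow> integrable M (\<lambda>\<omega>. \<bar>X i \<omega>\<bar> powr (4 + \<epsilon>))"
    and mom_bd: "\<And>i. i \<ge> 1 \<Longrightarrow> integral\<^sup>L M (\<lambda>\<omega>. \<bar>X i \<omega>\<bar> powr (4 + \<epsilon>)) \<le> Mb"
    and cpos: "c > 0"
    and Bn: "\<And>n. B_n_sq M X n \<ge> c * real n"
    and gam: "0 \<le> \<gamma>" "\<gamma> \<le> 1"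
    and rho: "\<rho> < 1/3"
    and cases:
      "((\<lambda>n. \<Sum>i=1..n. integral\<^sup>L M (\<lambda>\<omega>. (X i \<omega>)^3)) \<in> O(\<lambda>n. real n powr \<gamma>)
          \<and> x \<in> o(\<lambda>n. real n powr (1/2 - \<gamma>/3)) \<and> x \<in> O(\<lambda>n. real n powr \<rho>))
       \<or> ((\<lambda>n. \<Sum>i=1..n. integral\<^sup>L M (\<lambda>\<omega>. (X i \<omega>)^3)) \<in> o(\<lambda>n. real n powr \<gamma>)
          \<and> x \<in> O(\<lambda>n. real n powr (1/2 - \<gamma>/3)) \<and> x \<in> O(\<lambda>n. real n powr \<rho>))"
    and xinf: "filterlim x at_top sequentially"
  shows "\<exists>\<delta>1 \<delta>2 :: nat \<Rightarrow> real. \<delta>1 \<longlonglongrightarrow> 0 \<and> \<delta>2 \<longlonglongrightarrow> 0 \<and>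
    (\<forall>\<^sub>F n in sequentially.
       measure M {\<omega> \<in> space M. S_n X n \<omega> \<ge> x n * V_n X n \<omega>} / (1 - Phi (x n))
       = exp (- (1/12) * ((x n)^4 * (\<Sum>i=1..n. integral\<^sup>L M (\<lambda>\<omega>. (X i \<omega>)^4))
                          / (B_n_sq M X n)\<^sup>2) * (1 + \<delta>1 n)) * (1 + \<delta>2 n))"
proof -
  interpret prob_space M by (rule P)
  \<comment> \<open>The cap at 5 is the order of the Taylor remainder in
    \<open>exp_tilt_expansion\<close>.\<close>
  define r where "r = 4 + min \<epsilon> 1"
  \<comment> \<open>One unit comes from the summand 1 in the locale assumption, the other from |y|^r
    <= 1 + |y|^(4 + \<epsilon>).\<close>
  define L where "L = 2 + Mb"
  have r: "4 < r" "r \<le> 5" "r \<le> 4 + \<epsilon>" using eps by (auto simp: r_def)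
  obtain C where C: "C \<ge> 1"
    "\<And>y. \<bar>exp (tilt y) - (1 + y - y ^ 3 / 3 - y ^ 4 / 12)\<bar> \<le> C * \<bar>y\<bar> powr r"
    "\<And>y. \<bar>tilt y * exp (tilt y) - (y + y\<^sup>2 / 2 - y ^ 3 / 2)\<bar> \<le> C * y ^ 4"
    "\<And>y. \<bar>(tilt y)\<^sup>2 * exp (tilt y) - y\<^sup>2\<bar> \<le> C * \<bar>y\<bar> ^ 3"
    "\<And>y. \<bar>tilt y\<bar> ^ 3 * exp (tilt y) \<le> C * \<bar>y\<bar> ^ 3"
    "\<And>y \<theta>. \<theta> \<in> {3/2, 1/4, 1/8} \<Longrightarrow>
      exp (y - \<theta> * y\<^sup>2) \<le> 1 + y + (1/2 - \<theta>) * y\<^sup>2 + (1/6 - \<theta>) * y ^ 3 + C * y ^ 4"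
    using tilt_constants[of r] r by (metis less_imp_le)
  have powr_le: "\<bar>y\<bar> powr r \<le> 1 + \<bar>y\<bar> powr (4 + \<epsilon>)" for y :: real
  proof (cases "\<bar>y\<bar> \<le> 1")
    case True
    then have "\<bar>y\<bar> powr r \<le> 1 powr r" using r by (intro powr_mono2) auto
    then show ?thesis by (simp add: add_increasing2)
  next
    case False
    then have "\<bar>y\<bar> powr r \<le> \<bar>y\<bar> powr (4 + \<epsilon>)" using r by (intro powr_mono) auto
    then show ?thesis by simp
  qed
  have rint: "integrable M (\<lambda>\<omega>. \<bar>X i \<omega>\<bar> powr r)" if i: "i \<ge> 1" for i
  proof (rule Bochner_Integration.integrable_bound)
    show "integrable M (\<lambda>\<omega>. 1 + \<bar>X i \<omega>\<bar> powr (4 + \<epsilon>))" using mom_int[OF i] by simp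
    show "AE \<omega> in M. norm (\<bar>X i \<omega>\<bar> powr r) \<le> norm (1 + \<bar>X i \<omega>\<bar> powr (4 + \<epsilon>))"
      using powr_le by (intro AE_I2) simp
    show "(\<lambda>\<omega>. \<bar>X i \<omega>\<bar> powr r) \<in> borel_measurable M" using rv[OF i] by measurable
  qed
  interpret self_normalized M X r L c C
  proof
    show "1 + expectation (\<lambda>\<omega>. \<bar>X i \<omega>\<bar> powr r) \<le> L" if i: "i \<ge> 1" for i
    proof -
      have "expectation (\<lambda>\<omega>. \<bar>X i \<omega>\<bar> powr r) \<le> expectation (\<lambda>\<omega>. 1 + \<bar>X i \<omega>\<bar> powr (4 + \<epsilon>))"
        using rint[OF i] mom_int[OF i] powr_le by (intro integral_mono) auto
      also have "\<dots> \<le> 1 + Mb" using mom_int[OF i] mom_bd[OF i] by (simp add: prob_space)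
      finally show ?thesis by (simp add: L_def)
    qed
  qed (use rv indep mean0 r rint cpos Bn C in auto)

  define B where "B n = sqrt (B_n_sq M X n)" for n
  define h where "h n = x n / B n" for n
  define Pn where "Pn n = prob {\<omega> \<in> space M. x n * V_n X n \<omega> \<le> S_n X n \<omega>}" for n

  \<comment> \<open>x^3 = O(n^(3 \<rho>)) with 3 \<rho> < 1. The limits of x h^2, of h and of n h^4
    / x are all derived from this one.\<close>
  have x3n: "(\<lambda>n. x n ^ 3 / real n) \<longlonglongrightarrow> 0"
  proof -
    have "x \<in> O(\<lambda>n. real n powr \<rho>)" using cases by blast
    then have "(\<lambda>n. x n ^ 3) \<in> O(\<lambda>n. (real n powr \<rho>) ^ 3)" by (rule landau_o.big_power)
    also have "(\<lambda>n. (real n powr \<rho>) ^ 3) \<in> o(\<lambda>n. real n)" using rho by real_asymp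
    finally show ?thesis by (rule smalloD_tendsto)
  qed
  have S3: "(\<lambda>n. x n ^ 3 * (\<Sum>i=1..n. mom 3 i) / real n powr (3 / 2)) \<longlonglongrightarrow> 0"
  proof -
    \<comment> \<open>3 (1/2 - \<gamma>/3) + \<gamma> = 3/2 for every \<gamma>, so one little-o
      factor is enough, on x in case (a) and on the third moments in case (b).\<close>
    have eq: "(\<lambda>n. (real n powr (1/2 - \<gamma>/3)) ^ 3 * real n powr \<gamma>) \<in> O(\<lambda>n. real n powr (3 / 2))"
    proof (rule bigoI_tendsto)
      \<comment> \<open>At n = 0 every power \<open>real n powr a\<close> is 0 and the quotient is
        0, so the identity holds only for n > 0.\<close>
      have "\<forall>\<^sub>F n in sequentially. 1 = (real n powr (1/2 - \<gamma>/3)) ^ 3 * real n powr \<gamma> / real n powr (3 / 2)"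
        using eventually_gt_at_top[of 0]
      proof eventually_elim
        case (elim n)
        have "(real n powr (1/2 - \<gamma>/3)) ^ 3 * real n powr \<gamma> = real n powr (3 / 2)"
          using elim by (simp add: powr_power algebra_simps flip: powr_add)
        then show ?case using elim by simp
      qed
      then show "(\<lambda>n. (real n powr (1/2 - \<gamma>/3)) ^ 3 * real n powr \<gamma> / real n powr (3 / 2)) \<longlonglongrightarrow> 1"
        by (rule Lim_transform_eventually[OF tendsto_const])
      show "\<forall>\<^sub>F n in sequentially. real n powr (3 / 2) \<noteq> 0"
        using eventually_gt_at_top[of 0] by eventually_elim simp
    qed
    have "(\<lambda>n. x n ^ 3 * (\<Sum>i=1..n. mom 3 i)) \<in> o(\<lambda>n. (real n powr (1/2 - \<gamma>/3)) ^ 3 * real n powr \<gamma>)"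
      using cases unfolding mom_def[symmetric]
    proof (elim disjE conjE)
      assume "(\<lambda>n. \<Sum>i=1..n. mom 3 i) \<in> O(\<lambda>n. real n powr \<gamma>)" "x \<in> o(\<lambda>n. real n powr (1/2 - \<gamma>/3))"
      then show ?thesis by (intro landau_o.small_big_mult landau_o.small_power) auto
    next
      assume "(\<lambda>n. \<Sum>i=1..n. mom 3 i) \<in> o(\<lambda>n. real n powr \<gamma>)" "x \<in> O(\<lambda>n. real n powr (1/2 - \<gamma>/3))"
      then show ?thesis by (intro landau_o.big_small_mult landau_o.big_power) auto
    qed
    also note eq
    finally show ?thesis by (rule smalloD_tendsto)
  qed

  have base: "\<forall>\<^sub>F n in sequentially. n \<ge> 1 \<and> x n \<ge> 1 \<and> 0 < B_n_sq M X n"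
  proof -
    have "\<forall>\<^sub>F n in sequentially. x n \<ge> 1" using xinf by (simp add: filterlim_at_top)
    then show ?thesis using eventually_ge_at_top[of 1]
    proof eventually_elim
      case (elim n)
      have "0 < c * real n" using cpos elim by simp
      with Bn[of n] elim show ?case by linarith
    qed
  qed
  have Bsq: "(B n)\<^sup>2 = B_n_sq M X n" "0 < B n" if "0 < B_n_sq M X n" for n
    using that by (auto simp: B_def)
  have hsq: "(h n)\<^sup>2 \<le> 1 / c * ((x n)\<^sup>2 / real n)" if "n \<ge> 1" "x n \<ge> 1" "0 < B_n_sq M X n" for n
  proof -
    have "(h n)\<^sup>2 = (x n)\<^sup>2 / B_n_sq M X n" using Bsq(1)[OF that(3)] by (simp add: h_def power_divide)
    also have "\<dots> \<le> (x n)\<^sup>2 / (c * real n)" using Bn[of n] cpos that by (intro divide_left_mono) auto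
    finally show ?thesis by simp
  qed
  have dom: "\<forall>\<^sub>F n in sequentially. x n * (h n)\<^sup>2 \<le> 1 / c * (x n ^ 3 / real n)"
    using base
  proof eventually_elim
    case (elim n)
    then have "x n * (h n)\<^sup>2 \<le> x n * (1 / c * ((x n)\<^sup>2 / real n))" using hsq by (intro mult_left_mono) auto
    then show ?case by (simp add: power2_eq_square power3_eq_cube)
  qed
  have clim: "(\<lambda>n. 1 / c * (x n ^ 3 / real n)) \<longlonglongrightarrow> 0" by (rule tendsto_mult_right_zero[OF x3n])
  have xh2: "(\<lambda>n. x n * (h n)\<^sup>2) \<longlonglongrightarrow> 0"
  proof (rule tendsto_sandwich[OF _ dom tendsto_const clim])
    show "\<forall>\<^sub>F n in sequentially. 0 \<le> x n * (h n)\<^sup>2" using base by eventually_elim simp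
  qed
  have hlim: "h \<longlonglongrightarrow> 0"
  proof -
    have "(\<lambda>n. (h n)\<^sup>2) \<longlonglongrightarrow> 0"
    proof (rule tendsto_sandwich[OF _ _ tendsto_const xh2])
      show "\<forall>\<^sub>F n in sequentially. (h n)\<^sup>2 \<le> x n * (h n)\<^sup>2"
        using base by eventually_elim (simp add: mult_le_cancel_right1)
    qed simp
    then have "(\<lambda>n. sqrt ((h n)\<^sup>2)) \<longlonglongrightarrow> sqrt 0" by (rule tendsto_real_sqrt)
    then show ?thesis by (simp add: tendsto_rabs_zero_iff)
  qed
  have Glim: "(\<lambda>n. real n * h n ^ 4 / x n) \<longlonglongrightarrow> 0"
  proof (rule tendsto_sandwich[OF _ _ tendsto_const tendsto_mult_right_zero[OF clim, of "1 / c"]])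
    show "\<forall>\<^sub>F n in sequentially. 0 \<le> real n * h n ^ 4 / x n" using base by eventually_elim simp
    show "\<forall>\<^sub>F n in sequentially. real n * h n ^ 4 / x n \<le> 1 / c * (1 / c * (x n ^ 3 / real n))"
      using base
    proof eventually_elim
      case (elim n)
      then have "((h n)\<^sup>2)\<^sup>2 \<le> (1 / c * ((x n)\<^sup>2 / real n))\<^sup>2" using hsq by (intro power_mono) auto
      then have "real n * h n ^ 4 / x n \<le> real n * (1 / c * ((x n)\<^sup>2 / real n))\<^sup>2 / x n"
        using elim by (intro divide_right_mono mult_left_mono) (auto simp flip: power_mult)
      also have "\<dots> = 1 / c * (1 / c * (x n ^ 3 / real n))"
        using elim by (simp add: power2_eq_square power3_eq_cube)
      finally show ?case .
    qed
  qed
  have T3lim: "(\<lambda>n. T3 n (h n)) \<longlonglongrightarrow> 0"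
  proof (rule Lim_null_comparison)
    show "\<forall>\<^sub>F n in sequentially. norm (T3 n (h n)) \<le>
        1 / c powr (3 / 2) * \<bar>x n ^ 3 * (\<Sum>i=1..n. mom 3 i) / real n powr (3 / 2)\<bar>"
      using base
    proof eventually_elim
      case (elim n)
      have cn: "0 < c * real n" using elim cpos by simp
      have B0: "0 < B n" using elim Bsq(2) by blast
      have "sqrt (c * real n) \<le> B n" unfolding B_def using Bn[of n] by simp
      then have "sqrt (c * real n) ^ 3 \<le> B n ^ 3" using cn by (intro power_mono) auto
      moreover have "sqrt (c * real n) ^ 3 = c powr (3 / 2) * real n powr (3 / 2)"
        using cn cpos elim by (simp add: power_mult_distrib powr_power powr_mult flip: powr_half_sqrt)
      ultimately have le: "c powr (3 / 2) * real n powr (3 / 2) \<le> B n ^ 3" by simp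
      have "norm (T3 n (h n)) = \<bar>x n ^ 3 * (\<Sum>i=1..n. mom 3 i)\<bar> / B n ^ 3"
        using B0 by (simp add: T3_def h_def power_divide abs_mult)
      also have "\<dots> \<le> \<bar>x n ^ 3 * (\<Sum>i=1..n. mom 3 i)\<bar> / (c powr (3 / 2) * real n powr (3 / 2))"
        using le B0 cpos elim by (intro divide_left_mono) auto
      finally show ?case by (simp add: abs_divide)
    qed
    have "(\<lambda>n. 1 / c powr (3 / 2) * \<bar>x n ^ 3 * (\<Sum>i=1..n. mom 3 i) / real n powr (3 / 2)\<bar>) \<longlonglongrightarrow> 1 / c powr (3 / 2) * \<bar>0\<bar>"
      by (intro tendsto_intros S3)
    then show "(\<lambda>n. 1 / c powr (3 / 2) * \<bar>x n ^ 3 * (\<Sum>i=1..n. mom 3 i) / real n powr (3 / 2)\<bar>) \<longlonglongrightarrow> 0" by simp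
  qed

  have A0: "A > 0" using A_ge(1) by simp
  have "\<forall>\<^sub>F n in sequentially. x n \<ge> 1 \<and> small (h n) \<and> (x n)\<^sup>2 = (h n)\<^sup>2 * B_n_sq M X n \<and> h n \<le> \<kappa> \<and>
      10 * A ^ 3 * (real n * h n ^ 4) \<le> x n \<and> \<bar>T3 n (h n)\<bar> \<le> 1 \<and> n \<ge> 1"
  proof -
    have "\<forall>\<^sub>F n in sequentially. h n < 1 / (4 * A)" using hlim A0 by (intro order_tendstoD) auto
    moreover have "\<forall>\<^sub>F n in sequentially. h n < \<kappa>" using hlim kappa_pos by (intro order_tendstoD) auto
    moreover have "\<forall>\<^sub>F n in sequentially. real n * h n ^ 4 / x n < 1 / (10 * A ^ 3)"
      using Glim A0 by (intro order_tendstoD) auto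
    moreover have "\<forall>\<^sub>F n in sequentially. \<bar>T3 n (h n)\<bar> < 1"
      using tendsto_rabs_zero[OF T3lim] by (intro order_tendstoD) auto
    ultimately show ?thesis using base
    proof eventually_elim
      case (elim n)
      have x0: "x n > 0" using elim by linarith
      have B0: "0 < B n" using elim Bsq(2) by blast
      have "small (h n)" using elim A0 x0 B0 by (simp add: small_def h_def field_simps)
      moreover have "(x n)\<^sup>2 = (h n)\<^sup>2 * B_n_sq M X n"
        using elim Bsq(1)[of n] B0 by (simp add: h_def power_divide)
      moreover have "10 * A ^ 3 * (real n * h n ^ 4) \<le> x n"
        using elim(3) A0 x0 by (simp add: field_simps)
      ultimately show ?case using elim by auto
    qed
  qed
  then obtain N where N: "\<And>n. n \<ge> N \<Longrightarrow> x n \<ge> 1 \<and> small (h n) \<and> (x n)\<^sup>2 = (h n)\<^sup>2 * B_n_sq M X n \<and> h n \<le> \<kappa> \<and>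
      10 * A ^ 3 * (real n * h n ^ 4) \<le> x n \<and> \<bar>T3 n (h n)\<bar> \<le> 1 \<and> n \<ge> 1"
    unfolding eventually_sequentially by blast
  \<comment> \<open>The non-asymptotic conditions hold only from \<open>N\<close> on; shifting the
    index by \<open>N\<close> makes them true for every m, as the context requires.\<close>
  have ratio: "(\<lambda>n. Pn n / ((1 - Phi (x n)) * Zn n (h n))) \<longlonglongrightarrow> 1"
  proof (rule LIMSEQ_offset[where k = N])
    show "(\<lambda>m. Pn (m + N) / ((1 - Phi (x (m + N))) * Zn (m + N) (h (m + N)))) \<longlonglongrightarrow> 1"
      unfolding Pn_def
    proof (rule S_n_ratio_tendsto[where x = "\<lambda>m. x (m + N)" and h = "\<lambda>m. h (m + N)" and nn = "\<lambda>m. m + N"])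
      show "filterlim (\<lambda>m. x (m + N)) at_top sequentially"
        using filterlim_compose[OF xinf filterlim_add_const_nat_at_top] .
      fix m
      note Nm = N[OF le_add2[of N m]]
      show "x (m + N) \<ge> 1" "small (h (m + N))" "(x (m + N))\<^sup>2 = (h (m + N))\<^sup>2 * B_n_sq M X (m + N)"
        "h (m + N) \<le> \<kappa>" "10 * A ^ 3 * (real (m + N) * h (m + N) ^ 4) \<le> x (m + N)"
        "\<bar>T3 (m + N) (h (m + N))\<bar> \<le> 1"
        using Nm by blast+
    qed (rule LIMSEQ_ignore_initial_segment[OF hlim] LIMSEQ_ignore_initial_segment[OF Glim]
        LIMSEQ_ignore_initial_segment[OF xh2] LIMSEQ_ignore_initial_segment[OF T3lim])+
  qed

  \<comment> \<open>Solved from - T4 (1 + \<delta>1)/12 = ln Z + T3/3, so that \<delta>1 carries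
    exactly the error of \<open>ln_Zn_expansion\<close> relative to \<open>T4\<close>.\<close>
  define \<delta>1 where "\<delta>1 n = - 12 * (ln (Zn n (h n)) + T3 n (h n) / 3 + T4 n (h n) / 12) / T4 n (h n)" for n
  \<comment> \<open>T3 tends to 0 but need not be small relative to \<open>T4\<close>, so exp(-T3/3)
    goes into the outer factor and not into the exponent.\<close>
  define \<delta>2 where "\<delta>2 n = Pn n / ((1 - Phi (x n)) * Zn n (h n)) * exp (- T3 n (h n) / 3) - 1" for n
  have good: "0 < h n" "0 < T4 n (h n)" "\<bar>\<delta>1 n\<bar> \<le> 108 * A\<^sup>2 / c\<^sup>2 * h n powr (r - 4)"
    if "n \<ge> N" for n
  proof -
    have s: "small (h n)" and n: "real n > 0" using N[OF that] by auto
    show h0: "0 < h n" by (rule smallD(1)[OF s])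
    have g0: "0 < c\<^sup>2 * (real n * h n ^ 4)" using n h0 cpos by simp
    then show T4: "0 < T4 n (h n)" using T4_ge[OF h0, of n] by linarith
    have "\<bar>\<delta>1 n\<bar> = 12 * \<bar>ln (Zn n (h n)) + T3 n (h n) / 3 + T4 n (h n) / 12\<bar> / T4 n (h n)"
      using T4 unfolding \<delta>1_def abs_mult abs_divide by simp
    also have "\<dots> \<le> 12 * (9 * A\<^sup>2 * (real n * h n powr r)) / (c\<^sup>2 * (real n * h n ^ 4))"
      using ln_Zn_expansion[OF s, of n] T4_ge[OF h0, of n] g0 by (intro frac_le mult_left_mono) auto
    also have "\<dots> = 108 * A\<^sup>2 / c\<^sup>2 * (h n powr r / h n ^ 4)" using n by simp
    also have "h n ^ 4 = h n powr 4" using h0 powr_realpow[of "h n" 4] by simp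
    also have "h n powr r / h n powr 4 = h n powr (r - 4)" by (rule powr_diff[symmetric])
    finally show "\<bar>\<delta>1 n\<bar> \<le> 108 * A\<^sup>2 / c\<^sup>2 * h n powr (r - 4)" .
  qed
  have d1: "\<delta>1 \<longlonglongrightarrow> 0"
  proof (rule Lim_null_comparison)
    show "\<forall>\<^sub>F n in sequentially. norm (\<delta>1 n) \<le> 108 * A\<^sup>2 / c\<^sup>2 * h n powr (r - 4)"
      using good(3) by (auto simp: eventually_sequentially)
    have "\<forall>\<^sub>F n in sequentially. 0 \<le> h n"
      using good(1) less_imp_le unfolding eventually_sequentially by blast
    then have "(\<lambda>n. h n powr (r - 4)) \<longlonglongrightarrow> 0 powr (r - 4)"
      using r by (intro tendsto_powr' hlim tendsto_const) auto
    then show "(\<lambda>n. 108 * A\<^sup>2 / c\<^sup>2 * h n powr (r - 4)) \<longlonglongrightarrow> 0"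
      by (intro tendsto_mult_right_zero) simp
  qed
  have d2: "\<delta>2 \<longlonglongrightarrow> 0"
  proof -
    have "\<delta>2 \<longlonglongrightarrow> 1 * exp (- 0 / 3) - 1"
      unfolding \<delta>2_def by (intro tendsto_intros ratio T3lim) auto
    then show ?thesis by simp
  qed
  show ?thesis
  proof (rule exI[of _ \<delta>1], rule exI[of _ \<delta>2], intro conjI d1 d2)
    show "\<forall>\<^sub>F n in sequentially.
       prob {\<omega> \<in> space M. S_n X n \<omega> \<ge> x n * V_n X n \<omega>} / (1 - Phi (x n))
       = exp (- (1/12) * ((x n)^4 * (\<Sum>i=1..n. expectation (\<lambda>\<omega>. (X i \<omega>)^4))
                          / (B_n_sq M X n)\<^sup>2) * (1 + \<delta>1 n)) * (1 + \<delta>2 n)"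
      using base eventually_ge_at_top[of N]
    proof eventually_elim
      case (elim n)
      have s: "small (h n)" using N[OF elim(2)] by blast
      have Z: "Zn n (h n) > 0" by (rule Zn_pos[OF s])
      have T4: "T4 n (h n) > 0" by (rule good(2)[OF elim(2)])
      \<comment> \<open>\<open>B_n_sq\<close> is already a square, so the square of it in the
        statement is B_n^4, matching h^4 = x^4 / B_n^4 in \<open>T4\<close>.\<close>
      have "B n ^ 4 = ((B n)\<^sup>2)\<^sup>2" by (simp flip: power_mult)
      then have "B n ^ 4 = (B_n_sq M X n)\<^sup>2" using Bsq(1)[of n] elim by simp
      then have T4eq: "(x n)^4 * (\<Sum>i=1..n. expectation (\<lambda>\<omega>. (X i \<omega>)^4)) / (B_n_sq M X n)\<^sup>2 = T4 n (h n)"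
        by (simp add: T4_def mom_def h_def power_divide)
      have "- (1/12) * T4 n (h n) * (1 + \<delta>1 n) = ln (Zn n (h n)) + T3 n (h n) / 3"
        using T4 by (simp add: \<delta>1_def field_simps)
      then have "exp (- (1/12) * T4 n (h n) * (1 + \<delta>1 n)) = Zn n (h n) * exp (T3 n (h n) / 3)"
        using Z by (simp add: exp_add)
      then have "exp (- (1/12) * T4 n (h n) * (1 + \<delta>1 n)) * (1 + \<delta>2 n) = Pn n / (1 - Phi (x n))"
        using Z by (simp add: \<delta>2_def exp_minus)
      then show ?case unfolding T4eq Pn_def by simp
    qed
  qed
qed

end
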